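(* Let $\Omega\subset\mathbb{R}^n$ be an open and bounded domain, and let $f\in L^2(\Omega)$, $f\ge 0$, $f\neq 0$. Let $u(t)$ be the solution of the gradient flow $$u'(t)+\partial\mathcal{J}(u(t))\ni 0,\qquad u(0)=f,$$ and denote the finite extinction time of the flow by $T$. Then $u(t)/\|u(t)\|_2$ converges strongly in $L^2(\Omega)$, as $t\nearrow T$, to a multiple of the distance function $x\mapsto\operatorname{dist}(x,\partial\Omega)$.
   Context: $W^{1,\infty}_0(\Omega)=\{u\in W^{1,\infty}(\Omega): u=0\text{ on }\partial\Omega\}$ (Lipschitz functions vanishing on $\partial\Omega$). $\mathcal{J}:L^2(\Omega)\to[0,\infty]$ is $\mathcal{J}(u)=\|\nabla u\|_\infty$ if $u\in W^{1,\infty}_0(\Omega)$ and $+\infty$ otherwise; $\partial\mathcal{J}$ is its convex subdifferential in the Hilbert space $L^2(\Omega)$. The gradient flow is the $L^2(\Omega)$ gradient flow (evolution equation governed by the maximal monotone operator $\partial\mathcal{J}$). The extinction time is $T=\inf\{t>0:u(t)=0\}$. *)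

theory Defs
  imports "HOL-Analysis.Analysis" "HOL-Probability.Essential_Supremum"
begin

text \<open>
  Elements of \<open>L\<^sup>2(\<Omega>)\<close> are represented by real functions on the whole space of which only the
  values on \<open>\<Omega>\<close> matter; two representatives denote the same element iff they agree almost
  everywhere with respect to \<open>lebesgue_on \<Omega>\<close>. Everything below is invariant under this
  identification.
\<close>

definition L2 :: "'a::euclidean_space set \<Rightarrow> ('a \<Rightarrow> real) set" where
  "L2 \<Omega> = {u. u \<in> borel_measurable (lebesgue_on \<Omega>) \<and> integrable (lebesgue_on \<Omega>) (\<lambda>x. (u x)\<^sup>2)}"

definition L2_inner :: "'a::euclidean_space set \<Rightarrow> ('a \<Rightarrow> real) \<Rightarrow> ('a \<Rightarrow> real) \<Rightarrow> real" where
  "L2_inner \<Omega> u v = (LINT x|lebesgue_on \<Omega>. u x * v x)"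

definition L2_norm :: "'a::euclidean_space set \<Rightarrow> ('a \<Rightarrow> real) \<Rightarrow> real" where
  "L2_norm \<Omega> u = sqrt (L2_inner \<Omega> u u)"

subsection \<open>The space \<open>W\<^sup>1\<^sup>,\<^sup>\<infinity>\<close> and the functional\<close>

fun continuously_differentiable :: "nat \<Rightarrow> ('a::euclidean_space \<Rightarrow> real) \<Rightarrow> bool" where
  "continuously_differentiable 0 \<phi> \<longleftrightarrow> continuous_on UNIV \<phi>"
| "continuously_differentiable (Suc k) \<phi> \<longleftrightarrow>
     (\<forall>x. \<phi> differentiable (at x)) \<and>
     (\<forall>b\<in>Basis. continuously_differentiable k (\<lambda>x. frechet_derivative \<phi> (at x) b))"

definition test_functions :: "'a::euclidean_space set \<Rightarrow> ('a \<Rightarrow> real) set" where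
  "test_functions \<Omega> = {\<phi>. (\<forall>k. continuously_differentiable k \<phi>) \<and>
     compact (closure {x. \<phi> x \<noteq> 0}) \<and> closure {x. \<phi> x \<noteq> 0} \<subseteq> \<Omega>}"

definition locally_integrable ::
    "'a::euclidean_space set \<Rightarrow> ('a \<Rightarrow> 'b::euclidean_space) \<Rightarrow> bool" where
  "locally_integrable \<Omega> g \<longleftrightarrow>
     g \<in> borel_measurable (lebesgue_on \<Omega>) \<and>
     (\<forall>K. compact K \<and> K \<subseteq> \<Omega> \<longrightarrow> integrable (lebesgue_on K) g)"

definition has_weak_gradient ::
    "'a::euclidean_space set \<Rightarrow> ('a \<Rightarrow> real) \<Rightarrow> ('a \<Rightarrow> 'a) \<Rightarrow> bool" where
  "has_weak_gradient \<Omega> u g \<longleftrightarrow>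
     locally_integrable \<Omega> u \<and> locally_integrable \<Omega> g \<and>
     (\<forall>\<phi>\<in>test_functions \<Omega>. \<forall>b\<in>Basis.
        (LINT x|lebesgue_on \<Omega>. u x * frechet_derivative \<phi> (at x) b) =
        - (LINT x|lebesgue_on \<Omega>. (g x \<bullet> b) * \<phi> x))"

text \<open>Weak gradients are unique only up to null sets, hence a choice of a representative.\<close>

definition weak_gradient :: "'a::euclidean_space set \<Rightarrow> ('a \<Rightarrow> real) \<Rightarrow> 'a \<Rightarrow> 'a" where
  "weak_gradient \<Omega> u = (SOME g. has_weak_gradient \<Omega> u g)"

definition Linf_norm ::
    "'a::euclidean_space set \<Rightarrow> ('a \<Rightarrow> 'b::euclidean_space) \<Rightarrow> ereal" where
  "Linf_norm \<Omega> g = esssup (lebesgue_on \<Omega>) (\<lambda>x. ereal (norm (g x)))"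

definition Linf ::
    "'a::euclidean_space set \<Rightarrow> ('a \<Rightarrow> 'b::euclidean_space) set" where
  "Linf \<Omega> = {g. g \<in> borel_measurable (lebesgue_on \<Omega>) \<and> Linf_norm \<Omega> g < \<infinity>}"

definition W1inf :: "'a::euclidean_space set \<Rightarrow> ('a \<Rightarrow> real) set" where
  "W1inf \<Omega> = {u \<in> Linf \<Omega>. \<exists>g\<in>Linf \<Omega>. has_weak_gradient \<Omega> u g}"

text \<open>
  The boundary condition is pointwise: \<open>u\<close> has a representative that is continuous up to
  the boundary and vanishes there. No regularity of the boundary is involved.
\<close>

definition W1inf0 :: "'a::euclidean_space set \<Rightarrow> ('a \<Rightarrow> real) set" where
  "W1inf0 \<Omega> = {u \<in> W1inf \<Omega>. \<exists>v. continuous_on (closure \<Omega>) v \<and>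
     (\<forall>x\<in>frontier \<Omega>. v x = 0) \<and> (AE x in lebesgue_on \<Omega>. u x = v x)}"

definition grad_sup_functional :: "'a::euclidean_space set \<Rightarrow> ('a \<Rightarrow> real) \<Rightarrow> ereal" where
  "grad_sup_functional \<Omega> u =
     (if u \<in> W1inf0 \<Omega> then Linf_norm \<Omega> (weak_gradient \<Omega> u) else \<infinity>)"

subsection \<open>Subdifferential and gradient flow in \<open>L\<^sup>2\<close>\<close>

definition L2_subdifferential ::
    "'a::euclidean_space set \<Rightarrow> (('a \<Rightarrow> real) \<Rightarrow> ereal) \<Rightarrow> ('a \<Rightarrow> real) \<Rightarrow> ('a \<Rightarrow> real) set" where
  "L2_subdifferential \<Omega> E u = {p \<in> L2 \<Omega>. u \<in> L2 \<Omega> \<and> \<bar>E u\<bar> \<noteq> \<infinity> \<and>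
     (\<forall>v\<in>L2 \<Omega>. E u + ereal (L2_inner \<Omega> p (\<lambda>x. v x - u x)) \<le> E v)}"

definition L2_has_derivative_at ::
    "'a::euclidean_space set \<Rightarrow> (real \<Rightarrow> 'a \<Rightarrow> real) \<Rightarrow> ('a \<Rightarrow> real) \<Rightarrow> real \<Rightarrow> bool" where
  "L2_has_derivative_at \<Omega> u w t \<longleftrightarrow> w \<in> L2 \<Omega> \<and>
     ((\<lambda>s. L2_norm \<Omega> (\<lambda>x. (u s x - u t x) / (s - t) - w x)) \<longlongrightarrow> 0) (at t)"

text \<open>A pair \<open>(r, s)\<close> encodes the interval from \<open>r\<close> to \<open>s\<close>.\<close>

definition L2_absolutely_continuous_on ::
    "'a::euclidean_space set \<Rightarrow> real \<Rightarrow> real \<Rightarrow> (real \<Rightarrow> 'a \<Rightarrow> real) \<Rightarrow> bool" where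
  "L2_absolutely_continuous_on \<Omega> a b u \<longleftrightarrow>
     (\<forall>\<epsilon>>0. \<exists>\<delta>>0. \<forall>S. finite S \<and> (\<forall>(r, s)\<in>S. a \<le> r \<and> r \<le> s \<and> s \<le> b) \<and>
        disjoint_family_on (\<lambda>(r, s). {r<..<s}) S \<and> (\<Sum>(r, s)\<in>S. s - r) < \<delta> \<longrightarrow>
        (\<Sum>(r, s)\<in>S. L2_norm \<Omega> (\<lambda>x. u s x - u r x)) < \<epsilon>)"

text \<open>
  Strong solutions (in the sense of Brezis) of \<open>u'(t) + \<partial>E(u(t)) \<ni> 0\<close>, \<open>u(0) = f\<close>: continuous on
  \<open>[0, \<infinity>)\<close>, absolutely continuous on compact subintervals of \<open>(0, \<infinity>)\<close>, and satisfying the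
  inclusion for almost every \<open>t > 0\<close>. Values of \<open>u\<close> at negative times are irrelevant.
\<close>

definition L2_gradient_flow ::
    "'a::euclidean_space set \<Rightarrow> (('a \<Rightarrow> real) \<Rightarrow> ereal) \<Rightarrow> ('a \<Rightarrow> real) \<Rightarrow>
      (real \<Rightarrow> 'a \<Rightarrow> real) \<Rightarrow> bool" where
  "L2_gradient_flow \<Omega> E f u \<longleftrightarrow>
     (\<forall>t\<ge>0. u t \<in> L2 \<Omega>) \<and>
     (\<forall>t\<ge>0. ((\<lambda>s. L2_norm \<Omega> (\<lambda>x. u s x - u t x)) \<longlongrightarrow> 0) (at t within {0..})) \<and>
     (\<forall>a b. 0 < a \<and> a \<le> b \<longrightarrow> L2_absolutely_continuous_on \<Omega> a b u) \<and>
     (AE x in lebesgue_on \<Omega>. u 0 x = f x) \<and>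
     (AE t in lebesgue. 0 < t \<longrightarrow>
        (\<exists>w. L2_has_derivative_at \<Omega> u w t \<and>
             (\<lambda>x. - w x) \<in> L2_subdifferential \<Omega> E (u t)))"

text \<open>The infimum is taken in the extended reals, so it is \<open>\<infinity>\<close> if the flow never vanishes.\<close>

definition extinction_time :: "'a::euclidean_space set \<Rightarrow> (real \<Rightarrow> 'a \<Rightarrow> real) \<Rightarrow> ereal" where
  "extinction_time \<Omega> u = Inf (ereal ` {t. 0 < t \<and> (AE x in lebesgue_on \<Omega>. u t x = 0)})"

end

theory Submission
  imports Defs "HOL-Complex_Analysis.Great_Picard"
begin

text \<open>
  Let \<open>d\<close> be the distance to the boundary. A function in \<open>W\<^sup>1\<^sup>,\<^sup>\<infinity>\<^sub>0\<close> with \<open>J v \<le> L\<close> has an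
  \<open>L\<close>-Lipschitz representative vanishing outside \<open>\<Omega>\<close>, hence \<open>\<bar>v\<bar> \<le> L d\<close>, and the Rayleigh
  quotient \<open>R = J v / \<parallel>v\<parallel>\<close> is at least \<open>1 / \<parallel>d\<parallel>\<close>. If \<open>0 \<le> v\<close> and \<open>R\<close> is close to \<open>1 / \<parallel>d\<parallel>\<close>,
  then \<open>\<parallel>R d - v / \<parallel>v\<parallel>\<parallel>\<^sup>2 \<le> R\<^sup>2 \<parallel>d\<parallel>\<^sup>2 - 1\<close> is small; so it is enough that
  \<open>R (u t) \<rightarrow> 1 / \<parallel>d\<parallel>\<close> as \<open>t \<rightarrow> T\<close>.

  Write \<open>p = - u' t\<close>. Comparing the flow with its rescalings \<open>a u(s + \<tau> / a)\<close> gives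
  \<open>(t - s) \<parallel>p t\<parallel> \<le> \<parallel>u s\<parallel>\<close> for \<open>s < t\<close>. With \<open>P = inf\<^sub>s \<parallel>u s\<parallel> / (T - s)\<close> it follows that
  \<open>R (u t) \<le> \<parallel>p t\<parallel> \<le> P + o(1)\<close>, whereas \<open>d/dt \<parallel>u t\<parallel> = - R (u t)\<close> forces \<open>R (u t) \<ge> P - o(1)\<close>
  along some sequence of times \<open>t \<rightarrow> T\<close>. Along it \<open>p - R u / \<parallel>u\<parallel> \<rightarrow> 0\<close>, and by Arzela-Ascoli a
  subsequence of \<open>u / \<parallel>u\<parallel>\<close> converges uniformly to some \<open>g\<close> with \<open>0 \<le> g \<le> P d\<close>, \<open>\<parallel>g\<parallel> = 1\<close> and
  \<open>g (P d - g) = 0\<close>. As \<open>\<Omega>\<close> is connected, \<open>g = P d\<close>, so \<open>P = 1 / \<parallel>d\<parallel>\<close>.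
\<close>

section \<open>Absolutely continuous curves\<close>

text \<open>Compactness gives information only along one sequence of times, and its sole task is to
  find the number \<open>P\<close>. What reaches every time is the upper bound on
  \<open>norm p\<close>: it holds at all good times near \<open>T\<close>, so once \<open>P\<close>
  is known it bounds the distance of the normalized state from the limit there, and continuity of
  the flow covers the remaining null set of times. Connectedness excludes one competitor: on a
  disconnected domain, a function equal to \<open>P d\<close> on some components and to 0 on the
  others satisfies the same relations as \<open>g\<close>. The second obstacle is that the
  comparison functions (\<open>d\<close>, positive parts, multiples of representatives) are merely
  Lipschitz, and that such functions have weak gradients is Rademacher's theorem. This is bypassed:
  the subgradient inequality is tested with mollified truncations only, and the limit is taken in
  the inequality. Afterwards the functional is seen only through the Lipschitz constants of
  representatives that vanish outside \<Omega>. The inclusion holds at almost every time; each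
  differential inequality is integrated by means of absolute continuity in norm.\<close>

definition absolutely_continuous_dist :: "real \<Rightarrow> real \<Rightarrow> (real \<Rightarrow> real \<Rightarrow> real) \<Rightarrow> bool" where
  "absolutely_continuous_dist a b \<rho> \<longleftrightarrow>
     (\<forall>\<epsilon>>0. \<exists>\<delta>>0. \<forall>S. finite S \<and> (\<forall>(r, s)\<in>S. a \<le> r \<and> r \<le> s \<and> s \<le> b) \<and>
        disjoint_family_on (\<lambda>(r, s). {r<..<s}) S \<and> (\<Sum>(r, s)\<in>S. s - r) < \<delta> \<longrightarrow>
        (\<Sum>(r, s)\<in>S. \<rho> r s) < \<epsilon>)"

text \<open>This is the reason for a general increment \<open>\<rho>\<close> in place of the norm of
  one curve: \<open>scaled_contraction\<close> needs the sum of the increments of two reparametrized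
  copies of the flow.\<close>

lemma absolutely_continuous_dist_add:
  assumes "absolutely_continuous_dist a b \<rho>" "absolutely_continuous_dist a b \<sigma>"
  shows "absolutely_continuous_dist a b (\<lambda>r s. \<rho> r s + \<sigma> r s)"
  unfolding absolutely_continuous_dist_def
proof (intro allI impI)
  fix \<epsilon> :: real assume "\<epsilon> > 0"
  then have e2: "\<epsilon>/2 > 0" by simp
  obtain d1 where d1: "d1 > 0" "\<And>S. finite S \<and> (\<forall>(r, s)\<in>S. a \<le> r \<and> r \<le> s \<and> s \<le> b) \<and>
        disjoint_family_on (\<lambda>(r, s). {r<..<s}) S \<and> (\<Sum>(r, s)\<in>S. s - r) < d1 \<Longrightarrow>
        (\<Sum>(r, s)\<in>S. \<rho> r s) < \<epsilon>/2"
    using assms(1)[unfolded absolutely_continuous_dist_def] e2 by meson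
  obtain d2 where d2: "d2 > 0" "\<And>S. finite S \<and> (\<forall>(r, s)\<in>S. a \<le> r \<and> r \<le> s \<and> s \<le> b) \<and>
        disjoint_family_on (\<lambda>(r, s). {r<..<s}) S \<and> (\<Sum>(r, s)\<in>S. s - r) < d2 \<Longrightarrow>
        (\<Sum>(r, s)\<in>S. \<sigma> r s) < \<epsilon>/2"
    using assms(2)[unfolded absolutely_continuous_dist_def] e2 by meson
  show "\<exists>\<delta>>0. \<forall>S. finite S \<and> (\<forall>(r, s)\<in>S. a \<le> r \<and> r \<le> s \<and> s \<le> b) \<and>
        disjoint_family_on (\<lambda>(r, s). {r<..<s}) S \<and> (\<Sum>(r, s)\<in>S. s - r) < \<delta> \<longrightarrow>
        (\<Sum>(r, s)\<in>S. \<rho> r s + \<sigma> r s) < \<epsilon>"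
  proof (intro exI[of _ "min d1 d2"] conjI allI impI)
    fix S assume S: "finite S \<and> (\<forall>(r, s)\<in>S. a \<le> r \<and> r \<le> s \<and> s \<le> b) \<and>
        disjoint_family_on (\<lambda>(r, s). {r<..<s}) S \<and> (\<Sum>(r, s)\<in>S. s - r) < min d1 d2"
    have "(\<Sum>(r, s)\<in>S. \<rho> r s) < \<epsilon>/2" "(\<Sum>(r, s)\<in>S. \<sigma> r s) < \<epsilon>/2"
      using d1(2)[of S] d2(2)[of S] S by auto
    then show "(\<Sum>(r, s)\<in>S. \<rho> r s + \<sigma> r s) < \<epsilon>"
      by (simp add: case_prod_beta sum.distrib)
  qed (use d1 d2 in auto)
qed

lemma absolutely_continuous_dist_affine:
  assumes "absolutely_continuous_dist (c + m * a) (c + m * b) \<rho>" "m > 0"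
  shows "absolutely_continuous_dist a b (\<lambda>r s. \<rho> (c + m * r) (c + m * s))"
  unfolding absolutely_continuous_dist_def
proof (intro allI impI)
  fix \<epsilon> :: real assume "\<epsilon> > 0"
  obtain d where d: "d > 0" "\<And>S. finite S \<and> (\<forall>(r, s)\<in>S. c + m * a \<le> r \<and> r \<le> s \<and> s \<le> c + m * b) \<and>
        disjoint_family_on (\<lambda>(r, s). {r<..<s}) S \<and> (\<Sum>(r, s)\<in>S. s - r) < d \<Longrightarrow>
        (\<Sum>(r, s)\<in>S. \<rho> r s) < \<epsilon>"
    using assms(1)[unfolded absolutely_continuous_dist_def] \<open>\<epsilon> > 0\<close> by meson
  show "\<exists>\<delta>>0. \<forall>S. finite S \<and> (\<forall>(r, s)\<in>S. a \<le> r \<and> r \<le> s \<and> s \<le> b) \<and>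
        disjoint_family_on (\<lambda>(r, s). {r<..<s}) S \<and> (\<Sum>(r, s)\<in>S. s - r) < \<delta> \<longrightarrow>
        (\<Sum>(r, s)\<in>S. \<rho> (c + m * r) (c + m * s)) < \<epsilon>"
  proof (intro exI[of _ "d / m"] conjI allI impI)
    fix S assume S: "finite S \<and> (\<forall>(r, s)\<in>S. a \<le> r \<and> r \<le> s \<and> s \<le> b) \<and>
        disjoint_family_on (\<lambda>(r, s). {r<..<s}) S \<and> (\<Sum>(r, s)\<in>S. s - r) < d / m"
    define g where "g = (\<lambda>(r::real, s::real). (c + m * r, c + m * s))"
    have inj: "inj_on g S"
      using \<open>m > 0\<close> by (auto simp: inj_on_def g_def)
    have 1: "(\<Sum>(r, s)\<in>g ` S. s - r) = m * (\<Sum>(r, s)\<in>S. s - r)"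
      unfolding sum.reindex[OF inj] by (simp add: g_def case_prod_beta sum_distrib_left algebra_simps)
    have dis: "{fst x<..<snd x} \<inter> {fst y<..<snd y} = {}" if "x \<in> S" "y \<in> S" "x \<noteq> y" for x y
      using S that unfolding disjoint_family_on_def by (auto simp: case_prod_beta)
    have 2: "disjoint_family_on (\<lambda>(r, s). {r<..<s}) (g ` S)"
      unfolding disjoint_family_on_def
    proof (intro ballI impI)
      fix x' y' assume "x' \<in> g ` S" "y' \<in> g ` S" and ne: "x' \<noteq> y'"
      then obtain x y where xy: "x \<in> S" "y \<in> S" "x' = g x" "y' = g y" by auto
      have "x \<noteq> y" using ne xy by auto
      have "False" if z: "z \<in> (case x' of (r,s) \<Rightarrow> {r<..<s}) \<inter> (case y' of (r,s) \<Rightarrow> {r<..<s})" for z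
      proof -
        have "(z - c) / m \<in> {fst x<..<snd x} \<inter> {fst y<..<snd y}"
          using z \<open>m > 0\<close> xy by (auto simp: g_def case_prod_beta field_simps)
        then show False using dis[OF xy(1,2) \<open>x \<noteq> y\<close>] by auto
      qed
      then show "(case x' of (r,s) \<Rightarrow> {r<..<s}) \<inter> (case y' of (r,s) \<Rightarrow> {r<..<s}) = {}" by blast
    qed
    have "(\<Sum>(r, s)\<in>g ` S. \<rho> r s) < \<epsilon>"
    proof (rule d(2), intro conjI)
      show "\<forall>(r, s)\<in>g ` S. c + m * a \<le> r \<and> r \<le> s \<and> s \<le> c + m * b"
        using S \<open>m > 0\<close> by (force simp: g_def)
      show "(\<Sum>(r, s)\<in>g ` S. s - r) < d" using S 1 \<open>m > 0\<close> by (simp add: field_simps)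
    qed (use S 2 in auto)
    then show "(\<Sum>(r, s)\<in>S. \<rho> (c + m * r) (c + m * s)) < \<epsilon>"
      unfolding sum.reindex[OF inj] by (simp add: g_def case_prod_beta)
  qed (use d \<open>m > 0\<close> in auto)
qed

lemma tagged_division_pieces:
  assumes "p tagged_division_of {a..b::real}" "(x, K) \<in> p"
  shows "K = {Inf K..Sup K}" "Inf K \<le> x" "x \<le> Sup K" "a \<le> Inf K" "Sup K \<le> b"
    "{Inf K<..<Sup K} \<subseteq> K"
proof -
  obtain c d where K: "K = {c..d}" "x \<in> K" "K \<subseteq> {a..b}"
    using tagged_division_ofD(2,3,4)[OF assms] by auto
  then have "c \<le> d" by auto
  then have "Inf K = c" "Sup K = d" using K by auto
  then show "K = {Inf K..Sup K}" "Inf K \<le> x" "x \<le> Sup K" "a \<le> Inf K" "Sup K \<le> b"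
    "{Inf K<..<Sup K} \<subseteq> K"
    using K \<open>c \<le> d\<close> by auto
qed

text \<open>A Cousin-type argument: tags off the null set are controlled by the derivative, the
  remaining pieces lie in an open set of small measure and are controlled by absolute
  continuity.\<close>

lemma nonincreasing_if_derivative_nonpos_AE:
  fixes F :: "real \<Rightarrow> real"
  assumes "a \<le> b" "C \<ge> 0" and ac: "absolutely_continuous_dist a b \<rho>"
    and bound: "\<And>r s. a \<le> r \<Longrightarrow> r \<le> s \<Longrightarrow> s \<le> b \<Longrightarrow> F s - F r \<le> C * (\<rho> r s + (s - r))"
    and Z: "negligible Z"
    and der: "\<And>t. a < t \<Longrightarrow> t < b \<Longrightarrow> t \<notin> Z \<Longrightarrow> \<exists>D\<le>0. (F has_real_derivative D) (at t)"
  shows "F b \<le> F a"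
proof -
  have main: "F b - F a \<le> \<epsilon> * (b - a) + 2 * C * \<epsilon>" if "\<epsilon> > 0" for \<epsilon>
  proof -
    obtain \<delta> where d: "\<delta> > 0" "\<And>S. finite S \<and> (\<forall>(r, s)\<in>S. a \<le> r \<and> r \<le> s \<and> s \<le> b) \<and>
        disjoint_family_on (\<lambda>(r, s). {r<..<s}) S \<and> (\<Sum>(r, s)\<in>S. s - r) < \<delta> \<Longrightarrow>
        (\<Sum>(r, s)\<in>S. \<rho> r s) < \<epsilon>"
      using ac[unfolded absolutely_continuous_dist_def] \<open>\<epsilon> > 0\<close> by meson
    \<comment> \<open>The derivative is assumed in the open interval only. Adding the endpoints
      keeps the set null and sends pieces tagged there to the part controlled by absolute
      continuity.\<close>
    define Y where "Y = Z \<union> {a, b}"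
    have negY: "negligible Y"
      unfolding Y_def using Z by (intro negligible_Un) auto
    then have "Y \<in> sets lebesgue" "emeasure lebesgue Y = 0"
      by (auto simp: negligible_iff_null_sets null_sets_def)
    moreover have "min \<delta> \<epsilon> > 0" using d \<open>\<epsilon> > 0\<close> by auto
    \<comment> \<open>Measure below \<delta> triggers absolute continuity for the pieces inside
      \<open>U\<close>; measure below \<epsilon> bounds the term \<open>s - r\<close> in
      \<open>bound\<close>.\<close>
    ultimately obtain U where U: "open U" "Y \<subseteq> U" "U - Y \<in> lmeasurable" "emeasure lebesgue (U - Y) < ennreal (min \<delta> \<epsilon>)"
      using sets_lebesgue_outer_open[of Y "min \<delta> \<epsilon>"] by metis
    have U_eq: "U = (U - Y) \<union> Y" using U(2) by auto
    have Ulm: "U \<in> lmeasurable"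
      using U(3) negY U_eq by (metis fmeasurable.Un negligible_imp_measurable)
    have mU: "measure lebesgue U < min \<delta> \<epsilon>"
    proof -
      have "measure lebesgue U = measure lebesgue (U - Y)"
        using negY U_eq U(3)
        by (metis Un_commute measure_Un_null_set negligible_iff_null_sets fmeasurableD sup_commute)
      also have "\<dots> < min \<delta> \<epsilon>"
        using U(3,4) \<open>min \<delta> \<epsilon> > 0\<close> by (simp add: emeasure_eq_measure2 ennreal_less_iff)
      finally show ?thesis .
    qed
    have ex: "\<exists>e>0. if t \<in> Y then ball t e \<subseteq> U else
       a < t \<and> t < b \<longrightarrow> (\<forall>y. dist y t < e \<longrightarrow> (y \<ge> t \<longrightarrow> F y - F t \<le> \<epsilon> * (y - t)) \<and> (y \<le> t \<longrightarrow> F t - F y \<le> \<epsilon> * (t - y)))" for t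
    proof (cases "t \<in> Y")
      case True
      then show ?thesis using U(1,2) by (auto simp: open_contains_ball)
    next
      case False
      show ?thesis
      proof (cases "a < t \<and> t < b")
        case True
        then obtain D where D: "D \<le> 0" "(F has_real_derivative D) (at t)"
          using der False unfolding Y_def by blast
        then have "(F has_derivative (\<lambda>h. D * h)) (at t)"
          by (simp add: has_field_derivative_def)
        then obtain e where e: "e > 0" "\<And>y. norm (y - t) < e \<Longrightarrow> norm (F y - F t - D * (y - t)) \<le> \<epsilon> * norm (y - t)"
          unfolding has_derivative_at_alt using \<open>\<epsilon> > 0\<close> by blast
        have "(y \<ge> t \<longrightarrow> F y - F t \<le> \<epsilon> * (y - t)) \<and> (y \<le> t \<longrightarrow> F t - F y \<le> \<epsilon> * (t - y))" if "dist y t < e" for y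
        proof -
          have *: "\<bar>F y - F t - D * (y - t)\<bar> \<le> \<epsilon> * \<bar>y - t\<bar>"
            using e(2)[of y] that by (simp add: dist_norm)
          have "y \<ge> t \<Longrightarrow> D * (y - t) \<le> 0" "y \<le> t \<Longrightarrow> D * (y - t) \<ge> 0"
            using D(1) by (auto simp: mult_nonpos_nonneg mult_nonpos_nonpos)
          then show ?thesis using * by (auto simp: abs_if algebra_simps split: if_splits)
        qed
        then show ?thesis using False e(1) by auto
      next
        case False2: False
        then show ?thesis using False by (intro exI[of _ 1]) auto
      qed
    qed
    then obtain e where e: "\<And>t. e t > 0" "\<And>t. if t \<in> Y then ball t (e t) \<subseteq> U else
       a < t \<and> t < b \<longrightarrow> (\<forall>y. dist y t < e t \<longrightarrow> (y \<ge> t \<longrightarrow> F y - F t \<le> \<epsilon> * (y - t)) \<and> (y \<le> t \<longrightarrow> F t - F y \<le> \<epsilon> * (t - y)))"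
      by metis
    have "gauge (\<lambda>t. ball t (e t))"
      using e(1) by (auto simp: gauge_def)
    then obtain p where p: "p tagged_division_of {a..b}" "(\<lambda>t. ball t (e t)) fine p"
      using fine_division_exists_real by metis
    note pc = tagged_division_pieces[OF p(1)]
    have fin: "finite p" using p(1) by auto
    have inball: "Inf K \<in> ball x (e x) \<and> Sup K \<in> ball x (e x) \<and> K \<subseteq> ball x (e x)" if "(x, K) \<in> p" for x K
    proof -
      have "K \<subseteq> ball x (e x)" using p(2) that by (auto simp: fine_def)
      moreover have "Inf K \<in> K" "Sup K \<in> K" using pc[OF that] by (metis atLeastAtMost_iff order_refl order_trans)+
      ultimately show ?thesis by blast
    qed
    define G where "G = {z \<in> p. fst z \<notin> Y}"
    define B where "B = {z \<in> p. fst z \<in> Y}"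
    have split: "p = G \<union> B" "G \<inter> B = {}" by (auto simp: G_def B_def)
    have finGB: "finite G" "finite B" using fin by (auto simp: G_def B_def)
    have sumGB: "(\<Sum>z\<in>p. f z) = (\<Sum>z\<in>G. f z) + (\<Sum>z\<in>B. f z)" for f :: "real \<times> real set \<Rightarrow> real"
      unfolding split(1) by (rule sum.union_disjoint[OF finGB split(2)])
    \<comment> \<open>The piece is split at its tag, and the one-sided estimates on both sides add
      up.\<close>
    have good: "F (Sup K) - F (Inf K) \<le> \<epsilon> * (Sup K - Inf K)" if "(x, K) \<in> G" for x K
    proof -
      have xp: "(x, K) \<in> p" "x \<notin> Y" using that by (auto simp: G_def)
      then have "a < x" "x < b" using pc[OF xp(1)] by (auto simp: Y_def)
      then have *: "\<And>y. dist y x < e x \<Longrightarrow> (y \<ge> x \<longrightarrow> F y - F x \<le> \<epsilon> * (y - x)) \<and> (y \<le> x \<longrightarrow> F x - F y \<le> \<epsilon> * (x - y))"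
        using e(2)[of x] xp(2) by auto
      have "F (Sup K) - F x \<le> \<epsilon> * (Sup K - x)" "F x - F (Inf K) \<le> \<epsilon> * (x - Inf K)"
        using *[of "Sup K"] *[of "Inf K"] inball[OF xp(1)] pc[OF xp(1)] by (auto simp: dist_commute)
      then show ?thesis by (simp add: algebra_simps)
    qed
    have tele: "(\<Sum>(x,K)\<in>p. f (Sup K) - f (Inf K)) = f b - f a" for f :: "real \<Rightarrow> real"
      using additive_tagged_division_1[OF assms(1) p(1)] .
    have "(\<Sum>(x,K)\<in>G. F (Sup K) - F (Inf K)) \<le> (\<Sum>(x,K)\<in>G. \<epsilon> * (Sup K - Inf K))"
      using good by (intro sum_mono) auto
    also have "\<dots> \<le> (\<Sum>(x,K)\<in>p. \<epsilon> * (Sup K - Inf K))"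
      using \<open>\<epsilon> > 0\<close> pc(2,3) fin by (intro sum_mono2) (force simp: G_def intro!: mult_nonneg_nonneg)+
    also have "\<dots> = \<epsilon> * (b - a)"
      using tele[of "\<lambda>x. \<epsilon> * x"] by (simp add: right_diff_distrib)
    finally have sG: "(\<Sum>(x,K)\<in>G. F (Sup K) - F (Inf K)) \<le> \<epsilon> * (b - a)" .
    define g where "g = (\<lambda>(x::real, K::real set). (Inf K, Sup K))"
    have disj: "{Inf K<..<Sup K} \<inter> {Inf K'<..<Sup K'} = {}" if "(x, K) \<in> p" "(x', K') \<in> p" "(x, K) \<noteq> (x', K')" for x K x' K'
    proof -
      have "interior K \<inter> interior K' = {}"
        using tagged_division_ofD(5)[OF p(1) that] .
      moreover have "interior K = {Inf K<..<Sup K}" "interior K' = {Inf K'<..<Sup K'}"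
        using pc(1)[OF that(1)] pc(1)[OF that(2)] by (metis interior_atLeastAtMost_real)+
      ultimately show ?thesis by simp
    qed
    \<comment> \<open>Absolute continuity takes a set of intervals, so different pieces must give
      different intervals. Two pieces with the same interval would have disjoint interiors, so the
      interval is a single point, which is then the tag of both.\<close>
    have inj: "inj_on g B"
    proof (rule inj_onI)
      fix z z' assume z: "z \<in> B" "z' \<in> B" "g z = g z'"
      obtain x K x' K' where zz: "z = (x, K)" "z' = (x', K')" by (metis surj_pair)
      have eq: "Inf K = Inf K'" "Sup K = Sup K'" using z(3) by (auto simp: g_def zz)
      have pp: "(x, K) \<in> p" "(x', K') \<in> p" using z by (auto simp: B_def zz)
      have KK: "K = K'" using pc(1)[OF pp(1)] pc(1)[OF pp(2)] eq by metis
      show "z = z'"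
      proof (rule ccontr)
        assume "z \<noteq> z'"
        then have "{Inf K<..<Sup K} = {}" using disj[OF pp] zz eq by auto
        then have "Inf K \<ge> Sup K" by auto
        then have "x = x'" using pc(2,3)[OF pp(1)] pc(2,3)[OF pp(2)] eq by auto
        then show False using KK \<open>z \<noteq> z'\<close> zz by simp
      qed
    qed
    have dis2: "disjoint_family_on (\<lambda>(r, s). {r<..<s}) (g ` B)"
      unfolding disjoint_family_on_def
    proof (intro ballI impI)
      fix y y' assume "y \<in> g ` B" "y' \<in> g ` B" "y \<noteq> y'"
      then obtain z z' where z: "z \<in> B" "z' \<in> B" "y = g z" "y' = g z'" "z \<noteq> z'" by auto
      obtain x K x' K' where zz: "z = (x, K)" "z' = (x', K')" by (metis surj_pair)
      have pp: "(x, K) \<in> p" "(x', K') \<in> p" using z by (auto simp: B_def zz)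
      show "(case y of (r, s) \<Rightarrow> {r<..<s}) \<inter> (case y' of (r, s) \<Rightarrow> {r<..<s}) = {}"
        using disj[OF pp] z zz by (auto simp: g_def)
    qed
    have lenB: "(\<Sum>(r, s)\<in>g ` B. s - r) \<le> measure lebesgue U"
    proof -
      have "(\<Sum>(r, s)\<in>g ` B. s - r) = (\<Sum>(r, s)\<in>g ` B. measure lebesgue {r<..<s})"
        using pc(2,3) by (intro sum.cong) (force simp: g_def B_def)+
      also have "\<dots> = (\<Sum>y\<in>g ` B. measure lebesgue ((\<lambda>(r, s). {r<..<s}) y))"
        by (simp add: case_prod_beta)
      also have "\<dots> = measure lebesgue (\<Union>y\<in>g ` B. (\<lambda>(r, s). {r<..<s}) y)"
      proof (rule measure_finite_Union[symmetric])
        show "(\<lambda>(r, s). {r<..<s}) ` g ` B \<subseteq> sets lebesgue" by (auto simp: case_prod_beta)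
        show "emeasure lebesgue (case i of (r, s) \<Rightarrow> {r<..<s}) \<noteq> \<infinity>" for i :: "real \<times> real"
          using emeasure_bounded_finite[of "{fst i<..<snd i}"] by (simp add: case_prod_beta)
      qed (use finGB dis2 in auto)
      also have "\<dots> \<le> measure lebesgue U"
      proof (rule measure_mono_fmeasurable)
        show "(\<Union>y\<in>g ` B. (\<lambda>(r, s). {r<..<s}) y) \<subseteq> U"
        proof -
          have "{Inf K<..<Sup K} \<subseteq> U" if "(x, K) \<in> B" for x K
          proof -
            have "{Inf K<..<Sup K} \<subseteq> K"
              using that by (intro pc(6)[of x]) (simp add: B_def)
            also have "\<dots> \<subseteq> ball x (e x)" using inball[of x K] that by (auto simp: B_def)
            also have "\<dots> \<subseteq> U" using e(2)[of x] that by (auto simp: B_def)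
            finally show ?thesis .
          qed
          then have "(case g z of (r, s) \<Rightarrow> {r<..<s}) \<subseteq> U" if "z \<in> B" for z
            using that by (cases z) (simp add: g_def)
          then show ?thesis by (simp add: UN_subset_iff)
        qed
        show "(\<Union>y\<in>g ` B. (\<lambda>(r, s). {r<..<s}) y) \<in> sets lebesgue"
          using finGB by (auto simp: case_prod_beta)
      qed (rule Ulm)
      finally show ?thesis .
    qed
    have rhoB: "(\<Sum>(r, s)\<in>g ` B. \<rho> r s) < \<epsilon>"
    proof (rule d(2), intro conjI)
      show "\<forall>(r, s)\<in>g ` B. a \<le> r \<and> r \<le> s \<and> s \<le> b"
        using pc(2-5) by (force simp: g_def B_def)
      show "(\<Sum>(r, s)\<in>g ` B. s - r) < \<delta>" using lenB mU by simp
    qed (use finGB dis2 in auto)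
    have "(\<Sum>(x,K)\<in>B. F (Sup K) - F (Inf K)) \<le> (\<Sum>(x,K)\<in>B. C * (\<rho> (Inf K) (Sup K) + (Sup K - Inf K)))"
    proof (rule sum_mono)
      fix z assume z: "z \<in> B"
      obtain x K where zz: "z = (x, K)" by (metis surj_pair)
      then have "(x, K) \<in> p" using z by (auto simp: B_def)
      from pc(2-5)[OF this] show "(case z of (x, K) \<Rightarrow> F (Sup K) - F (Inf K)) \<le> (case z of (x, K) \<Rightarrow> C * (\<rho> (Inf K) (Sup K) + (Sup K - Inf K)))"
        unfolding zz by (auto intro!: bound)
    qed
    also have "\<dots> = C * ((\<Sum>(r, s)\<in>g ` B. \<rho> r s) + (\<Sum>(r, s)\<in>g ` B. s - r))"
      unfolding sum.reindex[OF inj] by (simp add: g_def case_prod_beta sum_distrib_left sum.distrib[symmetric] algebra_simps)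
    also have "\<dots> \<le> C * (\<epsilon> + \<epsilon>)"
      using rhoB lenB mU \<open>C \<ge> 0\<close> by (intro mult_left_mono add_mono) auto
    finally have sB: "(\<Sum>(x,K)\<in>B. F (Sup K) - F (Inf K)) \<le> C * (\<epsilon> + \<epsilon>)" .
    have "F b - F a = (\<Sum>(x,K)\<in>p. F (Sup K) - F (Inf K))" using tele[of F] by simp
    also have "\<dots> = (\<Sum>(x,K)\<in>G. F (Sup K) - F (Inf K)) + (\<Sum>(x,K)\<in>B. F (Sup K) - F (Inf K))"
      by (rule sumGB)
    also have "\<dots> \<le> \<epsilon> * (b - a) + C * (\<epsilon> + \<epsilon>)"
      using sG sB by simp
    finally show ?thesis by (simp add: algebra_simps)
  qed
  show ?thesis
  proof (rule ccontr)
    assume "\<not> F b \<le> F a"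
    then have pos: "F b - F a > 0" by simp
    \<comment> \<open>With this \<open>K\<close> the bound \<open>main\<close> at \<open>q\<close>
      reads \<open>q * K \<le> q * (K - 1)\<close>, which is impossible for positive
      \<open>q\<close>.\<close>
    define K where "K = b - a + 2 * C + 1"
    have "K > 0" using assms(1,2) by (simp add: K_def)
    define q where "q = (F b - F a) / K"
    have "q > 0" "F b - F a = q * K" using pos \<open>K > 0\<close> by (auto simp: q_def)
    moreover have "F b - F a \<le> q * (b - a) + 2 * C * q" by (rule main[OF \<open>q > 0\<close>])
    ultimately show False by (simp add: K_def algebra_simps)
  qed
qed

section \<open>Flows of one-homogeneous functionals in an inner product space\<close>

text \<open>The right-hand side is the form in which \<open>L2_has_derivative_at\<close> expresses
  differentiability.\<close>

lemma has_vector_derivative_iff_norm: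
  "(f has_vector_derivative w) (at t) \<longleftrightarrow>
     ((\<lambda>s. norm ((f s - f t) /\<^sub>R (s - t) - w)) \<longlongrightarrow> 0) (at t)"
proof -
  have "norm (f s - f t - (s - t) *\<^sub>R w) / norm (s - t) = norm ((f s - f t) /\<^sub>R (s - t) - w)" if "s \<noteq> t" for s
  proof -
    have "(f s - f t) /\<^sub>R (s - t) - w = (f s - f t - (s - t) *\<^sub>R w) /\<^sub>R (s - t)"
      using that by (simp add: scaleR_diff_right)
    then have "norm ((f s - f t) /\<^sub>R (s - t) - w) = norm (f s - f t - (s - t) *\<^sub>R w) / norm (s - t)"
      by (simp add: divide_inverse)
    then show ?thesis by simp
  qed
  then have "((\<lambda>s. norm (f s - f t - (s - t) *\<^sub>R w) / norm (s - t)) \<longlongrightarrow> 0) (at t) \<longleftrightarrow>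
     ((\<lambda>s. norm ((f s - f t) /\<^sub>R (s - t) - w)) \<longlongrightarrow> 0) (at t)"
    by (intro filterlim_cong) (auto simp: eventually_at_filter)
  then show ?thesis
    unfolding has_vector_derivative_def has_derivative_iff_norm by (simp add: bounded_linear_scaleR_left)
qed

lemma norm_vector_derivative_le:
  assumes "(f has_vector_derivative w) (at t)" "\<epsilon> > 0"
    and "\<And>s. dist s t < \<epsilon> \<Longrightarrow> norm (f s - f t) \<le> K * \<bar>s - t\<bar>"
  shows "norm w \<le> K"
proof -
  have "((\<lambda>s. (f s - f t) /\<^sub>R (s - t) - w) \<longlongrightarrow> 0) (at t)"
    using assms(1) unfolding has_vector_derivative_iff_norm by (rule tendsto_norm_zero_cancel)
  then have "((\<lambda>s. norm ((f s - f t) /\<^sub>R (s - t))) \<longlongrightarrow> norm w) (at t)"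
    by (intro tendsto_norm) (simp add: LIM_zero_iff)
  moreover have "\<forall>\<^sub>F s in at t. norm ((f s - f t) /\<^sub>R (s - t)) \<le> K"
    unfolding eventually_at
  proof (intro exI[of _ \<epsilon>] conjI ballI impI)
    fix s assume s: "s \<noteq> t \<and> dist s t < \<epsilon>"
    then have "norm (f s - f t) \<le> K * \<bar>s - t\<bar>" using assms(3) by blast
    moreover have "norm ((f s - f t) /\<^sub>R (s - t)) = norm (f s - f t) / \<bar>s - t\<bar>"
      unfolding norm_scaleR by (simp add: divide_inverse mult.commute)
    ultimately show "norm ((f s - f t) /\<^sub>R (s - t)) \<le> K"
      using s by (simp add: divide_le_eq)
  qed (use assms in auto)
  ultimately show ?thesis
    by (intro tendsto_upperbound) auto
qed

lemma negligible_affine_preimage: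
  fixes Z :: "real set"
  assumes "negligible Z" "m \<noteq> 0"
  shows "negligible {\<tau>. s + m * \<tau> \<in> Z}"
proof -
  have "negligible ((\<lambda>z. (z - s) / m) ` Z)"
    using assms by (intro negligible_differentiable_image_negligible) (auto intro!: derivative_intros simp: divide_inverse)
  moreover have "{\<tau>. s + m * \<tau> \<in> Z} = (\<lambda>z. (z - s) / m) ` Z"
    using \<open>m \<noteq> 0\<close> by (force simp: image_iff field_simps)
  ultimately show ?thesis by simp
qed

text \<open>The relation \<open>lip K v\<close> plays the role of \<open>J v \<le> K\<close> for a convex functional \<open>J\<close> that is
  positively homogeneous of degree one; \<open>p \<in> \<partial>J (U t)\<close> with \<open>J (U t) = L\<close> then means
  \<open>\<langle>p, U t\<rangle> = L\<close> and \<open>\<langle>p, v\<rangle> \<le> J v\<close> for all \<open>v\<close>.\<close>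

definition flow_at :: "(real \<Rightarrow> 'h::real_inner) \<Rightarrow> (real \<Rightarrow> 'h \<Rightarrow> bool) \<Rightarrow> real \<Rightarrow> 'h \<Rightarrow> real \<Rightarrow> bool" where
  "flow_at U lip t p L \<longleftrightarrow> (U has_vector_derivative - p) (at t) \<and> lip L (U t) \<and> p \<bullet> U t = L \<and>
     (\<forall>v K. lip K v \<longrightarrow> p \<bullet> v \<le> K)"

text \<open>Homogeneity of the functional enters through the two conditions on \<open>p\<close> in
  \<open>flow_at\<close>, Euler's identity and the support inequality. In the application
  \<open>lam\<close> is the reciprocal of the norm of the distance function.\<close>

locale homogeneous_flow =
  fixes U :: "real \<Rightarrow> 'h::real_inner" and lip :: "real \<Rightarrow> 'h \<Rightarrow> bool" and lam :: real
  assumes cont: "continuous_on {0..} U"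
    and ac: "\<And>a b. 0 < a \<Longrightarrow> a \<le> b \<Longrightarrow> absolutely_continuous_dist a b (\<lambda>r s. norm (U s - U r))"
    and lam_pos: "lam > 0"
    and poincare: "\<And>K v. lip K v \<Longrightarrow> lam * norm v \<le> K"
    and flow: "AE t in lebesgue. 0 < t \<longrightarrow> (\<exists>p L. flow_at U lip t p L)"
begin

abbreviation "good \<equiv> flow_at U lip"

lemma exceptional_set:
  obtains Z where "negligible Z" "\<And>t. 0 < t \<Longrightarrow> t \<notin> Z \<Longrightarrow> \<exists>p L. good t p L"
proof -
  obtain N where "N \<in> null_sets lebesgue" "{t. \<not> (0 < t \<longrightarrow> (\<exists>p L. good t p L))} \<subseteq> N"
    using flow unfolding eventually_ae_filter by auto
  then show ?thesis by (intro that[of N]) (auto simp: negligible_iff_null_sets)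
qed

lemma good_nonneg: "good t p L \<Longrightarrow> 0 \<le> L"
  using poincare[of L "U t"] lam_pos unfolding flow_at_def
  by (meson less_imp_le mult_nonneg_nonneg norm_ge_zero order_trans)

lemma norm_derivative:
  assumes "good t p L" "U t \<noteq> 0"
  shows "((\<lambda>s. norm (U s)) has_real_derivative - (L / norm (U t))) (at t)"
proof -
  have "(U has_derivative (\<lambda>h. h *\<^sub>R (- p))) (at t)"
    using assms(1) by (simp add: flow_at_def has_vector_derivative_def)
  then have "((\<lambda>s. norm (U s)) has_derivative (\<lambda>h. (h *\<^sub>R (- p)) \<bullet> sgn (U t))) (at t)"
    by (rule has_derivative_compose[where f = U and g = norm]) (rule has_derivative_norm[OF assms(2)])
  moreover have "(\<lambda>h. (h *\<^sub>R (- p)) \<bullet> sgn (U t)) = (*) (- (L / norm (U t)))"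
    using assms(1) by (auto simp: flow_at_def sgn_div_norm divide_inverse)
  ultimately show ?thesis by (simp add: has_field_derivative_def)
qed

text \<open>The norm decreases at rate \<open>L / norm (U t)\<close>, which is at least
  \<open>lam\<close> by the Poincare inequality. This linear decay forces extinction in finite
  time.\<close>

lemma norm_decay_upper:
  assumes "0 < a" "a \<le> b" and nz: "\<And>t. a < t \<Longrightarrow> t < b \<Longrightarrow> U t \<noteq> 0"
  shows "norm (U b) + lam * b \<le> norm (U a) + lam * a"
proof -
  obtain Z where Z: "negligible Z" "\<And>t. 0 < t \<Longrightarrow> t \<notin> Z \<Longrightarrow> \<exists>p L. good t p L"
    using exceptional_set by blast
  show ?thesis
  proof (rule nonincreasing_if_derivative_nonpos_AE[where F = "\<lambda>t. norm (U t) + lam * t" and C = "1 + lam" and Z = Z,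
        OF \<open>a \<le> b\<close> _ ac[OF assms(1,2)]])
    fix r s assume rs: "a \<le> r" "r \<le> s" "s \<le> b"
    have "norm (U s) - norm (U r) \<le> norm (U s - U r)" by (rule norm_triangle_ineq2)
    moreover have "0 \<le> lam * norm (U s - U r)" using lam_pos by simp
    ultimately show "norm (U s) + lam * s - (norm (U r) + lam * r) \<le> (1 + lam) * (norm (U s - U r) + (s - r))"
      using rs by (simp add: algebra_simps)
  next
    fix t assume t: "a < t" "t < b" "t \<notin> Z"
    then obtain p L where g: "good t p L" using Z(2)[of t] assms(1) by auto
    have U: "U t \<noteq> 0" using nz t by auto
    have "((\<lambda>t. norm (U t) + lam * t) has_real_derivative (- (L / norm (U t)) + lam * 1)) (at t)"
      by (intro derivative_intros norm_derivative[OF g U] DERIV_cmult DERIV_ident)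
    moreover have "lam * norm (U t) \<le> L" using g poincare by (simp add: flow_at_def)
    then have "lam \<le> L / norm (U t)" using U by (simp add: field_simps)
    ultimately show "\<exists>D\<le>0. ((\<lambda>t. norm (U t) + lam * t) has_real_derivative D) (at t)"
      by (intro exI[of _ "- (L / norm (U t)) + lam * 1"]) auto
  qed (use lam_pos Z in auto)
qed

text \<open>Counterpart of the preceding estimate: if the decay rate never exceeds \<open>K\<close>,
  at most \<open>K * (b - a)\<close> of the norm is lost. It serves to refute that the rate stays
  below \<open>P - \<epsilon>\<close> up to extinction.\<close>

lemma norm_decay_lower:
  assumes "0 < a" "a \<le> b" "K \<ge> 0" and nz: "\<And>t. a < t \<Longrightarrow> t < b \<Longrightarrow> U t \<noteq> 0"
    and bound: "\<And>t p L. a < t \<Longrightarrow> t < b \<Longrightarrow> good t p L \<Longrightarrow> L / norm (U t) \<le> K"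
  shows "norm (U a) \<le> norm (U b) + K * (b - a)"
proof -
  obtain Z where Z: "negligible Z" "\<And>t. 0 < t \<Longrightarrow> t \<notin> Z \<Longrightarrow> \<exists>p L. good t p L"
    using exceptional_set by blast
  have "- norm (U b) - K * b \<le> - norm (U a) - K * a"
  proof (rule nonincreasing_if_derivative_nonpos_AE[where F = "\<lambda>t. - norm (U t) - K * t" and C = "1" and Z = Z,
        OF \<open>a \<le> b\<close> _ ac[OF assms(1,2)]])
    fix r s assume rs: "a \<le> r" "r \<le> s" "s \<le> b"
    have "norm (U r) - norm (U s) \<le> norm (U s - U r)" by (metis norm_minus_commute norm_triangle_ineq2)
    moreover have "K * r \<le> K * s" using assms(3) rs by (simp add: mult_left_mono)
    ultimately show "- norm (U s) - K * s - (- norm (U r) - K * r) \<le> 1 * (norm (U s - U r) + (s - r))"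
      using rs by simp
  next
    fix t assume t: "a < t" "t < b" "t \<notin> Z"
    then obtain p L where g: "good t p L" using Z(2)[of t] assms(1) by auto
    have U: "U t \<noteq> 0" using nz t by auto
    have "((\<lambda>t. - norm (U t) - K * t) has_real_derivative (- (- (L / norm (U t))) - K * 1)) (at t)"
      by (intro derivative_intros norm_derivative[OF g U] DERIV_cmult DERIV_ident)
    then show "\<exists>D\<le>0. ((\<lambda>t. - norm (U t) - K * t) has_real_derivative D) (at t)"
      using bound[OF t(1,2) g] by (intro exI[of _ "- (- (L / norm (U t))) - K * 1"]) auto
  qed (use Z in auto)
  then show ?thesis by (simp add: algebra_simps)
qed

text \<open>By homogeneity \<open>a *\<^sub>R U (s + \<tau> / a)\<close> solves the same inclusion, so its distance to
  \<open>U (s + \<tau>)\<close> does not increase with \<open>\<tau>\<close>.\<close>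

lemma scaled_contraction:
  assumes "0 < s" "s \<le> t" "a > 0"
  shows "norm (a *\<^sub>R U (s + (t - s) / a) - U t) \<le> \<bar>a - 1\<bar> * norm (U s)"
proof -
  define m where "m = 1 / a"
  have m: "m > 0" "a * m = 1" using \<open>a > 0\<close> by (auto simp: m_def)
  obtain Z where Z: "negligible Z" "\<And>t. 0 < t \<Longrightarrow> t \<notin> Z \<Longrightarrow> \<exists>p L. good t p L"
    using exceptional_set by blast
  \<comment> \<open>The factor \<open>1 *\<close> gives both curves the shape
    \<open>s + m * \<tau>\<close>, so the affine reparametrization lemmas apply to each of
    them.\<close>
  define W where "W = (\<lambda>\<tau>. a *\<^sub>R U (s + m * \<tau>) - U (s + 1 * \<tau>))"
  define b where "b = t - s"
  have b: "0 \<le> b" using assms by (simp add: b_def)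
  define \<rho> where "\<rho> = (\<lambda>r r'. norm (U (s + m * r') - U (s + m * r)) + norm (U (s + 1 * r') - U (s + 1 * r)))"
  have ac\<rho>: "absolutely_continuous_dist 0 b \<rho>"
    unfolding \<rho>_def
    by (intro absolutely_continuous_dist_add absolutely_continuous_dist_affine[where \<rho> = "\<lambda>r s. norm (U s - U r)"] ac)
       (use assms m b in \<open>auto intro: add_pos_nonneg\<close>)
  have contW: "continuous_on {0..b} W"
    unfolding W_def using assms m
    by (intro continuous_intros continuous_on_compose2[OF cont]) (auto intro!: add_nonneg_nonneg)
  then have "bounded (W ` {0..b})"
    by (intro compact_imp_bounded compact_continuous_image) auto
  then obtain B where B: "B > 0" "\<And>\<tau>. \<tau> \<in> {0..b} \<Longrightarrow> norm (W \<tau>) \<le> B"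
    unfolding bounded_pos by auto
  have "(norm (W b))\<^sup>2 \<le> (norm (W 0))\<^sup>2"
  \<comment> \<open>On the interval \<open>norm (W \<tau>)\<close> is at most \<open>B\<close>, so
    the square changes by at most \<open>2 * B\<close> times the increment of \<open>W\<close>,
    which in turn is at most \<open>(a + 1) * \<rho>\<close>.\<close>
  proof (rule nonincreasing_if_derivative_nonpos_AE[where F = "\<lambda>\<tau>. (norm (W \<tau>))\<^sup>2" and C = "2 * B * (a + 1)"
        and Z = "{\<tau>. s + m * \<tau> \<in> Z} \<union> {\<tau>. s + 1 * \<tau> \<in> Z}", OF b _ ac\<rho>])
    fix r r' assume r: "0 \<le> r" "r \<le> r'" "r' \<le> b"
    have "W r' - W r = a *\<^sub>R (U (s + m * r') - U (s + m * r)) - (U (s + 1 * r') - U (s + 1 * r))"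
      by (simp add: W_def algebra_simps)
    then have "norm (W r' - W r) \<le> a * norm (U (s + m * r') - U (s + m * r)) + norm (U (s + 1 * r') - U (s + 1 * r))"
      using \<open>a > 0\<close> by (metis abs_of_pos norm_scaleR norm_triangle_ineq4)
    also have "\<dots> \<le> (a + 1) * \<rho> r r'"
      using \<open>a > 0\<close> by (simp add: \<rho>_def algebra_simps)
    also have "\<dots> \<le> (a + 1) * (\<rho> r r' + (r' - r))"
      using \<open>a > 0\<close> r by (intro mult_left_mono) auto
    finally have 1: "norm (W r' - W r) \<le> (a + 1) * (\<rho> r r' + (r' - r))" .
    have "(norm (W r'))\<^sup>2 - (norm (W r))\<^sup>2 = (norm (W r') - norm (W r)) * (norm (W r') + norm (W r))"
      by (simp add: power2_eq_square algebra_simps)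
    also have "\<dots> \<le> norm (W r' - W r) * (B + B)"
      using B(2)[of r] B(2)[of r'] r norm_triangle_ineq2[of "W r'" "W r"]
      by (intro order_trans[OF mult_right_mono mult_left_mono]) auto
    also have "\<dots> \<le> (a + 1) * (\<rho> r r' + (r' - r)) * (B + B)"
      using 1 B(1) by (intro mult_right_mono) auto
    finally show "(norm (W r'))\<^sup>2 - (norm (W r))\<^sup>2 \<le> 2 * B * (a + 1) * (\<rho> r r' + (r' - r))"
      by (simp add: algebra_simps)
  next
    show "negligible ({\<tau>. s + m * \<tau> \<in> Z} \<union> {\<tau>. s + 1 * \<tau> \<in> Z})"
      using m by (intro negligible_Un negligible_affine_preimage Z) auto
  next
    fix \<tau> assume \<tau>: "0 < \<tau>" "\<tau> < b" "\<tau> \<notin> {\<tau>. s + m * \<tau> \<in> Z} \<union> {\<tau>. s + 1 * \<tau> \<in> Z}"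
    define t1 t2 where "t1 = s + m * \<tau>" and "t2 = s + 1 * \<tau>"
    have "0 < t1" "0 < t2" using assms \<tau> m by (auto simp: t1_def t2_def intro!: add_pos_pos)
    then obtain p1 L1 p2 L2 where g: "good t1 p1 L1" "good t2 p2 L2"
      using Z(2)[of t1] Z(2)[of t2] \<tau> by (auto simp: t1_def t2_def)
    have d1: "((\<lambda>\<tau>. U (s + m * \<tau>)) has_vector_derivative m *\<^sub>R (- p1)) (at \<tau>)"
      using g(1) unfolding flow_at_def t1_def
      by (intro vector_diff_chain_at[unfolded o_def, where f = "\<lambda>\<tau>. s + m * \<tau>"])
         (auto intro!: derivative_eq_intros)
    have d2: "((\<lambda>\<tau>. U (s + 1 * \<tau>)) has_vector_derivative 1 *\<^sub>R (- p2)) (at \<tau>)"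
      using g(2) unfolding flow_at_def t2_def
      by (intro vector_diff_chain_at[unfolded o_def, where f = "\<lambda>\<tau>. s + 1 * \<tau>"])
         (auto intro!: derivative_eq_intros)
    have "(W has_vector_derivative (a *\<^sub>R (m *\<^sub>R (- p1)) - 1 *\<^sub>R (- p2))) (at \<tau>)"
      unfolding W_def by (intro has_vector_derivative_diff d2 bounded_linear.has_vector_derivative[OF bounded_linear_scaleR_right d1])
    moreover have "a *\<^sub>R (m *\<^sub>R (- p1)) - 1 *\<^sub>R (- p2) = p2 - p1"
      using m by simp
    ultimately have "(W has_derivative (\<lambda>h. h *\<^sub>R (p2 - p1))) (at \<tau>)"
      by (simp add: has_vector_derivative_def)
    then have "((\<lambda>\<tau>. W \<tau> \<bullet> W \<tau>) has_derivative (\<lambda>h. W \<tau> \<bullet> (h *\<^sub>R (p2 - p1)) + (h *\<^sub>R (p2 - p1)) \<bullet> W \<tau>)) (at \<tau>)"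
      by (intro has_derivative_inner)
    moreover have "(\<lambda>h. W \<tau> \<bullet> (h *\<^sub>R (p2 - p1)) + (h *\<^sub>R (p2 - p1)) \<bullet> W \<tau>) = (*) (2 * (W \<tau> \<bullet> (p2 - p1)))"
      by (auto simp: fun_eq_iff inner_commute)
    ultimately have "((\<lambda>\<tau>. (norm (W \<tau>))\<^sup>2) has_real_derivative 2 * (W \<tau> \<bullet> (p2 - p1))) (at \<tau>)"
      by (simp add: has_field_derivative_def dot_square_norm)
    \<comment> \<open>Monotonicity of the subdifferential. The product equals
      \<open>a * (p2 \<bullet> U t1 - L1) + (p1 \<bullet> U t2 - L2)\<close>, and both brackets are
      nonpositive by the support inequality.\<close>
    moreover have "W \<tau> \<bullet> (p2 - p1) \<le> 0"
    proof -
      have "p1 \<bullet> U t1 = L1" "p2 \<bullet> U t2 = L2" "p1 \<bullet> U t2 \<le> L2" "p2 \<bullet> U t1 \<le> L1"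
        using g unfolding flow_at_def by auto
      moreover have "a * (p2 \<bullet> U t1) \<le> a * L1" using calculation \<open>a > 0\<close> by simp
      moreover have "W \<tau> \<bullet> (p2 - p1) = a * (p2 \<bullet> U t1) - a * (p1 \<bullet> U t1) - p2 \<bullet> U t2 + p1 \<bullet> U t2"
        by (simp add: W_def t1_def t2_def inner_diff_left inner_diff_right inner_commute algebra_simps)
      ultimately show ?thesis by simp
    qed
    ultimately show "\<exists>D\<le>0. ((\<lambda>\<tau>. (norm (W \<tau>))\<^sup>2) has_real_derivative D) (at \<tau>)"
      by (intro exI[of _ "2 * (W \<tau> \<bullet> (p2 - p1))"]) auto
  qed (use B \<open>a > 0\<close> in auto)
  then have "norm (W b) \<le> norm (W 0)" by (simp add: power2_le_iff_abs_le)
  moreover have "W b = a *\<^sub>R U (s + (t - s) / a) - U t" by (simp add: W_def b_def m_def)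
  moreover have "W 0 = (a - 1) *\<^sub>R U s" by (simp add: W_def algebra_simps)
  ultimately show ?thesis by simp
qed

text \<open>Differentiating the contraction estimate at \<open>a = 1\<close> gives
  \<open>norm ((t - s) *\<^sub>R p + U t) \<le> norm (U s)\<close>. When the left side is squared,
  the cross term is \<open>2 * (t - s) * L\<close>, hence nonnegative; dropping it and
  \<open>(norm (U t))\<^sup>2\<close> leaves the claim.\<close>

lemma norm_subgradient_le:
  assumes "0 < s" "s < t" "good t p L"
  shows "(t - s) * norm p \<le> norm (U s)"
proof -
  define \<Phi> where "\<Phi> = (\<lambda>a. a *\<^sub>R U (s + (t - s) / a))"
  have "((\<lambda>a. U (s + (t - s) / a)) has_vector_derivative (- (t - s)) *\<^sub>R (- p)) (at 1)"
    using assms(3) unfolding flow_at_def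
    by (intro vector_diff_chain_at[unfolded o_def, where f = "\<lambda>a. s + (t - s) / a"])
       (auto intro!: derivative_eq_intros simp: has_real_derivative_iff_has_vector_derivative[symmetric])
  then have "(\<Phi> has_vector_derivative (1 *\<^sub>R ((- (t - s)) *\<^sub>R (- p)) + 1 *\<^sub>R U (s + (t - s) / 1))) (at 1)"
    unfolding \<Phi>_def by (intro has_vector_derivative_scaleR) (auto intro!: derivative_eq_intros)
  then have der: "(\<Phi> has_vector_derivative ((t - s) *\<^sub>R p + U t)) (at 1)" by (simp add: algebra_simps)
  have "norm ((t - s) *\<^sub>R p + U t) \<le> norm (U s)"
  proof (rule norm_vector_derivative_le[OF der, of 1])
    fix a :: real assume "dist a 1 < 1"
    then have "a > 0" by (auto simp: dist_real_def)
    then show "norm (\<Phi> a - \<Phi> 1) \<le> norm (U s) * \<bar>a - 1\<bar>"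
      using scaled_contraction[of s t a] assms by (simp add: \<Phi>_def mult.commute)
  qed simp
  then have "(norm ((t - s) *\<^sub>R p + U t))\<^sup>2 \<le> (norm (U s))\<^sup>2" by simp
  moreover have "(norm ((t - s) *\<^sub>R p + U t))\<^sup>2 = ((t - s) * norm p)\<^sup>2 + 2 * (t - s) * L + (norm (U t))\<^sup>2"
    using assms(3) unfolding flow_at_def power2_norm_eq_inner power_mult_distrib
    by (simp add: inner_add_left inner_add_right inner_commute power2_eq_square algebra_simps)
  moreover have "0 \<le> 2 * (t - s) * L" using good_nonneg[OF assms(3)] assms by simp
  ultimately have "((t - s) * norm p)\<^sup>2 \<le> (norm (U s))\<^sup>2"
    by (smt (verit) zero_le_power2)
  then show ?thesis
    by (rule power2_le_imp_le) simp
qed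

section \<open>Extinction time and asymptotic decay rate\<close>

lemma extinction:
  assumes "U 0 \<noteq> 0"
  obtains T where "0 < T" "U T = 0" "\<And>t. 0 \<le> t \<Longrightarrow> t < T \<Longrightarrow> U t \<noteq> 0"
proof -
  define E where "E = {t \<in> {0..}. U t = 0}"
  have "closed E"
    unfolding E_def using continuous_closed_preimage_constant[OF cont, of 0] by (simp add: closed_atLeast)
  have "E \<noteq> {}"
  proof
    assume "E = {}"
    then have nz: "\<And>t. 0 \<le> t \<Longrightarrow> U t \<noteq> 0" by (auto simp: E_def)
    \<comment> \<open>By this time the guaranteed decay exceeds \<open>norm (U 1)\<close>. The count
      starts at time 1 because absolute continuity is available only away from time 0.\<close>
    define b where "b = 1 + (norm (U 1) + 1) / lam"
    have "b \<ge> 1" using lam_pos by (simp add: b_def)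
    then have "norm (U b) + lam * b \<le> norm (U 1) + lam * 1"
      by (intro norm_decay_upper) (auto intro!: nz)
    moreover have "lam * b = lam + norm (U 1) + 1" using lam_pos by (simp add: b_def field_simps)
    ultimately show False using norm_ge_zero[of "U b"] by linarith
  qed
  have bdd: "bdd_below E" by (auto simp: E_def bdd_below_def)
  define T where "T = Inf E"
  have "T \<in> E" unfolding T_def using closed_contains_Inf[OF \<open>E \<noteq> {}\<close> bdd \<open>closed E\<close>] .
  show ?thesis
  proof
    show "U T = 0" using \<open>T \<in> E\<close> by (simp add: E_def)
    then show "0 < T" using \<open>T \<in> E\<close> assms by (auto simp: E_def less_le)
    fix t assume "0 \<le> t" "t < T"
    then show "U t \<noteq> 0" using cInf_lower[OF _ bdd, of t] by (force simp: E_def T_def)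
  qed
qed

text \<open>\<open>P\<close> is the infimum of the slopes of the chords from
  \<open>(s, norm (U s))\<close> to the extinction point \<open>(T, 0)\<close>. A nearly optimal
  \<open>s\<close>, inserted in \<open>norm_subgradient_le\<close>, yields the upper bound for all
  later good times close to \<open>T\<close>. If the decay rate stayed below
  \<open>P - \<epsilon>\<close> on a final interval, integration would give a chord of slope below
  the infimum.\<close>

lemma asymptotic_slope:
  assumes T: "0 < T" "U T = 0" "\<And>t. 0 \<le> t \<Longrightarrow> t < T \<Longrightarrow> U t \<noteq> 0"
  obtains P where "0 \<le> P"
    "\<And>\<epsilon>. \<epsilon> > 0 \<Longrightarrow> \<exists>t0. 0 < t0 \<and> t0 < T \<and> (\<forall>t p L. t0 < t \<and> t < T \<and> good t p L \<longrightarrow> norm p \<le> P + \<epsilon>)"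
    "\<And>\<epsilon> t0. \<epsilon> > 0 \<Longrightarrow> 0 < t0 \<Longrightarrow> t0 < T \<Longrightarrow> \<exists>t p L. t0 < t \<and> t < T \<and> good t p L \<and> P - \<epsilon> \<le> L / norm (U t)"
proof -
  define Q where "Q = (\<lambda>s. norm (U s) / (T - s))"
  define P where "P = Inf (Q ` {0<..<T})"
  have ne: "Q ` {0<..<T} \<noteq> {}" using T(1) by simp
  have Q0: "0 \<le> Q s" if "s < T" for s using that by (simp add: Q_def)
  have bdd: "bdd_below (Q ` {0<..<T})" using Q0 by (intro bdd_belowI[of _ 0]) auto
  have P0: "0 \<le> P" unfolding P_def using ne Q0 by (intro cInf_greatest) auto
  have PQ: "P * (T - s) \<le> norm (U s)" if "0 < s" "s < T" for s
  proof -
    have "P \<le> Q s" unfolding P_def using that by (intro cInf_lower bdd) auto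
    then show ?thesis using that by (simp add: Q_def field_simps)
  qed
  show ?thesis
  proof (rule that[OF P0])
    fix \<epsilon> :: real assume "\<epsilon> > 0"
    then obtain s where s: "0 < s" "s < T" "Q s < P + \<epsilon>"
      using cInf_lessD[OF ne, of "P + \<epsilon>"] by (auto simp: P_def)
    have "norm (U s) < (P + \<epsilon>) * (T - s)" using s by (simp add: Q_def field_simps)
    \<comment> \<open>From this time on \<open>norm (U s) \<le> (P + \<epsilon>) * (t - s)\<close>;
      near-optimality of \<open>s\<close> places it before \<open>T\<close>.\<close>
    define t0 where "t0 = s + norm (U s) / (P + \<epsilon>)"
    have pe: "P + \<epsilon> > 0" using P0 \<open>\<epsilon> > 0\<close> by simp
    show "\<exists>t0. 0 < t0 \<and> t0 < T \<and> (\<forall>t p L. t0 < t \<and> t < T \<and> good t p L \<longrightarrow> norm p \<le> P + \<epsilon>)"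
    proof (intro exI[of _ t0] conjI allI impI)
      show "0 < t0" using s pe by (auto simp: t0_def intro!: add_pos_nonneg)
      show "t0 < T" using \<open>norm (U s) < _\<close> pe by (simp add: t0_def field_simps)
      fix t p L assume t: "t0 < t \<and> t < T \<and> good t p L"
      have "0 \<le> norm (U s) / (P + \<epsilon>)" using pe by simp
      then have "s < t" using t by (auto simp: t0_def)
      have "(t - s) * norm p \<le> norm (U s)" using norm_subgradient_le[OF s(1) \<open>s < t\<close>] t by blast
      also have "\<dots> \<le> (P + \<epsilon>) * (t - s)" using t pe by (simp add: t0_def field_simps)
      finally show "norm p \<le> P + \<epsilon>" using \<open>s < t\<close> by (simp add: mult.commute)
    qed
  next
    fix \<epsilon> t0 :: real assume e: "\<epsilon> > 0" "0 < t0" "t0 < T"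
    show "\<exists>t p L. t0 < t \<and> t < T \<and> good t p L \<and> P - \<epsilon> \<le> L / norm (U t)"
    proof (rule ccontr)
      assume neg: "\<not> ?thesis"
      \<comment> \<open>The maximum supplies the nonnegative rate required by
        \<open>norm_decay_lower\<close>. Comparison with \<open>PQ\<close> leaves only the case
        \<open>P = 0\<close>; then the rate is 0 and \<open>U t0\<close> would vanish before
        \<open>T\<close>.\<close>
      have "norm (U t0) \<le> norm (U T) + max 0 (P - \<epsilon>) * (T - t0)"
      proof (rule norm_decay_lower)
        fix t p L assume "t0 < t" "t < T" "good t p L"
        then show "L / norm (U t) \<le> max 0 (P - \<epsilon>)" using neg by force
      qed (use e T in auto)
      then have *: "P * (T - t0) \<le> max 0 (P - \<epsilon>) * (T - t0)" using PQ[OF e(2,3)] T by simp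
      then have "P \<le> max 0 (P - \<epsilon>)" using e by simp
      then have "P = 0" using P0 e by auto
      then have "norm (U t0) \<le> 0" using \<open>norm (U t0) \<le> _\<close> T e by simp
      then show False using T(3)[of t0] e by simp
    qed
  qed
qed

end

section \<open>The space of square integrable functions\<close>

lemma L2_D: "u \<in> L2 \<Omega> \<Longrightarrow> u \<in> borel_measurable (lebesgue_on \<Omega>)"
    "u \<in> L2 \<Omega> \<Longrightarrow> integrable (lebesgue_on \<Omega>) (\<lambda>x. (u x)\<^sup>2)"
  by (auto simp: L2_def)

lemma L2_integrable_mult:
  assumes "u \<in> L2 \<Omega>" "v \<in> L2 \<Omega>"
  shows "integrable (lebesgue_on \<Omega>) (\<lambda>x. u x * v x)"
proof (rule Bochner_Integration.integrable_bound)
  show "integrable (lebesgue_on \<Omega>) (\<lambda>x. (u x)\<^sup>2 + (v x)\<^sup>2)"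
    using assms by (intro Bochner_Integration.integrable_add L2_D)
  show "(\<lambda>x. u x * v x) \<in> borel_measurable (lebesgue_on \<Omega>)"
    using assms by (intro borel_measurable_times L2_D)
  show "AE x in lebesgue_on \<Omega>. norm (u x * v x) \<le> norm ((u x)\<^sup>2 + (v x)\<^sup>2)"
  proof (intro AE_I2)
    fix x
    have "\<bar>u x * v x\<bar> \<le> (u x)\<^sup>2 + (v x)\<^sup>2"
      using sum_squares_bound[of "\<bar>u x\<bar>" "\<bar>v x\<bar>"] abs_ge_zero[of "u x * v x"]
      unfolding abs_mult power2_abs by linarith
    then show "norm (u x * v x) \<le> norm ((u x)\<^sup>2 + (v x)\<^sup>2)" by simp
  qed
qed

lemma L2_zero [simp]: "(\<lambda>x. 0) \<in> L2 \<Omega>"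
  by (simp add: L2_def)

lemma L2_scale: "u \<in> L2 \<Omega> \<Longrightarrow> (\<lambda>x. c * u x) \<in> L2 \<Omega>"
  by (auto simp: L2_def power_mult_distrib)

lemma L2_add:
  assumes "u \<in> L2 \<Omega>" "v \<in> L2 \<Omega>"
  shows "(\<lambda>x. u x + v x) \<in> L2 \<Omega>"
proof -
  have "integrable (lebesgue_on \<Omega>) (\<lambda>x. (u x)\<^sup>2 + 2 * (u x * v x) + (v x)\<^sup>2)"
    using assms by (intro Bochner_Integration.integrable_add integrable_mult_right L2_D L2_integrable_mult)
  then show ?thesis
    using assms by (auto simp: L2_def power2_sum algebra_simps)
qed

lemma L2_uminus: "u \<in> L2 \<Omega> \<Longrightarrow> (\<lambda>x. - u x) \<in> L2 \<Omega>"
  using L2_scale[of u \<Omega> "-1"] by simp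

lemma L2_diff: "u \<in> L2 \<Omega> \<Longrightarrow> v \<in> L2 \<Omega> \<Longrightarrow> (\<lambda>x. u x - v x) \<in> L2 \<Omega>"
  using L2_add[OF _ L2_uminus, of u \<Omega> v] by simp

lemma L2_divide: "u \<in> L2 \<Omega> \<Longrightarrow> (\<lambda>x. u x / c) \<in> L2 \<Omega>"
  using L2_scale[of u \<Omega> "1 / c"] by simp

lemma L2_bounded:
  assumes "u \<in> borel_measurable (lebesgue_on \<Omega>)" "\<Omega> \<in> lmeasurable" "\<And>x. x \<in> \<Omega> \<Longrightarrow> \<bar>u x\<bar> \<le> B"
  shows "u \<in> L2 \<Omega>"
proof -
  interpret finite_measure "lebesgue_on \<Omega>" using assms(2) by (intro finite_measure_lebesgue_on)
  have "integrable (lebesgue_on \<Omega>) (\<lambda>x. (u x)\<^sup>2)"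
  proof (rule integrable_const_bound[where B = "B\<^sup>2"])
    show "AE x in lebesgue_on \<Omega>. norm ((u x)\<^sup>2) \<le> B\<^sup>2"
    proof (intro AE_I2)
      fix x assume "x \<in> space (lebesgue_on \<Omega>)"
      then have "\<bar>u x\<bar> \<le> B" using assms(3) by simp
      then show "norm ((u x)\<^sup>2) \<le> B\<^sup>2" using power_mono[of "\<bar>u x\<bar>" B 2] by simp
    qed
  qed (use assms(1) in simp)
  then show ?thesis using assms(1) by (simp add: L2_def)
qed

section \<open>The inner product space of classes of square integrable functions\<close>

definition l2_eq :: "('a::euclidean_space \<Rightarrow> real) \<Rightarrow> ('a \<Rightarrow> real) \<Rightarrow> bool" where
  "l2_eq u v \<longleftrightarrow> u \<in> L2 UNIV \<and> v \<in> L2 UNIV \<and> (AE x in lebesgue. u x = v x)"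

lemma l2_eqI: "u \<in> L2 UNIV \<Longrightarrow> l2_eq u u"
  by (simp add: l2_eq_def)

\<comment> \<open>A type cannot depend on \<Omega>, so the classes live on the whole space and
  \<open>l2_class\<close> embeds functions on \<Omega> by extension with zero. As an instance of
  \<open>real_inner\<close> the type gives access to the abstract flow theory.\<close>
quotient_type (overloaded) 'a l2 = "'a::euclidean_space \<Rightarrow> real" / partial: l2_eq
proof (rule part_equivpI)
  show "\<exists>u :: 'a \<Rightarrow> real. l2_eq u u" by (intro exI[of _ "\<lambda>x. 0"]) (simp add: l2_eq_def)
  show "symp (l2_eq :: ('a \<Rightarrow> real) \<Rightarrow> _)"
    by (auto simp: symp_def l2_eq_def elim: AE_mp)
  show "transp (l2_eq :: ('a \<Rightarrow> real) \<Rightarrow> _)"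
    unfolding transp_def l2_eq_def by (auto elim!: eventually_elim2)
qed

instantiation l2 :: (euclidean_space) real_vector
begin

lift_definition zero_l2 :: "'a l2" is "\<lambda>x. 0"
  by (simp add: l2_eq_def)

lift_definition plus_l2 :: "'a l2 \<Rightarrow> 'a l2 \<Rightarrow> 'a l2" is "\<lambda>u v x. u x + v x"
  unfolding l2_eq_def by (auto intro!: L2_add elim!: eventually_elim2)

lift_definition minus_l2 :: "'a l2 \<Rightarrow> 'a l2 \<Rightarrow> 'a l2" is "\<lambda>u v x. u x - v x"
  unfolding l2_eq_def by (auto intro!: L2_diff elim!: eventually_elim2)

lift_definition uminus_l2 :: "'a l2 \<Rightarrow> 'a l2" is "\<lambda>u x. - u x"
  unfolding l2_eq_def by (auto intro!: L2_uminus elim!: eventually_mono)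

lift_definition scaleR_l2 :: "real \<Rightarrow> 'a l2 \<Rightarrow> 'a l2" is "\<lambda>c u x. c * u x"
  unfolding l2_eq_def by (auto intro!: L2_scale elim!: eventually_mono)

instance
proof
  fix x y z :: "'a l2" and a b :: real
  show "x + y + z = x + (y + z)"
    by transfer (auto simp: l2_eq_def ac_simps intro!: L2_add)
  show "x + y = y + x"
    by transfer (auto simp: l2_eq_def ac_simps intro!: L2_add)
  show "0 + x = x"
    by transfer (auto simp: l2_eq_def)
  show "- x + x = 0"
    by transfer (auto simp: l2_eq_def)
  show "x - y = x + - y"
    by transfer (auto simp: l2_eq_def intro!: L2_diff)
  show "a *\<^sub>R (x + y) = a *\<^sub>R x + a *\<^sub>R y"
    by transfer (auto simp: l2_eq_def distrib_left intro!: L2_add L2_scale)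
  show "(a + b) *\<^sub>R x = a *\<^sub>R x + b *\<^sub>R x"
    by transfer (auto simp: l2_eq_def distrib_right intro!: L2_add L2_scale)
  show "a *\<^sub>R b *\<^sub>R x = (a * b) *\<^sub>R x"
    by transfer (auto simp: l2_eq_def mult.assoc intro!: L2_scale)
  show "1 *\<^sub>R x = x"
    by transfer (auto simp: l2_eq_def)
qed

end

instantiation l2 :: (euclidean_space) real_inner
begin

lift_definition inner_l2 :: "'a l2 \<Rightarrow> 'a l2 \<Rightarrow> real" is "\<lambda>u v. LINT x|lebesgue. u x * v x"
proof -
  fix u u' v v' :: "'a \<Rightarrow> real"
  assume *: "l2_eq u u'" "l2_eq v v'"
  then have "AE x in lebesgue. u x = u' x" "AE x in lebesgue. v x = v' x"
    by (auto simp: l2_eq_def)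
  then have "AE x in lebesgue. u x * v x = u' x * v' x"
    by eventually_elim simp
  then show "(LINT x|lebesgue. u x * v x) = (LINT x|lebesgue. u' x * v' x)"
    using * by (intro integral_cong_AE) (auto simp: l2_eq_def L2_def)
qed

definition norm_l2 :: "'a l2 \<Rightarrow> real" where "norm_l2 x = sqrt (inner x x)"
definition dist_l2 :: "'a l2 \<Rightarrow> 'a l2 \<Rightarrow> real" where "dist_l2 x y = norm (x - y)"
definition sgn_l2 :: "'a l2 \<Rightarrow> 'a l2" where "sgn_l2 x = x /\<^sub>R norm x"
definition uniformity_l2 :: "('a l2 \<times> 'a l2) filter" where
  "uniformity_l2 = (INF e\<in>{0<..}. principal {(x, y). dist x y < e})"
definition open_l2 :: "'a l2 set \<Rightarrow> bool" where
  "open_l2 S \<longleftrightarrow> (\<forall>x\<in>S. \<forall>\<^sub>F (x', y) in uniformity. x' = x \<longrightarrow> y \<in> S)"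

lemma L2_UNIV_integrable_mult: "u \<in> L2 UNIV \<Longrightarrow> v \<in> L2 UNIV \<Longrightarrow> integrable lebesgue (\<lambda>x. u x * v x)"
  using L2_integrable_mult[of u UNIV v] by (simp add: lebesgue_on_UNIV_eq)

instance
proof
  fix x y z :: "'a l2" and r :: real
  show "inner x y = inner y x"
    by transfer (simp add: mult.commute)
  show "inner (x + y) z = inner x z + inner y z"
    by transfer (simp add: l2_eq_def distrib_right L2_UNIV_integrable_mult)
  show "inner (r *\<^sub>R x) y = r * inner x y"
    by transfer (simp add: mult.assoc)
  show "0 \<le> inner x x"
    by transfer simp
  show "(inner x x = 0) = (x = 0)"
  proof transfer
    fix u :: "'a \<Rightarrow> real" assume "l2_eq u u"
    then have u: "u \<in> L2 UNIV" by (simp add: l2_eq_def)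
    have "(LINT x|lebesgue. u x * u x) = 0 \<longleftrightarrow> (AE x in lebesgue. u x * u x = 0)"
      by (intro integral_nonneg_eq_0_iff_AE L2_UNIV_integrable_mult u) simp
    then show "((LINT x|lebesgue. u x * u x) = 0) = l2_eq u (\<lambda>x. 0)"
      using u by (simp add: l2_eq_def)
  qed
qed (fact norm_l2_def dist_l2_def sgn_l2_def uniformity_l2_def open_l2_def)+

end

definition l2_class :: "'a::euclidean_space set \<Rightarrow> ('a \<Rightarrow> real) \<Rightarrow> 'a l2" where
  "l2_class \<Omega> u = abs_l2 (\<lambda>x. indicator \<Omega> x * u x)"

context
  fixes \<Omega> :: "'a::euclidean_space set"
  assumes \<Omega>: "\<Omega> \<in> sets lebesgue"
begin

lemma lebesgue_on_measurable_extend: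
  fixes u :: "'a \<Rightarrow> real"
  shows "u \<in> borel_measurable (lebesgue_on \<Omega>) \<longleftrightarrow> (\<lambda>x. indicator \<Omega> x * u x) \<in> borel_measurable lebesgue"
  using borel_measurable_restrict_space_iff[of \<Omega> lebesgue u] \<Omega> by (simp add: mult.commute)

lemma lebesgue_on_integral_extend:
  fixes u :: "'a \<Rightarrow> real"
  shows "(LINT x|lebesgue_on \<Omega>. u x) = (LINT x|lebesgue. indicator \<Omega> x * u x)"
  using integral_restrict_space[of \<Omega> lebesgue u] \<Omega> by simp

lemma lebesgue_on_integrable_extend:
  fixes u :: "'a \<Rightarrow> real"
  shows "integrable (lebesgue_on \<Omega>) u \<longleftrightarrow> integrable lebesgue (\<lambda>x. indicator \<Omega> x * u x)"
  using integrable_restrict_space[of \<Omega> lebesgue u] \<Omega> by simp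

lemma L2_extend:
  assumes "u \<in> L2 \<Omega>" shows "(\<lambda>x. indicator \<Omega> x * u x) \<in> L2 UNIV"
proof -
  have "(\<lambda>x. (indicator \<Omega> x * u x)\<^sup>2) = (\<lambda>x. indicator \<Omega> x * (u x)\<^sup>2)"
    by (auto simp: indicator_def)
  then show ?thesis
    using assms by (simp add: L2_def lebesgue_on_measurable_extend lebesgue_on_integrable_extend lebesgue_on_UNIV_eq)
qed

lemma l2_class_eqI: 
  assumes "u \<in> L2 \<Omega>" shows "l2_eq (\<lambda>x. indicator \<Omega> x * u x) (\<lambda>x. indicator \<Omega> x * u x)"
  by (intro l2_eqI L2_extend assms)

lemma inner_l2_class:
  assumes "u \<in> L2 \<Omega>" "v \<in> L2 \<Omega>"
  shows "inner (l2_class \<Omega> u) (l2_class \<Omega> v) = L2_inner \<Omega> u v"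
proof -
  have "inner (l2_class \<Omega> u) (l2_class \<Omega> v) = (LINT x|lebesgue. indicator \<Omega> x * u x * (indicator \<Omega> x * v x))"
    unfolding l2_class_def by (intro inner_l2.abs_eq l2_class_eqI assms)
  also have "\<dots> = (LINT x|lebesgue. indicator \<Omega> x * (u x * v x))"
    by (intro Bochner_Integration.integral_cong) (auto simp: indicator_def)
  finally show ?thesis by (simp add: L2_inner_def lebesgue_on_integral_extend)
qed

lemma norm_l2_class: "u \<in> L2 \<Omega> \<Longrightarrow> norm (l2_class \<Omega> u) = L2_norm \<Omega> u"
  by (simp add: norm_eq_sqrt_inner inner_l2_class L2_norm_def)

lemma l2_class_add:
  assumes "u \<in> L2 \<Omega>" "v \<in> L2 \<Omega>"
  shows "l2_class \<Omega> (\<lambda>x. u x + v x) = l2_class \<Omega> u + l2_class \<Omega> v"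
  unfolding l2_class_def plus_l2.abs_eq[OF l2_class_eqI[OF assms(1)] l2_class_eqI[OF assms(2)]]
  by (simp add: distrib_left)

lemma l2_class_diff:
  assumes "u \<in> L2 \<Omega>" "v \<in> L2 \<Omega>"
  shows "l2_class \<Omega> (\<lambda>x. u x - v x) = l2_class \<Omega> u - l2_class \<Omega> v"
  unfolding l2_class_def minus_l2.abs_eq[OF l2_class_eqI[OF assms(1)] l2_class_eqI[OF assms(2)]]
  by (simp add: right_diff_distrib)

lemma l2_class_uminus:
  assumes "u \<in> L2 \<Omega>" shows "l2_class \<Omega> (\<lambda>x. - u x) = - l2_class \<Omega> u"
  unfolding l2_class_def uminus_l2.abs_eq[OF l2_class_eqI[OF assms(1)]] by simp

lemma l2_class_scale:
  assumes "u \<in> L2 \<Omega>" shows "l2_class \<Omega> (\<lambda>x. c * u x) = c *\<^sub>R l2_class \<Omega> u"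
  unfolding l2_class_def scaleR_l2.abs_eq[OF l2_class_eqI[OF assms(1)]] by (simp add: mult.left_commute)

lemma l2_class_divide:
  assumes "u \<in> L2 \<Omega>" shows "l2_class \<Omega> (\<lambda>x. u x / c) = l2_class \<Omega> u /\<^sub>R c"
  using l2_class_scale[OF assms, of "inverse c"] by (simp add: divide_inverse mult.commute)

lemma l2_class_eq_iff:
  assumes "u \<in> L2 \<Omega>" "v \<in> L2 \<Omega>"
  shows "l2_class \<Omega> u = l2_class \<Omega> v \<longleftrightarrow> (AE x in lebesgue_on \<Omega>. u x = v x)"
proof -
  have "l2_class \<Omega> u = l2_class \<Omega> v \<longleftrightarrow> l2_eq (\<lambda>x. indicator \<Omega> x * u x) (\<lambda>x. indicator \<Omega> x * v x)"
    unfolding l2_class_def using Quotient3_rel[OF Quotient3_l2] l2_class_eqI[OF assms(1)] l2_class_eqI[OF assms(2)] by blast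
  also have "\<dots> \<longleftrightarrow> (AE x in lebesgue. indicator \<Omega> x * u x = indicator \<Omega> x * v x)"
    using assms L2_extend by (simp add: l2_eq_def)
  also have "\<dots> \<longleftrightarrow> (AE x in lebesgue. x \<in> \<Omega> \<longrightarrow> u x = v x)"
    by (intro AE_cong) (auto simp: indicator_def)
  also have "\<dots> \<longleftrightarrow> (AE x in lebesgue_on \<Omega>. u x = v x)"
    using \<Omega> by (simp add: AE_restrict_space_iff)
  finally show ?thesis .
qed

lemma l2_class_zero: "l2_class \<Omega> (\<lambda>x. 0) = 0"
  unfolding l2_class_def by (simp add: zero_l2_def)

lemma l2_class_eq_0_iff:
  assumes "u \<in> L2 \<Omega>"
  shows "l2_class \<Omega> u = 0 \<longleftrightarrow> (AE x in lebesgue_on \<Omega>. u x = 0)"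
  using l2_class_eq_iff[OF assms L2_zero] by (simp add: l2_class_zero)

end

section \<open>Test functions\<close>

lemma continuously_differentiable_imp_continuous:
  "continuously_differentiable k \<phi> \<Longrightarrow> continuous_on UNIV \<phi>"
  by (cases k) (auto intro!: continuous_at_imp_continuous_on differentiable_imp_continuous_within)

text \<open>The definition refers to \<open>frechet_derivative\<close>; this rule accepts any
  exhibited derivative instead, which is what the inductions on the order use.\<close>

lemma continuously_differentiable_SucI:
  assumes "\<And>x. (f has_derivative f' x) (at x)"
    and "\<And>b. b \<in> Basis \<Longrightarrow> continuously_differentiable k (\<lambda>x. f' x b)"
  shows "continuously_differentiable (Suc k) f"
proof -
  have "frechet_derivative f (at x) = f' x" for x
    using frechet_derivative_at[OF assms(1)] by simp
  then show ?thesis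
    using assms by (auto simp: differentiable_def)
qed

lemma continuously_differentiable_SucD:
  assumes "continuously_differentiable (Suc k) f"
  shows "(f has_derivative frechet_derivative f (at x)) (at x)"
    "b \<in> Basis \<Longrightarrow> continuously_differentiable k (\<lambda>x. frechet_derivative f (at x) b)"
  using assms by (auto simp: frechet_derivative_works)

lemma continuously_differentiable_Suc_imp:
  "continuously_differentiable (Suc k) f \<Longrightarrow> continuously_differentiable k f"
proof (induction k arbitrary: f)
  case 0
  then show ?case using continuously_differentiable_imp_continuous[OF 0] by simp
next
  case (Suc k)
  then show ?case
    using continuously_differentiable_SucD[OF Suc.prems]
    by (intro continuously_differentiable_SucI) auto
qed

lemma continuously_differentiable_const: "continuously_differentiable k (\<lambda>x. c)"
  by (induction k arbitrary: c) (auto intro!: continuously_differentiable_SucI[where f' = "\<lambda>x v. 0"])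

lemma continuously_differentiable_inner_const: "continuously_differentiable k (\<lambda>x. x \<bullet> c)"
proof (cases k)
  case (Suc j)
  show ?thesis unfolding Suc
    by (rule continuously_differentiable_SucI[where f' = "\<lambda>x v. v \<bullet> c"])
       (auto intro!: derivative_eq_intros continuously_differentiable_const)
qed (auto intro!: continuous_intros)

lemma continuously_differentiable_add:
  "continuously_differentiable k f \<Longrightarrow> continuously_differentiable k g \<Longrightarrow>
   continuously_differentiable k (\<lambda>x. f x + g x)"
proof (induction k arbitrary: f g)
  case 0
  then show ?case by (auto intro!: continuous_intros)
next
  case (Suc k)
  note f = continuously_differentiable_SucD[OF Suc.prems(1)]
  note g = continuously_differentiable_SucD[OF Suc.prems(2)]
  show ?case
    by (rule continuously_differentiable_SucI[OF has_derivative_add[OF f(1) g(1)]]) (intro Suc.IH f g)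
qed

lemma continuously_differentiable_mult:
  "continuously_differentiable k f \<Longrightarrow> continuously_differentiable k g \<Longrightarrow>
   continuously_differentiable k (\<lambda>x. f x * g x)"
proof (induction k arbitrary: f g)
  case 0
  then show ?case by (auto intro!: continuous_intros)
next
  case (Suc k)
  note f = continuously_differentiable_SucD[OF Suc.prems(1)]
  note g = continuously_differentiable_SucD[OF Suc.prems(2)]
  show ?case
    by (rule continuously_differentiable_SucI[OF has_derivative_mult[OF f(1) g(1)]])
       (intro continuously_differentiable_add Suc.IH f(2) g(2) Suc.prems[THEN continuously_differentiable_Suc_imp])
qed

lemma continuously_differentiable_prod:
  assumes "finite A" "\<And>i. i \<in> A \<Longrightarrow> continuously_differentiable k (f i)"
  shows "continuously_differentiable k (\<lambda>x. \<Prod>i\<in>A. f i x)"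
  using assms by (induction rule: finite_induct)
    (auto intro!: continuously_differentiable_const continuously_differentiable_mult)

lemma continuously_differentiable_reflect:
  fixes f :: "'a::euclidean_space \<Rightarrow> real"
  shows "continuously_differentiable k f \<Longrightarrow> continuously_differentiable k (\<lambda>y. f (x - y))"
proof (induction k arbitrary: f)
  case 0
  then have "continuous_on UNIV f" by simp
  then have "continuous_on UNIV (\<lambda>y. f (x - y))"
    by (rule continuous_on_compose2[of _ f]) (auto intro!: continuous_intros)
  then show ?case by simp
next
  case (Suc k)
  note f = continuously_differentiable_SucD[OF Suc.prems]
  have 1: "((\<lambda>y. f (x - y)) has_derivative (\<lambda>v. frechet_derivative f (at (x - y)) (- v))) (at y)" for y
    by (rule has_derivative_compose[where f = "\<lambda>y. x - y", OF _ f(1)]) (auto intro!: derivative_eq_intros)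
  have 2: "frechet_derivative f (at (x - y)) (- v) = (- 1) * frechet_derivative f (at (x - y)) v" for y v
    using linear_neg[OF has_derivative_linear[OF f(1)]] by simp
  show ?case
    by (rule continuously_differentiable_SucI[OF 1], unfold 2)
       (intro continuously_differentiable_mult continuously_differentiable_const Suc.IH f(2))
qed

text \<open>The classical flat function is the case \<open>m = 0\<close>. The powers in the
  denominator make the family closed under differentiation up to linear combinations, so smoothness
  follows by one induction on the order, simultaneously for all \<open>m\<close>.\<close>

definition flat_exp :: "nat \<Rightarrow> real \<Rightarrow> real" where
  "flat_exp m s = (if 0 < s then exp (- (1 / s)) / s ^ m else 0)"

lemma flat_exp_tendsto_0: "((\<lambda>s. flat_exp m s) \<longlongrightarrow> 0) (at 0)"
proof -
  have "((\<lambda>x::real. x ^ m / exp x) \<longlongrightarrow> 0) at_top" by (rule tendsto_power_div_exp_0)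
  then have "((\<lambda>s::real. inverse s ^ m / exp (inverse s)) \<longlongrightarrow> 0) (at_right 0)"
    by (rule filterlim_compose) (rule filterlim_inverse_at_top_right)
  then have "((\<lambda>s. flat_exp m s) \<longlongrightarrow> 0) (at_right 0)"
  proof (rule Lim_transform_eventually)
    show "\<forall>\<^sub>F s in at_right 0. inverse s ^ m / exp (inverse s) = flat_exp m s"
      by (auto simp: eventually_at_filter flat_exp_def exp_minus divide_inverse power_inverse mult.commute)
  qed
  moreover have "((\<lambda>s. flat_exp m s) \<longlongrightarrow> 0) (at_left 0)"
    by (rule tendsto_eventually) (auto simp: eventually_at_filter flat_exp_def)
  ultimately show ?thesis by (simp add: filterlim_split_at)
qed

lemma flat_exp_derivative:
  "(flat_exp m has_real_derivative (flat_exp (m + 2) s - real m * flat_exp (m + 1) s)) (at s)"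
proof -
  consider "s > 0" | "s < 0" | "s = 0" by linarith
  then show ?thesis
  proof cases
    case 1
    have "((\<lambda>s. exp (- (1 / s)) / s ^ m) has_real_derivative (flat_exp (m + 2) s - real m * flat_exp (m + 1) s)) (at s)"
    proof -
      have d1: "((\<lambda>s. exp (- (1 / s))) has_real_derivative exp (- (1 / s)) * (1 / s\<^sup>2)) (at s)"
        using 1 by (auto intro!: derivative_eq_intros simp: power2_eq_square field_simps)
      have d2: "((\<lambda>s. inverse s ^ m) has_real_derivative - (real m * inverse s ^ (m + 1))) (at s)"
      proof -
        have "((\<lambda>s. inverse s ^ m) has_real_derivative real m * (- (inverse s ^ Suc (Suc 0)) * inverse s ^ (m - Suc 0))) (at s)"
          using 1 by (intro DERIV_power DERIV_inverse) simp
        moreover have "real m * (- (inverse s ^ Suc (Suc 0)) * inverse s ^ (m - Suc 0)) = - (real m * inverse s ^ (m + 1))"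
          by (cases m) auto
        ultimately show ?thesis by metis
      qed
      have "exp (- (1 / s)) * (1 / s\<^sup>2) * inverse s ^ m + - (real m * inverse s ^ (m + 1)) * exp (- (1 / s))
          = flat_exp (m + 2) s - real m * flat_exp (m + 1) s"
        using 1 by (simp add: flat_exp_def divide_inverse power_inverse power2_eq_square)
      then have "((\<lambda>s. exp (- (1 / s)) * inverse s ^ m) has_real_derivative
          (flat_exp (m + 2) s - real m * flat_exp (m + 1) s)) (at s)"
        using DERIV_mult[OF d1 d2] by metis
      then show ?thesis by (simp add: divide_inverse power_inverse)
    qed
    then show ?thesis
      by (rule has_field_derivative_transform_within_open[of _ _ _ "{0<..}"]) (use 1 in \<open>auto simp: flat_exp_def\<close>)
  next
    case 2
    have "((\<lambda>s. 0) has_real_derivative (flat_exp (m + 2) s - real m * flat_exp (m + 1) s)) (at s)"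
      using 2 by (simp add: flat_exp_def)
    then show ?thesis
      by (rule has_field_derivative_transform_within_open[of _ _ _ "{..<0}"]) (use 2 in \<open>auto simp: flat_exp_def\<close>)
  next
    case 3
    have "((\<lambda>h. (flat_exp m (0 + h) - flat_exp m 0) / h) \<longlongrightarrow> 0) (at 0)"
    \<comment> \<open>At the origin the difference quotient of \<open>flat_exp m\<close> is exactly
      \<open>flat_exp (m + 1)\<close>.\<close>
    proof (rule Lim_transform_eventually[OF flat_exp_tendsto_0[of "m + 1"]])
      show "\<forall>\<^sub>F h in at 0. flat_exp (m + 1) h = (flat_exp m (0 + h) - flat_exp m 0) / h"
        by (auto simp: eventually_at_filter flat_exp_def)
    qed
    then show ?thesis using 3 by (simp add: DERIV_def flat_exp_def)
  qed
qed

lemma continuously_differentiable_flat_exp: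
  assumes "\<And>k. continuously_differentiable k q"
  shows "continuously_differentiable k (\<lambda>x. flat_exp m (q x))"
proof (induction k arbitrary: m)
  case 0
  have "continuous_on UNIV (flat_exp m)"
    using flat_exp_derivative DERIV_isCont continuous_at_imp_continuous_on by blast
  moreover have "continuous_on UNIV q" using continuously_differentiable_imp_continuous assms by blast
  ultimately have "continuous_on UNIV (\<lambda>x. flat_exp m (q x))"
    by (rule continuous_on_compose2) auto
  then show ?case by simp
next
  case (Suc k)
  note q = continuously_differentiable_SucD[OF assms]
  have "((\<lambda>x. flat_exp m (q x)) has_derivative
      (\<lambda>v. (flat_exp (m + 2) (q x) + (- real m) * flat_exp (m + 1) (q x)) * frechet_derivative q (at x) v)) (at x)" for x
    using has_derivative_compose[OF q(1) flat_exp_derivative[unfolded has_field_derivative_def]] by simp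
  then show ?case
    by (rule continuously_differentiable_SucI)
       (intro continuously_differentiable_mult continuously_differentiable_add continuously_differentiable_const Suc.IH q(2))
qed

lemma flat_exp_nonneg: "0 \<le> flat_exp m s" and flat_exp_0_le_1: "flat_exp 0 s \<le> 1"
  and flat_exp_eq_0_iff: "flat_exp m s = 0 \<longleftrightarrow> s \<le> 0"
  by (auto simp: flat_exp_def)

lemma flat_exp_0_tendsto_1:
  assumes "s > 0" shows "(\<lambda>k. flat_exp 0 (real (Suc k) * s)) \<longlonglongrightarrow> 1"
proof -
  have "(\<lambda>k. exp (- (inverse (real (Suc k)) * (1 / s)))) \<longlonglongrightarrow> exp (- (0 * (1 / s)))"
    by (intro tendsto_intros LIMSEQ_inverse_real_of_nat)
  moreover have "exp (- (inverse (real (Suc k)) * (1 / s))) = flat_exp 0 (real (Suc k) * s)" for k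
    using assms by (simp add: flat_exp_def divide_inverse mult.commute)
  ultimately show ?thesis by simp
qed

text \<open>For a nonempty box the quadratic factor of a coordinate is positive exactly when that
  coordinate lies strictly between the two bounds. Multiplying it by \<open>Suc k\<close> drives the
  flat function to 1 there, so the bumps tend pointwise to the indicator of the open box.\<close>

definition box_bump :: "'a::euclidean_space \<Rightarrow> 'a \<Rightarrow> nat \<Rightarrow> 'a \<Rightarrow> real" where
  "box_bump \<alpha> \<beta> k x = (\<Prod>b\<in>Basis. flat_exp 0 (real (Suc k) * ((x \<bullet> b - \<alpha> \<bullet> b) * (\<beta> \<bullet> b - x \<bullet> b))))"

lemma box_bump_smooth: "continuously_differentiable j (box_bump \<alpha> \<beta> k)"
proof -
  have "continuously_differentiable j (\<lambda>x. real (Suc k) * ((x \<bullet> b + (- (\<alpha> \<bullet> b))) * (\<beta> \<bullet> b + (- 1) * (x \<bullet> b))))" for j b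
    by (intro continuously_differentiable_mult continuously_differentiable_add
        continuously_differentiable_const continuously_differentiable_inner_const)
  then have "continuously_differentiable j (\<lambda>x. real (Suc k) * ((x \<bullet> b - \<alpha> \<bullet> b) * (\<beta> \<bullet> b - x \<bullet> b)))" for j b
    by simp
  then have "continuously_differentiable j (\<lambda>x. \<Prod>b\<in>Basis. flat_exp 0 (real (Suc k) * ((x \<bullet> b - \<alpha> \<bullet> b) * (\<beta> \<bullet> b - x \<bullet> b))))"
    by (intro continuously_differentiable_prod continuously_differentiable_flat_exp) auto
  then show ?thesis unfolding box_bump_def[abs_def] .
qed

lemma box_bump_bounds: "0 \<le> box_bump \<alpha> \<beta> k x" "box_bump \<alpha> \<beta> k x \<le> 1"
  unfolding box_bump_def by (auto intro!: prod_nonneg prod_le_1 flat_exp_nonneg flat_exp_0_le_1)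

context
  fixes \<alpha> \<beta> :: "'a::euclidean_space"
  assumes ne: "box \<alpha> \<beta> \<noteq> {}"
begin

text \<open>The product could also be positive with both factors negative; this needs the bounds in
  the wrong order and is excluded by nonemptiness of the box.\<close>

lemma box_factor_pos_iff:
  assumes "b \<in> Basis"
  shows "(x \<bullet> b - \<alpha> \<bullet> b) * (\<beta> \<bullet> b - x \<bullet> b) > 0 \<longleftrightarrow> \<alpha> \<bullet> b < x \<bullet> b \<and> x \<bullet> b < \<beta> \<bullet> b"
  using ne assms unfolding box_ne_empty by (fastforce simp: zero_less_mult_iff)

lemma box_bump_outside: "x \<notin> box \<alpha> \<beta> \<Longrightarrow> box_bump \<alpha> \<beta> k x = 0"
proof -
  assume "x \<notin> box \<alpha> \<beta>"
  then obtain b where "b \<in> Basis" "\<not> (\<alpha> \<bullet> b < x \<bullet> b \<and> x \<bullet> b < \<beta> \<bullet> b)" by (auto simp: mem_box)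
  then have "(x \<bullet> b - \<alpha> \<bullet> b) * (\<beta> \<bullet> b - x \<bullet> b) \<le> 0" "b \<in> Basis" using box_factor_pos_iff[of b x] by auto
  then have "flat_exp 0 (real (Suc k) * ((x \<bullet> b - \<alpha> \<bullet> b) * (\<beta> \<bullet> b - x \<bullet> b))) = 0"
    unfolding flat_exp_eq_0_iff by (intro mult_nonneg_nonpos[OF of_nat_0_le_iff])
  then show ?thesis unfolding box_bump_def using \<open>b \<in> Basis\<close> by auto
qed

lemma box_bump_tendsto: "(\<lambda>k. box_bump \<alpha> \<beta> k x) \<longlonglongrightarrow> indicator (box \<alpha> \<beta>) x"
proof (cases "x \<in> box \<alpha> \<beta>")
  case True
  have "(\<lambda>k. box_bump \<alpha> \<beta> k x) \<longlonglongrightarrow> (\<Prod>b\<in>(Basis::'a set). 1)"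
    unfolding box_bump_def using True box_factor_pos_iff[of _ x]
    by (intro tendsto_prod flat_exp_0_tendsto_1) (auto simp: mem_box)
  then show ?thesis using True by simp
qed (simp add: box_bump_outside)

lemma box_bump_test_function:
  assumes "cbox \<alpha> \<beta> \<subseteq> \<Omega>" shows "box_bump \<alpha> \<beta> k \<in> test_functions \<Omega>"
proof -
  have "{x. box_bump \<alpha> \<beta> k x \<noteq> 0} \<subseteq> cbox \<alpha> \<beta>" using box_bump_outside box_subset_cbox by blast
  then have *: "closure {x. box_bump \<alpha> \<beta> k x \<noteq> 0} \<subseteq> cbox \<alpha> \<beta>" by (intro closure_minimal) auto
  then have "compact (closure {x. box_bump \<alpha> \<beta> k x \<noteq> 0})"
    using compact_cbox closed_closure compact_Int_closed by (metis inf.absorb_iff2)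
  then show ?thesis using * assms box_bump_smooth by (auto simp: test_functions_def)
qed

end

section \<open>The fundamental lemma of the calculus of variations\<close>

text \<open>The sets \<open>A\<close> with \<open>\<integral>\<^sub>A h = 0\<close> form a Dynkin system containing the boxes.\<close>

lemma AE_zero_if_box_integrals_zero:
  fixes h :: "'a::euclidean_space \<Rightarrow> real"
  assumes int: "integrable lebesgue h"
    and zero: "\<And>a b. (LINT x|lebesgue. indicator (box a b) x * h x) = 0"
  shows "AE x in lebesgue. h x = 0"
proof -
  have intA: "integrable lebesgue (\<lambda>x. indicator A x * h x)" if "A \<in> sets borel" for A
    using integrable_mult_indicator[OF _ int, of A] that by simp
  \<comment> \<open>The whole space is exhausted by boxes; its integral is needed to pass to
    complements in the Dynkin system.\<close>
  have tot: "(LINT x|lebesgue. h x) = 0"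
  proof -
    have "(\<lambda>n. LINT x|lebesgue. indicator (box (- real n *\<^sub>R One) (real n *\<^sub>R One)) x * h x) \<longlonglongrightarrow> (LINT x|lebesgue. h x)"
    proof (rule integral_dominated_convergence[where w = "\<lambda>x. \<bar>h x\<bar>"])
      show "AE x in lebesgue. (\<lambda>n. indicator (box (- real n *\<^sub>R One) (real n *\<^sub>R One)) x * h x) \<longlonglongrightarrow> h x"
      proof (intro AE_I2)
        fix x :: 'a
        have "x \<in> (\<Union>i::nat. box (- (real i *\<^sub>R One)) (real i *\<^sub>R One))"
          unfolding UN_box_eq_UNIV by simp
        then obtain N where N: "x \<in> box (- real N *\<^sub>R One) (real N *\<^sub>R One)"
          by auto
        have "x \<in> box (- real n *\<^sub>R One) (real n *\<^sub>R One)" if "n \<ge> N" for n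
        proof -
          have "real N \<le> real n" using that by simp
          then show ?thesis using N unfolding mem_box by (force simp: inner_sum_left_Basis)
        qed
        then have "\<forall>\<^sub>F n in sequentially. indicator (box (- real n *\<^sub>R One) (real n *\<^sub>R One)) x * h x = h x"
          unfolding eventually_sequentially by (intro exI[of _ N]) auto
        then show "(\<lambda>n. indicator (box (- real n *\<^sub>R One) (real n *\<^sub>R One)) x * h x) \<longlonglongrightarrow> h x"
          by (rule tendsto_eventually)
      qed
      show "AE x in lebesgue. norm (indicator (box (- real n *\<^sub>R One) (real n *\<^sub>R One)) x * h x) \<le> \<bar>h x\<bar>" for n
        by (intro AE_I2) (auto simp: indicator_def)
    qed (use int intA in \<open>auto intro: borel_measurable_integrable\<close>)
    then show ?thesis unfolding zero using LIMSEQ_unique tendsto_const by blast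
  qed
  have all: "(LINT x|lebesgue. indicator A x * h x) = 0" if "A \<in> sets borel" for A
  proof -
    let ?G = "range (\<lambda>(a, b). box a b) :: 'a set set"
    have "Int_stable ?G"
      by (auto simp: Int_stable_def Int_interval_mixed_eq_empty box_Int_box)
    moreover have "?G \<subseteq> Pow UNIV" by simp
    moreover have "A \<in> sigma_sets UNIV ?G"
      using that by (simp add: borel_eq_box)
    ultimately show ?thesis
    proof (induction rule: sigma_sets_induct_disjoint)
      case (basic A)
      then show ?case using zero by auto
    next
      case empty
      then show ?case by simp
    next
      case (compl A)
      then have A: "A \<in> sets borel" by (simp add: borel_eq_box)
      have "(LINT x|lebesgue. indicator (UNIV - A) x * h x) = (LINT x|lebesgue. h x - indicator A x * h x)"
        by (intro Bochner_Integration.integral_cong) (auto simp: indicator_def)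
      also have "\<dots> = 0"
        using compl tot by (simp add: Bochner_Integration.integral_diff[OF int intA[OF A]])
      finally show ?case .
    next
      case (union A)
      then have A: "A i \<in> sets borel" for i by (auto simp: borel_eq_box)
      have "(LINT x:(\<Union>i. A i)|lebesgue. h x) = (\<Sum>i. LINT x:(A i)|lebesgue. h x)"
      proof (rule lebesgue_integral_countable_add)
        show "set_integrable lebesgue (\<Union>i. A i) h"
          using intA[of "\<Union>i. A i"] A by (auto simp: set_integrable_def)
      qed (use A union in \<open>auto simp: disjoint_family_on_def\<close>)
      then show ?case using union by (simp add: set_lebesgue_integral_def)
    qed
  qed
  \<comment> \<open>The sign sets of \<open>h\<close> are only Lebesgue measurable, whereas
    \<open>all\<close> speaks of Borel sets. A Borel representative has Borel sign sets.\<close>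
  obtain g where g: "g \<in> borel_measurable lborel" "AE x in lborel. h x = g x"
    using completion_ex_borel_measurable_real[OF borel_measurable_integrable[OF int]] by blast
  have g': "g \<in> borel_measurable borel" using g(1) by simp
  have hg: "AE x in lebesgue. h x = g x" using AE_completion[OF g(2)] .
  have gl: "g \<in> borel_measurable lebesgue" using g(1) by (rule measurable_completion)
  have intg: "integrable lebesgue g"
    using integrable_cong_AE[OF borel_measurable_integrable[OF int] gl hg] int by simp
  \<comment> \<open>The constant \<open>c\<close> takes the values 1 and -1, so that the positive
    and the negative set are treated alike: a function of one sign with zero integral vanishes
    almost everywhere.\<close>
  have part: "AE x in lebesgue. indicator A x * g x = 0"
    if A: "A \<in> sets borel" and sgn: "(\<And>x. x \<in> A \<Longrightarrow> 0 \<le> c * g x)" and c: "c \<noteq> 0" for A c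
  proof -
    have i: "integrable lebesgue (\<lambda>x. c * (indicator A x * g x))"
      using integrable_mult_indicator[OF _ intg, of A] A by simp
    have m: "(\<lambda>x. indicator A x * h x) \<in> borel_measurable lebesgue" "(\<lambda>x. indicator A x * g x) \<in> borel_measurable lebesgue"
      using intA[OF A] integrable_mult_indicator[OF _ intg, of A] A by (auto intro: borel_measurable_integrable)
    have "(LINT x|lebesgue. indicator A x * g x) = (LINT x|lebesgue. indicator A x * h x)"
      using m hg by (intro integral_cong_AE) (auto elim: eventually_mono)
    then have "(LINT x|lebesgue. c * (indicator A x * g x)) = 0" using all[OF A] by simp
    moreover have "AE x in lebesgue. 0 \<le> c * (indicator A x * g x)"
      using sgn by (intro AE_I2) (auto simp: indicator_def)
    ultimately have "AE x in lebesgue. c * (indicator A x * g x) = 0"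
      using integral_nonneg_eq_0_iff_AE[OF i] by blast
    then show ?thesis using c by simp
  qed
  have s: "{x. g x > 0} \<in> sets borel" "{x. g x < 0} \<in> sets borel"
    using g' by auto
  have "AE x in lebesgue. indicator {x. g x > 0} x * g x = 0"
    by (rule part[OF s(1), of 1]) auto
  moreover have "AE x in lebesgue. indicator {x. g x < 0} x * g x = 0"
    by (rule part[OF s(2), of "-1"]) auto
  ultimately show ?thesis using hg
    by eventually_elim (auto simp: indicator_def split: if_splits)
qed

text \<open>Bumps tending to the indicator of a box give vanishing box integrals. Since
  \<open>h\<close> is only locally integrable, the conclusion is drawn on one closed box inside
  \<Omega> at a time, and countably many such boxes cover \<Omega>.\<close>

lemma fundamental_lemma_of_variations:
  fixes h :: "'a::euclidean_space \<Rightarrow> real"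
  assumes \<Omega>: "open \<Omega>" and li: "locally_integrable \<Omega> h"
    and zero: "\<And>\<phi>. \<phi> \<in> test_functions \<Omega> \<Longrightarrow> (LINT x|lebesgue_on \<Omega>. h x * \<phi> x) = 0"
  shows "AE x in lebesgue_on \<Omega>. h x = 0"
proof -
  have \<Omega>m: "\<Omega> \<in> sets lebesgue" using \<Omega> by auto
  have boxzero: "(LINT x|lebesgue. indicator (box \<alpha> \<beta>) x * h x) = 0" if sub: "cbox \<alpha> \<beta> \<subseteq> \<Omega>" for \<alpha> \<beta>
  proof (cases "box \<alpha> \<beta> = {}")
    case False
    have "integrable (lebesgue_on (cbox \<alpha> \<beta>)) h"
      using li sub by (auto simp: locally_integrable_def)
    then have int: "integrable lebesgue (\<lambda>x. indicator (cbox \<alpha> \<beta>) x * h x)"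
      by (simp add: lebesgue_on_integrable_extend)
    have m: "(\<lambda>x. indicator \<Omega> x * h x) \<in> borel_measurable lebesgue"
      using li lebesgue_on_measurable_extend[OF \<Omega>m] by (auto simp: locally_integrable_def)
    have bb: "box_bump \<alpha> \<beta> k \<in> borel_measurable lebesgue" for k
      using borel_measurable_continuous_onI[OF continuously_differentiable_imp_continuous[OF box_bump_smooth]]
      by (intro measurable_completion) simp
    have "(\<lambda>k. LINT x|lebesgue. box_bump \<alpha> \<beta> k x * (indicator \<Omega> x * h x)) \<longlonglongrightarrow> (LINT x|lebesgue. indicator (box \<alpha> \<beta>) x * (indicator \<Omega> x * h x))"
    proof (rule integral_dominated_convergence[where w = "\<lambda>x. \<bar>indicator (cbox \<alpha> \<beta>) x * h x\<bar>"])
      show "AE x in lebesgue. (\<lambda>k. box_bump \<alpha> \<beta> k x * (indicator \<Omega> x * h x)) \<longlonglongrightarrow> indicator (box \<alpha> \<beta>) x * (indicator \<Omega> x * h x)"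
        by (intro AE_I2 tendsto_mult box_bump_tendsto[OF False] tendsto_const)
      show "AE x in lebesgue. norm (box_bump \<alpha> \<beta> k x * (indicator \<Omega> x * h x)) \<le> \<bar>indicator (cbox \<alpha> \<beta>) x * h x\<bar>" for k
      proof (intro AE_I2)
        fix x
        show "norm (box_bump \<alpha> \<beta> k x * (indicator \<Omega> x * h x)) \<le> \<bar>indicator (cbox \<alpha> \<beta>) x * h x\<bar>"
        proof (cases "x \<in> box \<alpha> \<beta>")
          case True
          then have "x \<in> cbox \<alpha> \<beta>" using box_subset_cbox by blast
          then show ?thesis using box_bump_bounds[of \<alpha> \<beta> k x]
            by (auto simp: abs_mult indicator_def mult_left_le_one_le)
        qed (simp add: box_bump_outside[OF False])
      qed
    qed (use m bb int in \<open>auto intro!: borel_measurable_times borel_measurable_indicator\<close>)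
    moreover have "(LINT x|lebesgue. box_bump \<alpha> \<beta> k x * (indicator \<Omega> x * h x)) = 0" for k
      using zero[OF box_bump_test_function[OF False sub], of k] lebesgue_on_integral_extend[OF \<Omega>m]
      by (simp add: mult.commute mult.left_commute)
    ultimately have "(\<lambda>k::nat. 0) \<longlonglongrightarrow> (LINT x|lebesgue. indicator (box \<alpha> \<beta>) x * (indicator \<Omega> x * h x))"
      by simp
    then have "(LINT x|lebesgue. indicator (box \<alpha> \<beta>) x * (indicator \<Omega> x * h x)) = 0"
      by (simp add: LIMSEQ_const_iff)
    moreover have "indicator (box \<alpha> \<beta>) x * (indicator \<Omega> x * h x) = indicator (box \<alpha> \<beta>) x * h x" for x
      using subsetD[OF sub] subsetD[OF box_subset_cbox[of \<alpha> \<beta>], of x]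
      by (cases "x \<in> box \<alpha> \<beta>") (simp_all add: indicator_def)
    ultimately show ?thesis by simp
  qed simp
  have cb: "AE x in lebesgue. x \<in> cbox \<alpha> \<beta> \<longrightarrow> h x = 0" if sub: "cbox \<alpha> \<beta> \<subseteq> \<Omega>" for \<alpha> \<beta>
  proof -
    have "integrable (lebesgue_on (cbox \<alpha> \<beta>)) h"
      using li sub by (auto simp: locally_integrable_def)
    then have int: "integrable lebesgue (\<lambda>x. indicator (cbox \<alpha> \<beta>) x * h x)"
      by (simp add: lebesgue_on_integrable_extend)
    have "negligible (cbox \<alpha> \<beta> - box \<alpha> \<beta>)" by (rule negligible_frontier_interval)
    then have neg: "AE x in lebesgue. x \<notin> cbox \<alpha> \<beta> - box \<alpha> \<beta>"
      unfolding negligible_iff_null_sets by (rule AE_not_in)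
    have "AE x in lebesgue. indicator (cbox \<alpha> \<beta>) x * h x = 0"
    proof (rule AE_zero_if_box_integrals_zero[OF int])
      fix a b
      \<comment> \<open>A test box meets the open box in a box again, and replacing the closed box
        by the open one changes the integral only on the null boundary.\<close>
      obtain c d where cd: "box a b \<inter> box \<alpha> \<beta> = box c d" by (simp add: box_Int_box)
      have "(LINT x|lebesgue. indicator (box a b) x * (indicator (cbox \<alpha> \<beta>) x * h x)) = (LINT x|lebesgue. indicator (box c d) x * h x)"
      proof (rule integral_cong_AE)
        show "(\<lambda>x. indicator (box a b) x * (indicator (cbox \<alpha> \<beta>) x * h x)) \<in> borel_measurable lebesgue"
          using int by (intro borel_measurable_times[OF borel_measurable_indicator borel_measurable_integrable]) auto
        have eq: "(\<lambda>x. indicator (box c d) x * h x) = (\<lambda>x. indicator (box c d) x * (indicator (cbox \<alpha> \<beta>) x * h x))"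
        proof
          fix x
          have "x \<in> box c d \<Longrightarrow> x \<in> cbox \<alpha> \<beta>" using cd box_subset_cbox[of \<alpha> \<beta>] by blast
          then show "indicator (box c d) x * h x = indicator (box c d) x * (indicator (cbox \<alpha> \<beta>) x * h x)"
            by (cases "x \<in> box c d") (simp_all add: indicator_def)
        qed
        show "(\<lambda>x. indicator (box c d) x * h x) \<in> borel_measurable lebesgue"
          unfolding eq
          using int by (intro borel_measurable_times[OF borel_measurable_indicator borel_measurable_integrable]) auto
        show "AE x in lebesgue. indicator (box a b) x * (indicator (cbox \<alpha> \<beta>) x * h x) = indicator (box c d) x * h x"
          using neg
        proof eventually_elim
          case (elim x)
          then have "x \<in> box c d \<longleftrightarrow> x \<in> box a b \<and> x \<in> cbox \<alpha> \<beta>"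
            using cd box_subset_cbox[of \<alpha> \<beta>] by blast
          then show ?case by (simp add: indicator_def)
        qed
      qed
      also have "\<dots> = 0"
      proof (cases "box c d = {}")
        case False
        have "box c d \<subseteq> box \<alpha> \<beta>" using cd by auto
        then have "cbox c d \<subseteq> cbox \<alpha> \<beta>" using False by (metis closure_box closure_mono box_eq_empty(1) bot.extremum_uniqueI)
        then show ?thesis using boxzero sub by blast
      qed simp
      finally show "(LINT x|lebesgue. indicator (box a b) x * (indicator (cbox \<alpha> \<beta>) x * h x)) = 0" .
    qed
    then show ?thesis by eventually_elim (auto simp: indicator_def)
  qed
  obtain \<D> where D: "countable \<D>" "\<D> \<subseteq> Pow \<Omega>" "\<And>X. X \<in> \<D> \<Longrightarrow> \<exists>a b. X = cbox a b" "\<Union>\<D> = \<Omega>"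
    using open_countable_Union_open_cbox[OF \<Omega>] by metis
  have "AE x in lebesgue. \<forall>X\<in>\<D>. x \<in> X \<longrightarrow> h x = 0"
  proof (subst AE_ball_countable[OF D(1)], intro ballI)
    fix X assume "X \<in> \<D>"
    then show "AE x in lebesgue. x \<in> X \<longrightarrow> h x = 0" using D(2,3) cb by blast
  qed
  then have "AE x in lebesgue. x \<in> \<Omega> \<longrightarrow> h x = 0"
    by eventually_elim (use D(4) in blast)
  then show ?thesis using \<Omega>m by (simp add: AE_restrict_space_iff)
qed

section \<open>Mollification\<close>

lemma integrable_lborel_bounded_support:
  fixes f :: "'a::euclidean_space \<Rightarrow> real"
  assumes "continuous_on UNIV f" "\<And>x. R < norm x \<Longrightarrow> f x = 0"
  shows "integrable lborel f"
proof -
  have "integrable lborel (\<lambda>x. indicator (cball 0 R) x *\<^sub>R f x)"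
    using assms(1) continuous_on_subset by (intro borel_integrable_compact) auto
  moreover have "(\<lambda>x. indicator (cball 0 R) x *\<^sub>R f x) = f"
    using assms(2) by (force simp: indicator_def)
  ultimately show ?thesis by simp
qed

lemma continuous_bounded_support_imp_bounded:
  fixes f :: "'a::euclidean_space \<Rightarrow> real"
  assumes "continuous_on UNIV f" "\<And>x. R < norm x \<Longrightarrow> f x = 0"
  obtains B where "B \<ge> 0" "\<And>x. \<bar>f x\<bar> \<le> B"
proof -
  have "bounded (f ` cball 0 R)"
    using assms(1) continuous_on_subset by (intro compact_imp_bounded compact_continuous_image) auto
  then obtain B where B: "B > 0" "\<And>x. x \<in> cball 0 R \<Longrightarrow> \<bar>f x\<bar> \<le> B"
    unfolding bounded_pos by auto
  have "\<bar>f x\<bar> \<le> B" for x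
    using B assms(2)[of x] by (cases "x \<in> cball 0 R") auto
  then show ?thesis using that[of B] B by auto
qed

lemma lborel_integral_reflect:
  fixes f :: "'a::euclidean_space \<Rightarrow> real"
  assumes "f \<in> borel_measurable borel"
  shows "(LINT z|lborel. f (x - z)) = (LINT y|lborel. f y)"
proof -
  have "(lborel :: 'a measure) = density (distr lborel borel (\<lambda>z. x + (- 1) *\<^sub>R z)) (\<lambda>_. \<bar>- 1::real\<bar> ^ DIM('a))"
    by (rule lborel_affine) simp
  then have eq: "(lborel :: 'a measure) = distr lborel borel (\<lambda>z. x - z)"
    by (simp add: density_1)
  have "(LINT y|lborel. f y) = (LINT y|distr lborel borel (\<lambda>z. x - z). f y)" using eq by simp
  also have "\<dots> = (LINT z|lborel. f (x - z))" using assms by (intro integral_distr) auto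
  finally show ?thesis by simp
qed

lemma lborel_integral_translate:
  fixes f :: "'a::euclidean_space \<Rightarrow> real"
  assumes "f \<in> borel_measurable borel"
  shows "(LINT z|lborel. f (z + c)) = (LINT y|lborel. f y)"
proof -
  have "(LINT y|lborel. f y) = (LINT y|distr lborel borel ((+) c). f y)" by (simp add: lborel_distr_plus)
  also have "\<dots> = (LINT z|lborel. f (c + z))" using assms by (intro integral_distr) auto
  finally show ?thesis by (simp add: add.commute)
qed

lemma linear_basis_sum:
  fixes f :: "'a::euclidean_space \<Rightarrow> real"
  assumes "linear f" shows "f v = (\<Sum>b\<in>Basis. (v \<bullet> b) * f b)"
proof -
  have "f v = f (\<Sum>b\<in>Basis. (v \<bullet> b) *\<^sub>R b)" by (simp add: euclidean_representation)
  then show ?thesis using assms by (simp add: linear_sum linear_cmul)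
qed

definition smooth_supported :: "real \<Rightarrow> ('a::euclidean_space \<Rightarrow> real) \<Rightarrow> bool" where
  "smooth_supported R \<phi> \<longleftrightarrow> (\<forall>k. continuously_differentiable k \<phi>) \<and> (\<forall>x. R < norm x \<longrightarrow> \<phi> x = 0)"

context
  fixes \<phi> :: "'a::euclidean_space \<Rightarrow> real" and R :: real
  assumes ss: "smooth_supported R \<phi>"
begin

lemma smooth_supportedD:
  "continuously_differentiable k \<phi>" "R < norm x \<Longrightarrow> \<phi> x = 0"
  using ss by (auto simp: smooth_supported_def)

lemma smooth_continuous: "continuous_on UNIV \<phi>"
  using continuously_differentiable_imp_continuous[OF smooth_supportedD(1)] .

lemma smooth_has_derivative: "(\<phi> has_derivative frechet_derivative \<phi> (at x)) (at x)"
  using continuously_differentiable_SucD(1)[OF smooth_supportedD(1)] .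

lemma smooth_partial_continuous: "b \<in> Basis \<Longrightarrow> continuous_on UNIV (\<lambda>x. frechet_derivative \<phi> (at x) b)"
  using continuously_differentiable_imp_continuous[OF continuously_differentiable_SucD(2)[OF smooth_supportedD(1)]] .

lemma smooth_derivative_sum: "frechet_derivative \<phi> (at x) v = (\<Sum>b\<in>Basis. (v \<bullet> b) * frechet_derivative \<phi> (at x) b)"
  by (rule linear_basis_sum[OF has_derivative_linear[OF smooth_has_derivative]])

lemma smooth_derivative_continuous: "continuous_on UNIV (\<lambda>x. frechet_derivative \<phi> (at x) v)"
  unfolding smooth_derivative_sum[of _ v]
  by (intro continuous_intros smooth_partial_continuous)

lemma smooth_derivative_support:
  assumes "R < norm x" shows "frechet_derivative \<phi> (at x) v = 0"
proof -
  have "((\<lambda>x. 0) has_derivative (\<lambda>v. 0)) (at x)" by simp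
  then have "(\<phi> has_derivative (\<lambda>v. 0)) (at x)"
    by (rule has_derivative_transform_within_open[of _ _ _ _ "- cball 0 R"]) (use assms smooth_supportedD(2) in auto)
  then show ?thesis by (metis frechet_derivative_at)
qed

lemma smooth_derivative_bound:
  obtains K where "K \<ge> 0" "\<And>x v. \<bar>frechet_derivative \<phi> (at x) v\<bar> \<le> K * norm v"
proof -
  have "\<exists>K\<ge>0. \<forall>x. \<bar>frechet_derivative \<phi> (at x) b\<bar> \<le> K" for b
    using continuous_bounded_support_imp_bounded[OF smooth_derivative_continuous[of b] smooth_derivative_support] by metis
  then obtain K where K: "\<And>b. K b \<ge> 0" "\<And>b x. \<bar>frechet_derivative \<phi> (at x) b\<bar> \<le> K b" by metis
  show ?thesis
  proof
    show "0 \<le> (\<Sum>b\<in>(Basis::'a set). K b)" by (intro sum_nonneg K)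
    fix x v
    have "\<bar>frechet_derivative \<phi> (at x) v\<bar> \<le> (\<Sum>b\<in>Basis. \<bar>(v \<bullet> b) * frechet_derivative \<phi> (at x) b\<bar>)"
      unfolding smooth_derivative_sum[of x v] by (rule sum_abs)
    also have "\<dots> \<le> (\<Sum>b\<in>Basis. norm v * K b)"
      by (intro sum_mono) (auto simp: abs_mult intro!: mult_mono K Basis_le_norm)
    finally show "\<bar>frechet_derivative \<phi> (at x) v\<bar> \<le> (\<Sum>b\<in>Basis. K b) * norm v"
      by (simp add: sum_distrib_left mult.commute)
  qed
qed

lemma smooth_lipschitz:
  obtains K where "K \<ge> 0" "\<And>x y. \<bar>\<phi> x - \<phi> y\<bar> \<le> K * norm (x - y)"
proof -
  obtain K where K: "K \<ge> 0" "\<And>x v. \<bar>frechet_derivative \<phi> (at x) v\<bar> \<le> K * norm v"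
    using smooth_derivative_bound by blast
  have "norm (\<phi> x - \<phi> y) \<le> K * norm (x - y)" for x y
  proof (rule differentiable_bound[of UNIV \<phi> "\<lambda>x. frechet_derivative \<phi> (at x)"])
    show "onorm (frechet_derivative \<phi> (at x)) \<le> K" for x
      using K(2) by (intro onorm_le) auto
  qed (auto intro: smooth_has_derivative)
  then show ?thesis using that[of K] K by auto
qed

lemma smooth_reflected_derivative:
  "frechet_derivative (\<lambda>y. \<phi> (x - y)) (at y) v = - frechet_derivative \<phi> (at (x - y)) v"
proof -
  have "((\<lambda>y. \<phi> (x - y)) has_derivative (\<lambda>v. frechet_derivative \<phi> (at (x - y)) (- v))) (at y)"
    by (rule has_derivative_compose[where f = "\<lambda>y. x - y", OF _ smooth_has_derivative]) (auto intro!: derivative_eq_intros)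
  then have "frechet_derivative (\<lambda>y. \<phi> (x - y)) (at y) v = frechet_derivative \<phi> (at (x - y)) (- v)"
    using frechet_derivative_at by metis
  then show ?thesis
    using linear_neg[OF has_derivative_linear[OF smooth_has_derivative]] by simp
qed

lemma smooth_directional_derivative:
  "((\<lambda>t. \<phi> (x + t *\<^sub>R v)) has_real_derivative frechet_derivative \<phi> (at x) v) (at 0)"
proof -
  have "((\<lambda>t. \<phi> (x + t *\<^sub>R v)) has_derivative (\<lambda>t. frechet_derivative \<phi> (at x) (t *\<^sub>R v))) (at 0)"
    by (rule has_derivative_compose[where f = "\<lambda>t. x + t *\<^sub>R v" and g = \<phi>])
       (auto intro!: derivative_eq_intros smooth_has_derivative)
  moreover have "(\<lambda>t. frechet_derivative \<phi> (at x) (t *\<^sub>R v)) = (*) (frechet_derivative \<phi> (at x) v)"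
    using linear_cmul[OF has_derivative_linear[OF smooth_has_derivative]] by (auto simp: mult.commute)
  ultimately show ?thesis by (simp add: has_field_derivative_def)
qed

end

definition mollifier :: "real \<Rightarrow> ('a::euclidean_space \<Rightarrow> real) \<Rightarrow> bool" where
  "mollifier \<epsilon> \<eta> \<longleftrightarrow> (\<forall>k. continuously_differentiable k \<eta>) \<and> (\<forall>z. 0 \<le> \<eta> z) \<and>
     (\<forall>z. \<epsilon> \<le> norm z \<longrightarrow> \<eta> z = 0) \<and> (LINT z|lborel. \<eta> z) = 1"

lemma mollifier_exists:
  assumes "\<epsilon> > 0"
  obtains \<eta> :: "'a::euclidean_space \<Rightarrow> real" where "mollifier \<epsilon> \<eta>"
proof -
  \<comment> \<open>This is \<open>\<epsilon>\<^sup>2 - (norm z)\<^sup>2\<close>, written as a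
    polynomial in the coordinates so that smoothness follows from the sum and product rules.\<close>
  define q where "q = (\<lambda>z::'a. \<epsilon>\<^sup>2 + (-1) * (\<Sum>b\<in>Basis. (z \<bullet> b) * (z \<bullet> b)))"
  have qz: "q z = \<epsilon>\<^sup>2 - (norm z)\<^sup>2" for z
    unfolding q_def power2_norm_eq_inner euclidean_inner[of z z] by simp
  have sm: "continuously_differentiable k (\<lambda>z::'a. \<Sum>b\<in>B. (z \<bullet> b) * (z \<bullet> b))" if "finite B" for k B
    using that by (induction B) (auto intro!: continuously_differentiable_const continuously_differentiable_add
        continuously_differentiable_mult continuously_differentiable_inner_const)
  have q: "continuously_differentiable k q" for k
    unfolding q_def by (intro continuously_differentiable_add continuously_differentiable_mult continuously_differentiable_const sm) simp
  define \<psi> where "\<psi> = (\<lambda>z. flat_exp 0 (q z))"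
  have s\<psi>: "continuously_differentiable k \<psi>" for k
    unfolding \<psi>_def by (rule continuously_differentiable_flat_exp[OF q])
  have c\<psi>: "continuous_on UNIV \<psi>" using s\<psi> continuously_differentiable_imp_continuous by blast
  have 0: "\<psi> z = 0" if "\<epsilon> \<le> norm z" for z
    using that assms unfolding \<psi>_def flat_exp_eq_0_iff qz by (simp add: power_mono)
  have pos: "\<psi> z > 0" if "norm z < \<epsilon>" for z
  proof -
    have "q z > 0" using that assms unfolding qz by (simp add: power_strict_mono)
    then show ?thesis using flat_exp_nonneg[of 0 "q z"] flat_exp_eq_0_iff[of 0 "q z"] by (simp add: \<psi>_def less_le)
  qed
  have nn: "\<psi> z \<ge> 0" for z by (simp add: \<psi>_def flat_exp_nonneg)
  have int: "integrable lborel \<psi>"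
    using 0 by (intro integrable_lborel_bounded_support[OF c\<psi>, of \<epsilon>]) auto
  define I where "I = (LINT z|lborel. \<psi> z)"
  \<comment> \<open>Otherwise \<psi>, which is positive on the ball of radius \<epsilon>, would
    vanish almost everywhere, and that ball would be a null set.\<close>
  have "I \<noteq> 0"
  proof
    assume "I = 0"
    then have "AE z in lborel. \<psi> z = 0"
      using integral_nonneg_eq_0_iff_AE[OF int] nn by (auto simp: I_def)
    then have "AE z in lborel. z \<notin> ball (0::'a) \<epsilon>"
      by eventually_elim (use pos in force)
    then have "AE z in lebesgue. z \<notin> ball (0::'a) \<epsilon>" by (rule AE_completion)
    then have "negligible (ball (0::'a) \<epsilon>)"
      by (simp add: AE_iff_null_sets negligible_iff_null_sets)
    then show False using open_not_negligible[of "ball (0::'a) \<epsilon>"] assms by auto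
  qed
  moreover have "I \<ge> 0" unfolding I_def using nn by (intro integral_nonneg_AE) auto
  ultimately have I: "I > 0" by simp
  have "mollifier \<epsilon> (\<lambda>z. (1 / I) * \<psi> z)"
    unfolding mollifier_def
  proof (intro conjI allI impI)
    show "continuously_differentiable k (\<lambda>z. (1 / I) * \<psi> z)" for k
      by (intro continuously_differentiable_mult continuously_differentiable_const s\<psi>)
    show "(LINT z|lborel. (1 / I) * \<psi> z) = 1" using I by (simp add: I_def[symmetric])
  qed (use I nn 0 in auto)
  then show ?thesis using that by blast
qed

section \<open>Convolution with smooth kernels\<close>

definition convolution :: "('a::euclidean_space \<Rightarrow> real) \<Rightarrow> ('a \<Rightarrow> real) \<Rightarrow> 'a \<Rightarrow> real" where
  "convolution w \<eta> x = (LINT y|lborel. w y * \<eta> (x - y))"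

lemma integral_dominated_convergence_at_0:
  fixes f :: "real \<Rightarrow> 'a \<Rightarrow> real"
  assumes "\<And>h. h \<noteq> 0 \<Longrightarrow> f h \<in> borel_measurable M" "g \<in> borel_measurable M" "integrable M w"
    and "\<And>x. x \<in> space M \<Longrightarrow> ((\<lambda>h. f h x) \<longlongrightarrow> g x) (at 0)"
    and "\<And>h x. x \<in> space M \<Longrightarrow> h \<noteq> 0 \<Longrightarrow> \<bar>h\<bar> \<le> 1 \<Longrightarrow> \<bar>f h x\<bar> \<le> w x"
  shows "((\<lambda>h. LINT x|M. f h x) \<longlongrightarrow> (LINT x|M. g x)) (at 0)"
  unfolding tendsto_at_iff_sequentially
proof (intro allI impI)
  fix X :: "nat \<Rightarrow> real" assume X: "\<forall>i. X i \<in> UNIV - {0}" "X \<longlonglongrightarrow> 0"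
  then have "\<forall>\<^sub>F n in sequentially. \<bar>X n\<bar> < 1"
    using order_tendstoD(2)[OF tendsto_rabs_zero[OF X(2)], of 1] by simp
  then obtain N where N: "\<And>n. n \<ge> N \<Longrightarrow> \<bar>X n\<bar> \<le> 1" unfolding eventually_sequentially by force
  \<comment> \<open>The domination is assumed for parameters of modulus at most 1, hence the shift
    past the first \<open>N\<close> terms.\<close>
  have "(\<lambda>n. LINT x|M. f (X (n + N)) x) \<longlonglongrightarrow> (LINT x|M. g x)"
  proof (rule integral_dominated_convergence[where w = w])
    show "AE x in M. (\<lambda>n. f (X (n + N)) x) \<longlonglongrightarrow> g x"
    proof (intro AE_I2)
      fix x assume "x \<in> space M"
      from assms(4)[OF this] have "((\<lambda>h. f h x) \<circ> X) \<longlonglongrightarrow> g x"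
        unfolding tendsto_at_iff_sequentially using X by blast
      then show "(\<lambda>n. f (X (n + N)) x) \<longlonglongrightarrow> g x"
        using LIMSEQ_ignore_initial_segment[of "(\<lambda>h. f h x) \<circ> X"] by (simp add: o_def)
    qed
    show "AE x in M. norm (f (X (n + N)) x) \<le> w x" for n
      using assms(5) X(1) N[of "n + N"] by (intro AE_I2) auto
  qed (use assms X in auto)
  then have "(\<lambda>n. LINT x|M. f (X n) x) \<longlonglongrightarrow> (LINT x|M. g x)"
    by (rule LIMSEQ_offset)
  then show "((\<lambda>h. LINT x|M. f h x) \<circ> X) \<longlonglongrightarrow> (LINT x|M. g x)" by (simp add: o_def)
qed

lemma integrable_mult_bounded:
  fixes w f :: "'a::euclidean_space \<Rightarrow> real"
  assumes "integrable M w" "f \<in> borel_measurable M" "\<And>x. \<bar>f x\<bar> \<le> B"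
  shows "integrable M (\<lambda>x. w x * f x)"
proof (rule Bochner_Integration.integrable_bound)
  show "integrable M (\<lambda>x. B * w x)" using assms(1) by simp
  show "AE x in M. norm (w x * f x) \<le> norm (B * w x)"
  proof (intro AE_I2)
    fix x
    have "\<bar>f x\<bar> * \<bar>w x\<bar> \<le> \<bar>B\<bar> * \<bar>w x\<bar>" using assms(3)[of x] by (intro mult_right_mono) auto
    then show "norm (w x * f x) \<le> norm (B * w x)" by (simp add: abs_mult mult.commute)
  qed
qed (use assms in \<open>auto intro: borel_measurable_integrable\<close>)

lemma reflect_measurable:
  fixes f :: "'a::euclidean_space \<Rightarrow> real"
  assumes "continuous_on UNIV f" shows "(\<lambda>y. f (x - y)) \<in> borel_measurable borel"
proof -
  have "continuous_on UNIV (\<lambda>y. f (x - y))"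
    by (rule continuous_on_compose2[OF assms]) (auto intro!: continuous_intros)
  then show ?thesis by (rule borel_measurable_continuous_onI)
qed

context
  fixes w \<eta> :: "'a::euclidean_space \<Rightarrow> real" and R :: real
  assumes w: "integrable lborel w"
    and ss: "smooth_supported R \<eta>"
begin

lemma convolution_integrable: "integrable lborel (\<lambda>y. w y * \<eta> (x - y))"
proof -
  obtain B where "\<And>x. \<bar>\<eta> x\<bar> \<le> B"
    using continuous_bounded_support_imp_bounded[OF smooth_continuous[OF ss] smooth_supportedD(2)[OF ss]] by blast
  then show ?thesis
    using reflect_measurable[OF smooth_continuous[OF ss]]
    by (intro integrable_mult_bounded[OF w]) auto
qed

lemma convolution_derivative_integrable: "integrable lborel (\<lambda>y. w y * frechet_derivative \<eta> (at (x - y)) v)"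
proof -
  have "continuous_on UNIV (\<lambda>x. frechet_derivative \<eta> (at x) v)"
    by (rule smooth_derivative_continuous[OF ss])
  moreover have "frechet_derivative \<eta> (at x) v = 0" if "R < norm x" for x
    by (rule smooth_derivative_support[OF ss that])
  ultimately obtain B where "\<And>x. \<bar>frechet_derivative \<eta> (at x) v\<bar> \<le> B"
    using continuous_bounded_support_imp_bounded by blast
  then show ?thesis
    using reflect_measurable[OF smooth_derivative_continuous[OF ss]]
    by (intro integrable_mult_bounded[OF w]) auto
qed

text \<open>The derivative moves under the integral onto the kernel. The kernel is Lipschitz with
  constant \<open>K\<close>, so all difference quotients are dominated by
  \<open>\<bar>w y\<bar> * (K * norm v)\<close>.\<close>

lemma convolution_directional_derivative:
  "((\<lambda>t. convolution w \<eta> (x + t *\<^sub>R v)) has_real_derivative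
     (LINT y|lborel. w y * frechet_derivative \<eta> (at (x - y)) v)) (at 0)"
proof -
  obtain K where K: "K \<ge> 0" "\<And>x y. \<bar>\<eta> x - \<eta> y\<bar> \<le> K * norm (x - y)"
    using smooth_lipschitz[OF ss] by blast
  have "((\<lambda>h. LINT y|lborel. w y * ((\<eta> (x + h *\<^sub>R v - y) - \<eta> (x - y)) / h)) \<longlongrightarrow>
      (LINT y|lborel. w y * frechet_derivative \<eta> (at (x - y)) v)) (at 0)"
  proof (rule integral_dominated_convergence_at_0[where w = "\<lambda>y. \<bar>w y\<bar> * (K * norm v)"])
    show "((\<lambda>h. w y * ((\<eta> (x + h *\<^sub>R v - y) - \<eta> (x - y)) / h)) \<longlongrightarrow> w y * frechet_derivative \<eta> (at (x - y)) v) (at 0)" for y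
      using smooth_directional_derivative[where x = "x - y" and v = v, OF ss]
      by (intro tendsto_mult tendsto_const) (simp add: DERIV_def algebra_simps)
    show "\<bar>w y * ((\<eta> (x + h *\<^sub>R v - y) - \<eta> (x - y)) / h)\<bar> \<le> \<bar>w y\<bar> * (K * norm v)" if "h \<noteq> 0" for h y
    proof -
      have "\<bar>\<eta> (x + h *\<^sub>R v - y) - \<eta> (x - y)\<bar> \<le> K * (\<bar>h\<bar> * norm v)"
        using K(2)[of "x + h *\<^sub>R v - y" "x - y"] by simp
      then show ?thesis using that unfolding abs_mult abs_divide
        by (intro mult_left_mono) (auto simp: field_simps)
    qed
    show "(\<lambda>y. w y * frechet_derivative \<eta> (at (x - y)) v) \<in> borel_measurable lborel"
      using convolution_derivative_integrable by (rule borel_measurable_integrable)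
    have "(\<lambda>y. \<eta> (x + h *\<^sub>R v - y)) \<in> borel_measurable borel" "(\<lambda>y. \<eta> (x - y)) \<in> borel_measurable borel" for h
      using reflect_measurable[OF smooth_continuous[OF ss]] by auto
    then show "(\<lambda>y. w y * ((\<eta> (x + h *\<^sub>R v - y) - \<eta> (x - y)) / h)) \<in> borel_measurable lborel" for h
      using borel_measurable_integrable[OF w] by auto
  qed (use w in simp)
  moreover have "(\<lambda>h. LINT y|lborel. w y * ((\<eta> (x + h *\<^sub>R v - y) - \<eta> (x - y)) / h)) =
     (\<lambda>h. (convolution w \<eta> (x + (0 + h) *\<^sub>R v) - convolution w \<eta> (x + 0 *\<^sub>R v)) / h)"
  proof
    fix h
    have "(LINT y|lborel. w y * ((\<eta> (x + h *\<^sub>R v - y) - \<eta> (x - y)) / h)) =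
      (LINT y|lborel. (w y * \<eta> (x + h *\<^sub>R v - y) - w y * \<eta> (x - y)) / h)"
      by (simp add: algebra_simps diff_divide_distrib)
    then show "(LINT y|lborel. w y * ((\<eta> (x + h *\<^sub>R v - y) - \<eta> (x - y)) / h)) =
     (convolution w \<eta> (x + (0 + h) *\<^sub>R v) - convolution w \<eta> (x + 0 *\<^sub>R v)) / h"
      using convolution_integrable[of "x + h *\<^sub>R v"] convolution_integrable[of x]
      by (simp add: convolution_def Bochner_Integration.integral_diff)
  qed
  ultimately show ?thesis unfolding DERIV_def by metis
qed

lemma convolution_derivative_along:
  "((\<lambda>t. convolution w \<eta> (x + t *\<^sub>R v)) has_real_derivative
     (LINT y|lborel. w y * frechet_derivative \<eta> (at (x + t *\<^sub>R v - y)) v)) (at t)"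
proof -
  have "((\<lambda>s. convolution w \<eta> (x + (s + t) *\<^sub>R v)) has_real_derivative
     (LINT y|lborel. w y * frechet_derivative \<eta> (at (x + t *\<^sub>R v - y)) v)) (at 0)"
    using convolution_directional_derivative[of "x + t *\<^sub>R v" v] by (simp add: algebra_simps)
  then show ?thesis using DERIV_shift[of "\<lambda>t. convolution w \<eta> (x + t *\<^sub>R v)" _ 0 t] by simp
qed

end

lemma mollifierD:
  assumes "mollifier \<epsilon> \<eta>"
  shows "\<And>k. continuously_differentiable k \<eta>" "\<And>z. 0 \<le> \<eta> z" "\<And>z. \<epsilon> \<le> norm z \<Longrightarrow> \<eta> z = 0"
    "\<And>z. \<epsilon> < norm z \<Longrightarrow> \<eta> z = 0" "(LINT z|lborel. \<eta> z) = 1" "continuous_on UNIV \<eta>"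
    "\<eta> \<in> borel_measurable borel" "integrable lborel \<eta>" "smooth_supported \<epsilon> \<eta>"
proof -
  show a: "\<And>k. continuously_differentiable k \<eta>" "\<And>z. 0 \<le> \<eta> z" "\<And>z. \<epsilon> \<le> norm z \<Longrightarrow> \<eta> z = 0"
    "\<And>z. \<epsilon> < norm z \<Longrightarrow> \<eta> z = 0" "(LINT z|lborel. \<eta> z) = 1"
    using assms by (auto simp: mollifier_def)
  show c: "continuous_on UNIV \<eta>" using continuously_differentiable_imp_continuous[OF a(1)] .
  then show "\<eta> \<in> borel_measurable borel" by (rule borel_measurable_continuous_onI)
  show "integrable lborel \<eta>" using integrable_lborel_bounded_support[OF c a(4)] .
  show "smooth_supported \<epsilon> \<eta>" using a by (simp add: smooth_supported_def)
qed

lemma convolution_reflect: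
  assumes "mollifier \<epsilon> \<eta>" "w \<in> borel_measurable borel"
  shows "convolution w \<eta> x = (LINT z|lborel. w (x - z) * \<eta> z)"
proof -
  have "(\<lambda>y. w y * \<eta> (x - y)) \<in> borel_measurable borel"
    using assms(2) reflect_measurable[OF mollifierD(6)[OF assms(1)]] by simp
  from lborel_integral_reflect[OF this, of x] show ?thesis by (simp add: convolution_def)
qed

lemma mollified_integrable:
  assumes m: "mollifier \<epsilon> \<eta>" and w: "continuous_on UNIV w"
  shows "integrable lborel (\<lambda>z. w (x - z) * \<eta> z)"
proof (rule integrable_lborel_bounded_support)
  show "continuous_on UNIV (\<lambda>z. w (x - z) * \<eta> z)"
    by (intro continuous_intros mollifierD(6)[OF m] continuous_on_compose2[OF w]) auto
  show "\<And>z. \<epsilon> < norm z \<Longrightarrow> w (x - z) * \<eta> z = 0" using mollifierD(4)[OF m] by simp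
qed

text \<open>The comparison function \<open>c\<close> is free because two choices are used: the
  constant \<open>w x\<close> measures how close the mollification is to \<open>w\<close>, and
  \<open>w (y - z)\<close> compares the mollification at two points and preserves Lipschitz
  constants.\<close>

lemma convolution_diff_le:
  assumes m: "mollifier \<epsilon> \<eta>" and w: "continuous_on UNIV w"
    and b: "\<And>z. norm z < \<epsilon> \<Longrightarrow> \<bar>w (x - z) - c z\<bar> \<le> \<rho>" and c: "continuous_on UNIV c"
  shows "\<bar>convolution w \<eta> x - (LINT z|lborel. c z * \<eta> z)\<bar> \<le> \<rho>"
proof -
  have wm: "w \<in> borel_measurable borel" using w by (rule borel_measurable_continuous_onI)
  have i1: "integrable lborel (\<lambda>z. w (x - z) * \<eta> z)" using mollified_integrable[OF m w] .
  have i2: "integrable lborel (\<lambda>z. c z * \<eta> z)"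
    using mollifierD(4)[OF m]
    by (intro integrable_lborel_bounded_support[of _ \<epsilon>] continuous_intros mollifierD(6)[OF m] c) auto
  have "convolution w \<eta> x - (LINT z|lborel. c z * \<eta> z) = (LINT z|lborel. (w (x - z) - c z) * \<eta> z)"
    unfolding convolution_reflect[OF m wm] using i1 i2 by (simp add: left_diff_distrib)
  also have "\<bar>\<dots>\<bar> \<le> (LINT z|lborel. \<rho> * \<eta> z)"
  proof (rule integral_abs_bound[THEN order_trans], rule integral_mono)
    show "integrable lborel (\<lambda>z. \<bar>(w (x - z) - c z) * \<eta> z\<bar>)"
      using i1 i2 by (intro integrable_abs) (simp add: left_diff_distrib)
    show "integrable lborel (\<lambda>z. \<rho> * \<eta> z)" using mollifierD(8)[OF m] by simp
    fix z
    show "\<bar>(w (x - z) - c z) * \<eta> z\<bar> \<le> \<rho> * \<eta> z"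
    proof (cases "norm z < \<epsilon>")
      case True
      then show ?thesis using b[OF True] mollifierD(2)[OF m, of z] by (simp add: abs_mult mult_right_mono)
    next
      case False
      then show ?thesis using mollifierD(3)[OF m, of z] by simp
    qed
  qed
  also have "\<dots> = \<rho>" using mollifierD(5)[OF m] by simp
  finally show ?thesis .
qed

lemma convolution_close:
  assumes m: "mollifier \<epsilon> \<eta>" and w: "continuous_on UNIV w"
    and b: "\<And>y. dist y x < \<epsilon> \<Longrightarrow> \<bar>w y - w x\<bar> \<le> \<rho>"
  shows "\<bar>convolution w \<eta> x - w x\<bar> \<le> \<rho>"
proof -
  have "\<bar>convolution w \<eta> x - (LINT z|lborel. w x * \<eta> z)\<bar> \<le> \<rho>"
  proof (rule convolution_diff_le[OF m w])
    fix z :: 'a assume "norm z < \<epsilon>"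
    then show "\<bar>w (x - z) - w x\<bar> \<le> \<rho>" using b[of "x - z"] by (simp add: dist_norm)
  qed simp
  then show ?thesis using mollifierD(5)[OF m] by simp
qed

lemma reflected_mollifier_test_function:
  assumes m: "mollifier \<epsilon> \<eta>" and sub: "cball x \<epsilon> \<subseteq> \<Omega>"
  shows "(\<lambda>y. \<eta> (x - y)) \<in> test_functions \<Omega>"
proof -
  have "{y. \<eta> (x - y) \<noteq> 0} \<subseteq> cball x \<epsilon>"
    using mollifierD(4)[OF m] by (force simp: dist_norm)
  then have *: "closure {y. \<eta> (x - y) \<noteq> 0} \<subseteq> cball x \<epsilon>" by (intro closure_minimal) auto
  then have "compact (closure {y. \<eta> (x - y) \<noteq> 0})"
    using compact_cball closed_closure compact_Int_closed by (metis inf.absorb_iff2)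
  then show ?thesis using * sub continuously_differentiable_reflect[OF mollifierD(1)[OF m]] by (auto simp: test_functions_def)
qed

section \<open>Lipschitz representatives\<close>

lemma borel_imp_lebesgue_on: "f \<in> borel_measurable borel \<Longrightarrow> f \<in> borel_measurable (lebesgue_on \<Omega>)"
  for f :: "'a::euclidean_space \<Rightarrow> 'b::euclidean_space"
  by (intro measurable_restrict_space1 measurable_completion) simp

lemma integral_lebesgue_on_eq_lborel:
  fixes F :: "'a::euclidean_space \<Rightarrow> real"
  assumes "\<Omega> \<in> sets lebesgue" "F \<in> borel_measurable borel" "\<And>x. x \<notin> \<Omega> \<Longrightarrow> F x = 0"
  shows "(LINT x|lebesgue_on \<Omega>. F x) = (LINT x|lborel. F x)"
proof -
  have "(\<lambda>x. indicator \<Omega> x * F x) = F" using assms(3) by (force simp: indicator_def)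
  then show ?thesis
    using assms by (simp add: lebesgue_on_integral_extend integral_completion)
qed

lemma has_weak_gradient_weak_gradient:
  "\<exists>g. has_weak_gradient \<Omega> u g \<Longrightarrow> has_weak_gradient \<Omega> u (weak_gradient \<Omega> u)"
  unfolding weak_gradient_def by (rule someI_ex[of "has_weak_gradient \<Omega> u"])

lemma AE_norm_le_Linf_norm:
  assumes "Linf_norm \<Omega> g = ereal L"
  shows "AE x in lebesgue_on \<Omega>. norm (g x) \<le> L"
  using esssup_AE[where M = "lebesgue_on \<Omega>" and f = "\<lambda>x. ereal (norm (g x))"] assms
  by (simp add: Linf_norm_def)

lemma AE_open_imp_ex:
  fixes \<Omega> :: "'a::euclidean_space set"
  assumes "open \<Omega>" "\<Omega> \<noteq> {}" "AE x in lebesgue_on \<Omega>. P x"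
  shows "\<exists>x\<in>\<Omega>. P x"
proof (rule ccontr)
  assume "\<not> ?thesis"
  moreover have "AE x in lebesgue. x \<in> \<Omega> \<longrightarrow> P x"
    using assms by (simp add: AE_restrict_space_iff)
  ultimately have "AE x in lebesgue. x \<notin> \<Omega>" by (auto elim: eventually_mono)
  then have "negligible \<Omega>"
    using assms(1) by (simp add: AE_iff_null_sets negligible_iff_null_sets)
  then show False using open_not_negligible assms by blast
qed

text \<open>A derivative-free description of the functions on which the functional is at most
  \<open>L\<close>. Vanishing off \<Omega> encodes the boundary condition, and the Lipschitz bound
  concerns the extension to the whole space although \<Omega> need not be convex.\<close>

definition lipschitz_zero_outside :: "'a::euclidean_space set \<Rightarrow> real \<Rightarrow> ('a \<Rightarrow> real) \<Rightarrow> bool" where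
  "lipschitz_zero_outside \<Omega> L v \<longleftrightarrow> L-lipschitz_on UNIV v \<and> (\<forall>x. x \<notin> \<Omega> \<longrightarrow> v x = 0)"

lemma lipschitz_zero_outsideD:
  assumes "lipschitz_zero_outside \<Omega> L v"
  shows "0 \<le> L" "\<bar>v x - v y\<bar> \<le> L * norm (x - y)" "x \<notin> \<Omega> \<Longrightarrow> v x = 0" "continuous_on UNIV v"
  using assms lipschitz_on_nonneg lipschitz_onD[of L UNIV v x y] lipschitz_on_continuous_on
  by (auto simp: lipschitz_zero_outside_def dist_norm)

lemma lipschitz_zero_outsideI:
  assumes "0 \<le> L" "\<And>x y. \<bar>v x - v y\<bar> \<le> L * norm (x - y)" "\<And>x. x \<notin> \<Omega> \<Longrightarrow> v x = 0"
  shows "lipschitz_zero_outside \<Omega> L v"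
  using assms by (auto simp: lipschitz_zero_outside_def dist_norm intro!: lipschitz_onI)

text \<open>A gradient bound controls \<open>v\<close> only along segments inside \<Omega>. If a
  segment leaves \<Omega>, it contains a point \<open>z\<close> where \<open>v\<close> vanishes;
  \<open>\<bar>v x\<bar>\<close> and \<open>\<bar>v y\<bar>\<close> are bounded separately through
  their distances to \<open>z\<close>, and these distances add up to the length of the
  segment.\<close>

lemma lipschitz_of_segments:
  fixes v :: "'a::euclidean_space \<Rightarrow> real"
  assumes \<Omega>: "open \<Omega>" and v: "continuous_on UNIV v" "\<And>x. x \<notin> \<Omega> \<Longrightarrow> v x = 0" and L: "0 \<le> L"
    and seg: "\<And>x y. closed_segment x y \<subseteq> \<Omega> \<Longrightarrow> \<bar>v x - v y\<bar> \<le> L * norm (x - y)"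
  shows "lipschitz_zero_outside \<Omega> L v"
proof -
  have exit: "\<bar>v x\<bar> \<le> L * norm (x - z)" if x: "x \<in> \<Omega>" and z: "z \<notin> \<Omega>" for x z
  proof -
    have "closed (closed_segment x z \<inter> - \<Omega>)" "closed_segment x z \<inter> - \<Omega> \<noteq> {}"
      using \<Omega> z by auto
    \<comment> \<open>The point where the segment first leaves \<Omega>: everything before it lies
      in \<Omega>.\<close>
    then obtain q where q: "q \<in> closed_segment x z \<inter> - \<Omega>"
      and min: "\<And>p. p \<in> closed_segment x z \<inter> - \<Omega> \<Longrightarrow> dist x q \<le> dist x p"
      using distance_attains_inf[of "closed_segment x z \<inter> - \<Omega>" x] by auto
    have "x \<noteq> q" using q x by auto
    have inside: "x + s *\<^sub>R (q - x) \<in> \<Omega>" if s: "0 \<le> s" "s < 1" for s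
    proof (rule ccontr)
      assume n: "x + s *\<^sub>R (q - x) \<notin> \<Omega>"
      have "x + s *\<^sub>R (q - x) \<in> closed_segment x q"
        using s by (auto simp: in_segment algebra_simps intro!: exI[of _ s])
      moreover have "closed_segment x q \<subseteq> closed_segment x z"
        using q by (intro closed_segment_subset) auto
      ultimately have "dist x q \<le> dist x (x + s *\<^sub>R (q - x))" using n by (intro min) auto
      also have "\<dots> = s * dist x q" using s by (simp add: dist_norm norm_minus_commute)
      finally show False using s \<open>x \<noteq> q\<close> by simp
    qed
    have le: "\<bar>v x - v (x + s *\<^sub>R (q - x))\<bar> \<le> L * norm (x - q)" if s: "0 \<le> s" "s < 1" for s
    proof -
      have "closed_segment x (x + s *\<^sub>R (q - x)) \<subseteq> \<Omega>"
      proof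
        fix p assume "p \<in> closed_segment x (x + s *\<^sub>R (q - x))"
        then obtain r where r: "0 \<le> r" "r \<le> 1" "p = (1 - r) *\<^sub>R x + r *\<^sub>R (x + s *\<^sub>R (q - x))"
          by (auto simp: in_segment)
        then have "p = x + (r * s) *\<^sub>R (q - x)" by (simp add: algebra_simps)
        moreover have "0 \<le> r * s" "r * s < 1"
          using r s mult_le_one[of r s] mult_left_le_one_le[of s r] by auto
        ultimately show "p \<in> \<Omega>" using inside by blast
      qed
      then have "\<bar>v x - v (x + s *\<^sub>R (q - x))\<bar> \<le> L * norm (x - (x + s *\<^sub>R (q - x)))" by (rule seg)
      also have "\<dots> = L * (s * norm (x - q))" using s by (simp add: norm_minus_commute)
      also have "\<dots> \<le> L * (1 * norm (x - q))" using s L by (intro mult_left_mono mult_right_mono) auto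
      finally show ?thesis by simp
    qed
    \<comment> \<open>The point \<open>q\<close> is itself outside \<Omega>, so \<open>seg\<close>
      applies only before it and the bound reaches \<open>q\<close> by continuity.\<close>
    have "((\<lambda>s. \<bar>v x - v (x + s *\<^sub>R (q - x))\<bar>) \<longlongrightarrow> \<bar>v x - v (x + 1 *\<^sub>R (q - x))\<bar>) (at_left 1)"
    proof (intro tendsto_rabs tendsto_diff tendsto_const)
      have "isCont v (x + 1 *\<^sub>R (q - x))" using v(1) by (simp add: continuous_on_eq_continuous_at)
      moreover have "((\<lambda>s. x + s *\<^sub>R (q - x)) \<longlongrightarrow> x + 1 *\<^sub>R (q - x)) (at_left 1)"
        by (intro tendsto_intros)
      ultimately show "((\<lambda>s. v (x + s *\<^sub>R (q - x))) \<longlongrightarrow> v (x + 1 *\<^sub>R (q - x))) (at_left 1)"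
        by (rule isCont_tendsto_compose)
    qed
    moreover have "\<forall>\<^sub>F s in at_left 1. \<bar>v x - v (x + s *\<^sub>R (q - x))\<bar> \<le> L * norm (x - q)"
      unfolding eventually_at_left_field by (rule exI[of _ 0]) (auto intro!: le)
    ultimately have "\<bar>v x - v (x + 1 *\<^sub>R (q - x))\<bar> \<le> L * norm (x - q)"
      by (intro tendsto_upperbound) auto
    moreover have "v q = 0" using q v(2) by auto
    moreover have "norm (x - q) \<le> norm (x - z)"
      using min[of z] z by (simp add: dist_norm)
    ultimately show ?thesis using mult_left_mono[OF _ L, of "norm (x - q)" "norm (x - z)"] by simp
  qed
  show ?thesis
  proof (rule lipschitz_zero_outsideI[OF L _ v(2)])
    fix x y
    show "\<bar>v x - v y\<bar> \<le> L * norm (x - y)"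
    proof (cases "closed_segment x y \<subseteq> \<Omega>")
      case True then show ?thesis by (rule seg)
    next
      case False
      then obtain z where z: "z \<in> closed_segment x y" "z \<notin> \<Omega>" by auto
      have "\<bar>v x\<bar> \<le> L * norm (x - z)" "\<bar>v y\<bar> \<le> L * norm (y - z)"
        using exit[OF _ z(2)] v(2) L by (metis abs_zero mult_nonneg_nonneg norm_ge_zero)+
      moreover have "norm (x - y) = norm (x - z) + norm (y - z)"
        using z(1) by (metis between between_mem_segment dist_commute dist_norm)
      ultimately show ?thesis by (simp add: distrib_left)
    qed
  qed
qed

text \<open>Mollify \<open>v\<close>: the derivative of the mollification in direction
  \<open>e\<close> is an average of \<open>g \<bullet> e\<close>, hence at most
  \<open>L * norm e\<close>. The mean value theorem bounds the difference of the mollification at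
  the endpoints, and shrinking the radius gives the bound for \<open>v\<close>.\<close>

lemma weak_gradient_segment_bound:
  fixes v u :: "'a::euclidean_space \<Rightarrow> real"
  assumes \<Omega>: "open \<Omega>" "bounded \<Omega>" and g: "has_weak_gradient \<Omega> u g"
    and gL: "AE x in lebesgue_on \<Omega>. norm (g x) \<le> L" and L: "0 \<le> L"
    and v: "continuous_on UNIV v" "\<And>x. x \<notin> \<Omega> \<Longrightarrow> v x = 0" and uv: "AE x in lebesgue_on \<Omega>. u x = v x"
    and seg: "closed_segment x y \<subseteq> \<Omega>"
  shows "\<bar>v x - v y\<bar> \<le> L * norm (x - y)"
proof -
  have \<Omega>m: "\<Omega> \<in> sets lebesgue" "\<Omega> \<in> lmeasurable" using \<Omega> by (auto intro: lmeasurable_open)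
  interpret finite_measure "lebesgue_on \<Omega>" using \<Omega>m by (intro finite_measure_lebesgue_on)
  obtain R where R: "\<And>x. x \<in> \<Omega> \<Longrightarrow> norm x \<le> R" using \<Omega>(2) by (auto simp: bounded_iff)
  have vint: "integrable lborel v"
    using R v by (intro integrable_lborel_bounded_support[of v R]) force+
  have vm: "v \<in> borel_measurable borel" using v(1) by (rule borel_measurable_continuous_onI)
  obtain \<epsilon>0 where e0: "\<epsilon>0 > 0" "\<And>z. z \<in> closed_segment x y \<Longrightarrow> cball z \<epsilon>0 \<subseteq> \<Omega>"
  proof -
    obtain d where d: "d > 0" "\<And>z p. z \<in> closed_segment x y \<Longrightarrow> p \<in> - \<Omega> \<Longrightarrow> d \<le> dist z p"
      using separate_compact_closed[of "closed_segment x y" "- \<Omega>"] seg \<Omega>(1)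
      by (auto simp: Int_commute disjoint_eq_subset_Compl closed_Compl)
    show ?thesis
    proof (rule that[of "d/2"])
      fix z assume "z \<in> closed_segment x y"
      then show "cball z (d/2) \<subseteq> \<Omega>" using d(2)[of z] d(1) by fastforce
    qed (use d in simp)
  qed
  \<comment> \<open>The reflected kernel centred at \<open>z\<close> is an admissible test function.
    The sign from differentiating a reflection cancels the sign in the definition of the weak
    gradient.\<close>
  have key: "\<bar>LINT p|lborel. v p * frechet_derivative \<eta> (at (z - p)) e\<bar> \<le> L * norm e"
    if m: "mollifier \<epsilon> \<eta>" and sub: "cball z \<epsilon> \<subseteq> \<Omega>" for \<epsilon> \<eta> z e
  proof -
    define \<phi> where "\<phi> = (\<lambda>p. \<eta> (z - p))"
    note sm = mollifierD(9)[OF m]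
    have \<phi>t: "\<phi> \<in> test_functions \<Omega>"
      unfolding \<phi>_def by (rule reflected_mollifier_test_function[OF m sub])
    have \<phi>b: "\<phi> \<in> borel_measurable borel"
      unfolding \<phi>_def by (rule reflect_measurable[OF mollifierD(6)[OF m]])
    have \<phi>m: "\<phi> \<in> borel_measurable (lebesgue_on \<Omega>)"
      using \<phi>b by (rule borel_imp_lebesgue_on)
    have \<phi>0: "\<phi> p = 0" if "p \<notin> \<Omega>" for p
    proof -
      have "\<epsilon> < norm (z - p)" using that sub by (force simp: dist_norm)
      then show ?thesis using mollifierD(4)[OF m] by (simp add: \<phi>_def)
    qed
    have \<phi>nn: "0 \<le> \<phi> p" for p using mollifierD(2)[OF m] by (simp add: \<phi>_def)
    obtain B where B: "\<And>p. \<bar>\<eta> p\<bar> \<le> B"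
      using continuous_bounded_support_imp_bounded[OF mollifierD(6)[OF m] mollifierD(4)[OF m]] by blast
    have \<phi>1: "(LINT p|lebesgue_on \<Omega>. \<phi> p) = 1"
      using integral_lebesgue_on_eq_lborel[OF \<Omega>m(1) \<phi>b \<phi>0] lborel_integral_reflect[OF mollifierD(7)[OF m], of z] mollifierD(5)[OF m]
      by (simp add: \<phi>_def)
    have \<phi>int: "integrable (lebesgue_on \<Omega>) \<phi>"
      using B by (intro integrable_const_bound[where B = B] \<phi>m AE_I2) (simp add: \<phi>_def)
    have gm: "g \<in> borel_measurable (lebesgue_on \<Omega>)" and um: "u \<in> borel_measurable (lebesgue_on \<Omega>)"
      using g by (auto simp: has_weak_gradient_def locally_integrable_def)
    have gle: "AE p in lebesgue_on \<Omega>. \<bar>(g p \<bullet> w) * \<phi> p\<bar> \<le> L * norm w * \<phi> p" for w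
      using gL
    proof eventually_elim
      case (elim p)
      have "\<bar>g p \<bullet> w\<bar> \<le> norm (g p) * norm w" by (rule Cauchy_Schwarz_ineq2)
      also have "\<dots> \<le> L * norm w" using elim by (intro mult_right_mono) auto
      finally show ?case using \<phi>nn[of p] by (simp add: abs_mult mult_right_mono)
    qed
    have gint: "integrable (lebesgue_on \<Omega>) (\<lambda>p. (g p \<bullet> w) * \<phi> p)" for w
    proof (rule Bochner_Integration.integrable_bound)
      show "integrable (lebesgue_on \<Omega>) (\<lambda>p. L * norm w * \<phi> p)" using \<phi>int by simp
      show "AE p in lebesgue_on \<Omega>. norm ((g p \<bullet> w) * \<phi> p) \<le> norm (L * norm w * \<phi> p)"
        using gle[of w] by eventually_elim (use L \<phi>nn in \<open>simp add: abs_mult\<close>)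
    qed (use gm \<phi>m in simp)
    have basis: "(LINT p|lborel. v p * frechet_derivative \<eta> (at (z - p)) b) = (LINT p|lebesgue_on \<Omega>. (g p \<bullet> b) * \<phi> p)"
      if b: "b \<in> Basis" for b
    proof -
      have Dm: "(\<lambda>p. frechet_derivative \<eta> (at (z - p)) b) \<in> borel_measurable borel"
        using smooth_derivative_continuous[OF sm] by (rule reflect_measurable)
      then have Dl: "(\<lambda>p. frechet_derivative \<eta> (at (z - p)) b) \<in> borel_measurable (lebesgue_on \<Omega>)"
        by (rule borel_imp_lebesgue_on)
      have "(LINT p|lborel. v p * frechet_derivative \<eta> (at (z - p)) b) = (LINT p|lebesgue_on \<Omega>. v p * frechet_derivative \<eta> (at (z - p)) b)"
        using vm Dm v(2) by (intro integral_lebesgue_on_eq_lborel[OF \<Omega>m(1), symmetric]) auto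
      also have "\<dots> = (LINT p|lebesgue_on \<Omega>. u p * frechet_derivative \<eta> (at (z - p)) b)"
      proof (rule integral_cong_AE)
        show "AE p in lebesgue_on \<Omega>. v p * frechet_derivative \<eta> (at (z - p)) b = u p * frechet_derivative \<eta> (at (z - p)) b"
          using uv by eventually_elim simp
        show "(\<lambda>p. v p * frechet_derivative \<eta> (at (z - p)) b) \<in> borel_measurable (lebesgue_on \<Omega>)"
          using borel_imp_lebesgue_on[OF vm] Dl by (rule borel_measurable_times)
        show "(\<lambda>p. u p * frechet_derivative \<eta> (at (z - p)) b) \<in> borel_measurable (lebesgue_on \<Omega>)"
          using um Dl by (rule borel_measurable_times)
      qed
      also have "\<dots> = - (LINT p|lebesgue_on \<Omega>. u p * frechet_derivative \<phi> (at p) b)"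
        unfolding \<phi>_def smooth_reflected_derivative[OF sm] by simp
      also have "\<dots> = (LINT p|lebesgue_on \<Omega>. (g p \<bullet> b) * \<phi> p)"
        using g \<phi>t b by (simp add: has_weak_gradient_def)
      finally show ?thesis .
    qed
    have "(LINT p|lborel. v p * frechet_derivative \<eta> (at (z - p)) e)
        = (LINT p|lborel. (\<Sum>b\<in>Basis. (e \<bullet> b) * (v p * frechet_derivative \<eta> (at (z - p)) b)))"
      by (subst smooth_derivative_sum[OF sm]) (simp_all add: sum_distrib_left mult.left_commute)
    also have "\<dots> = (\<Sum>b\<in>Basis. (e \<bullet> b) * (LINT p|lborel. v p * frechet_derivative \<eta> (at (z - p)) b))"
      using convolution_derivative_integrable[OF vint sm] by simp
    also have "\<dots> = (\<Sum>b\<in>Basis. (e \<bullet> b) * (LINT p|lebesgue_on \<Omega>. (g p \<bullet> b) * \<phi> p))"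
      using basis by simp
    also have "\<dots> = (LINT p|lebesgue_on \<Omega>. (\<Sum>b\<in>Basis. (e \<bullet> b) * ((g p \<bullet> b) * \<phi> p)))"
      using gint by simp
    also have "\<dots> = (LINT p|lebesgue_on \<Omega>. (g p \<bullet> e) * \<phi> p)"
      by (simp add: euclidean_inner[of "g _" e] sum_distrib_left sum_distrib_right mult_ac)
    finally have eq: "(LINT p|lborel. v p * frechet_derivative \<eta> (at (z - p)) e) = (LINT p|lebesgue_on \<Omega>. (g p \<bullet> e) * \<phi> p)" .
    have "\<bar>LINT p|lebesgue_on \<Omega>. (g p \<bullet> e) * \<phi> p\<bar> \<le> (LINT p|lebesgue_on \<Omega>. \<bar>(g p \<bullet> e) * \<phi> p\<bar>)"
      by (rule integral_abs_bound)
    also have "\<dots> \<le> (LINT p|lebesgue_on \<Omega>. L * norm e * \<phi> p)"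
      using gint[of e] \<phi>int gle[of e] by (intro integral_mono_AE) auto
    also have "\<dots> = L * norm e" using \<phi>1 by simp
    finally show ?thesis using eq by simp
  qed
  have approx: "\<bar>v x - v y\<bar> \<le> L * norm (x - y) + 2 * \<rho>" if "\<rho> > 0" for \<rho>
  proof -
    have "isCont v x" "isCont v y" using v(1) by (auto simp: continuous_on_eq_continuous_at)
    then obtain d1 d2 where d: "d1 > 0" "\<And>p. dist p x < d1 \<Longrightarrow> dist (v p) (v x) < \<rho>"
      "d2 > 0" "\<And>p. dist p y < d2 \<Longrightarrow> dist (v p) (v y) < \<rho>"
      using \<open>\<rho> > 0\<close> unfolding continuous_at_eps_delta by metis
    \<comment> \<open>The radius keeps the kernel inside \<Omega> along the whole segment and moves
      \<open>v\<close> by at most \<rho> at the two endpoints.\<close>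
    define \<epsilon> where "\<epsilon> = min \<epsilon>0 (min d1 d2)"
    have "\<epsilon> > 0" using d e0 by (simp add: \<epsilon>_def)
    then obtain \<eta> :: "'a \<Rightarrow> real" where m: "mollifier \<epsilon> \<eta>" using mollifier_exists by blast
    note sm = mollifierD(9)[OF m]
    define F where "F = (\<lambda>t. convolution v \<eta> (x + t *\<^sub>R (y - x)))"
    have "\<exists>t>0. t < 1 \<and> F 1 - F 0 = (1 - 0) * (LINT p|lborel. v p * frechet_derivative \<eta> (at (x + t *\<^sub>R (y - x) - p)) (y - x))"
      unfolding F_def using convolution_derivative_along[OF vint sm] by (intro MVT2) auto
    then obtain t where t: "0 < t" "t < 1" "F 1 - F 0 = (LINT p|lborel. v p * frechet_derivative \<eta> (at (x + t *\<^sub>R (y - x) - p)) (y - x))"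
      by auto
    have "x + t *\<^sub>R (y - x) \<in> closed_segment x y"
      using t by (auto simp: in_segment algebra_simps intro!: exI[of _ t])
    then have "cball (x + t *\<^sub>R (y - x)) \<epsilon>0 \<subseteq> \<Omega>" by (rule e0(2))
    then have "cball (x + t *\<^sub>R (y - x)) \<epsilon> \<subseteq> \<Omega>" by (auto simp: \<epsilon>_def)
    from key[OF m this] have "\<bar>F 1 - F 0\<bar> \<le> L * norm (y - x)" using t(3) by metis
    moreover have "F 0 = convolution v \<eta> x" "F 1 = convolution v \<eta> y" by (simp_all add: F_def)
    moreover have "\<bar>convolution v \<eta> x - v x\<bar> \<le> \<rho>"
      by (rule convolution_close[OF m v(1)]) (use d(2) in \<open>force simp: \<epsilon>_def dist_real_def\<close>)
    moreover have "\<bar>convolution v \<eta> y - v y\<bar> \<le> \<rho>"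
      by (rule convolution_close[OF m v(1)]) (use d(4) in \<open>force simp: \<epsilon>_def dist_real_def\<close>)
    ultimately show ?thesis by (simp add: norm_minus_commute)
  qed
  show ?thesis
  proof (rule field_le_epsilon)
    fix e :: real assume "e > 0"
    then show "\<bar>v x - v y\<bar> \<le> L * norm (x - y) + e" using approx[of "e/2"] by simp
  qed
qed

lemma W1inf0_lipschitz_representative:
  fixes u :: "'a::euclidean_space \<Rightarrow> real"
  assumes \<Omega>: "open \<Omega>" "bounded \<Omega>" "\<Omega> \<noteq> {}" and E: "grad_sup_functional \<Omega> u = ereal L"
  obtains v where "lipschitz_zero_outside \<Omega> L v" "AE x in lebesgue_on \<Omega>. u x = v x"
proof -
  have u: "u \<in> W1inf0 \<Omega>" and Lg: "Linf_norm \<Omega> (weak_gradient \<Omega> u) = ereal L"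
    using E by (auto simp: grad_sup_functional_def split: if_splits)
  then obtain v0 where v0: "continuous_on (closure \<Omega>) v0" "\<And>x. x \<in> frontier \<Omega> \<Longrightarrow> v0 x = 0"
    "AE x in lebesgue_on \<Omega>. u x = v0 x"
    by (auto simp: W1inf0_def)
  have g: "has_weak_gradient \<Omega> u (weak_gradient \<Omega> u)"
    using u by (intro has_weak_gradient_weak_gradient) (auto simp: W1inf0_def W1inf_def)
  have gL: "AE x in lebesgue_on \<Omega>. norm (weak_gradient \<Omega> u x) \<le> L"
    using Lg by (rule AE_norm_le_Linf_norm)
  \<comment> \<open>A nonempty open set is not null, so some point satisfies the almost-everywhere
    bound and shows that \<open>L\<close> is nonnegative.\<close>
  then have L: "0 \<le> L" using AE_open_imp_ex[OF \<Omega>(1,3)] norm_ge_zero order_trans by blast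
  \<comment> \<open>The zero boundary values make the extension by zero continuous: the closed sets
    \<open>closure \<Omega>\<close> and \<open>- \<Omega>\<close> overlap exactly in the
    frontier.\<close>
  define v where "v = (\<lambda>x. if x \<in> closure \<Omega> then v0 x else 0)"
  have "continuous_on (closure \<Omega> \<union> - \<Omega>) v"
    unfolding v_def
  proof (rule continuous_on_cases)
    show "\<forall>x. x \<in> closure \<Omega> \<and> x \<notin> closure \<Omega> \<or> x \<in> - \<Omega> \<and> x \<in> closure \<Omega> \<longrightarrow> v0 x = 0"
      using v0(2) \<Omega>(1) by (auto simp: frontier_def interior_open)
  qed (use v0 \<Omega> in auto)
  moreover have "closure \<Omega> \<union> - \<Omega> = UNIV" using closure_subset by blast
  ultimately have vc: "continuous_on UNIV v" by simp
  have v0': "v x = 0" if "x \<notin> \<Omega>" for x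
    using that v0(2) \<Omega>(1) by (auto simp: v_def frontier_def interior_open)
  have uv: "AE x in lebesgue_on \<Omega>. u x = v x"
    using v0(3) AE_space
  proof eventually_elim
    case (elim x)
    then show ?case using closure_subset by (auto simp: v_def)
  qed
  have "lipschitz_zero_outside \<Omega> L v"
    by (rule lipschitz_of_segments[OF \<Omega>(1) vc v0' L weak_gradient_segment_bound[OF \<Omega>(1,2) g gL L vc v0' uv]])
  then show ?thesis using that uv by blast
qed

section \<open>From Lipschitz functions back to the functional\<close>

lemma test_functionsD:
  assumes "\<phi> \<in> test_functions \<Omega>"
  obtains R where "smooth_supported R \<phi>" "\<And>x. x \<notin> \<Omega> \<Longrightarrow> \<phi> x = 0"
proof -
  have c: "compact (closure {x. \<phi> x \<noteq> 0})" "closure {x. \<phi> x \<noteq> 0} \<subseteq> \<Omega>" and s: "\<And>k. continuously_differentiable k \<phi>"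
    using assms by (auto simp: test_functions_def)
  then obtain R where "\<And>x. x \<in> closure {x. \<phi> x \<noteq> 0} \<Longrightarrow> norm x \<le> R"
    by (metis bounded_iff compact_imp_bounded)
  then have "\<phi> x = 0" if "R < norm x" for x
    using that closure_subset[of "{x. \<phi> x \<noteq> 0}"] by force
  moreover have "\<phi> x = 0" if "x \<notin> \<Omega>" for x
    using that c(2) closure_subset[of "{x. \<phi> x \<noteq> 0}"] by blast
  ultimately show ?thesis using that s unfolding smooth_supported_def by blast
qed

lemma test_function_measurable:
  assumes "\<phi> \<in> test_functions \<Omega>" shows "\<phi> \<in> borel_measurable borel"
proof -
  have "continuously_differentiable 0 \<phi>" using assms unfolding test_functions_def by blast
  then show ?thesis by (simp add: borel_measurable_continuous_onI)
qed

lemma locally_integrable_test_function: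
  fixes f :: "'a::euclidean_space \<Rightarrow> real"
  assumes f: "locally_integrable \<Omega> f" and \<phi>: "\<phi> \<in> test_functions \<Omega>" and \<Omega>: "\<Omega> \<in> sets lebesgue"
  shows "integrable (lebesgue_on \<Omega>) (\<lambda>x. f x * \<phi> x)"
proof -
  obtain R where R: "smooth_supported R \<phi>" "\<And>x. x \<notin> \<Omega> \<Longrightarrow> \<phi> x = 0"
    using test_functionsD[OF \<phi>] by blast
  obtain B where B: "\<And>x. \<bar>\<phi> x\<bar> \<le> B"
    using continuous_bounded_support_imp_bounded[OF smooth_continuous[OF R(1)] smooth_supportedD(2)[OF R(1)]] by blast
  define K where "K = closure {x. \<phi> x \<noteq> 0}"
  have K: "compact K" "K \<subseteq> \<Omega>" using \<phi> by (auto simp: test_functions_def K_def)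
  then have Km: "K \<in> sets lebesgue" by (simp add: compact_imp_closed borel_closed)
  have "integrable (lebesgue_on K) f" using f K by (auto simp: locally_integrable_def)
  then have "integrable lebesgue (\<lambda>x. indicator K x * f x)"
    using lebesgue_on_integrable_extend[OF Km] by simp
  then have "integrable lebesgue (\<lambda>x. indicator K x * f x * \<phi> x)"
    using test_function_measurable[OF \<phi>]
    by (intro integrable_mult_bounded[OF _ _ B]) (auto intro: measurable_completion)
  moreover have "(\<lambda>x. indicator K x * f x * \<phi> x) = (\<lambda>x. indicator \<Omega> x * (f x * \<phi> x))"
  proof
    fix x
    have "\<phi> x \<noteq> 0 \<Longrightarrow> x \<in> K" using closure_subset[of "{x. \<phi> x \<noteq> 0}"] by (auto simp: K_def)
    then show "indicator K x * f x * \<phi> x = indicator \<Omega> x * (f x * \<phi> x)"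
      using K(2) by (cases "\<phi> x = 0") (auto simp: indicator_def)
  qed
  ultimately show ?thesis using lebesgue_on_integrable_extend[OF \<Omega>] by simp
qed

lemma locally_integrable_inner:
  fixes g :: "'a::euclidean_space \<Rightarrow> 'b::euclidean_space"
  assumes "locally_integrable \<Omega> g" shows "locally_integrable \<Omega> (\<lambda>x. g x \<bullet> b)"
  using assms by (auto simp: locally_integrable_def)

lemma locally_integrable_diff:
  fixes f g :: "'a::euclidean_space \<Rightarrow> 'b::euclidean_space"
  assumes "locally_integrable \<Omega> f" "locally_integrable \<Omega> g"
  shows "locally_integrable \<Omega> (\<lambda>x. f x - g x)"
  using assms by (auto simp: locally_integrable_def)

lemma locally_integrable_bounded:
  fixes g :: "'a::euclidean_space \<Rightarrow> 'b::euclidean_space"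
  assumes "g \<in> borel_measurable borel" "\<And>x. norm (g x) \<le> B"
  shows "locally_integrable \<Omega> g"
  unfolding locally_integrable_def
proof (intro conjI allI impI)
  show "g \<in> borel_measurable (lebesgue_on \<Omega>)" using assms(1) by (rule borel_imp_lebesgue_on)
  fix K assume "compact K \<and> K \<subseteq> \<Omega>"
  then interpret finite_measure "lebesgue_on K"
    by (intro finite_measure_lebesgue_on lmeasurable_compact) simp
  show "integrable (lebesgue_on K) g"
    using assms by (intro integrable_const_bound[where B = B] borel_imp_lebesgue_on) auto
qed

text \<open>The functional evaluates a weak gradient selected by a choice operator; uniqueness makes
  its norm accessible through any gradient that has been computed.\<close>

lemma weak_gradient_unique:
  fixes u :: "'a::euclidean_space \<Rightarrow> real"
  assumes \<Omega>: "open \<Omega>" and g: "has_weak_gradient \<Omega> u g" and h: "has_weak_gradient \<Omega> u h"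
  shows "AE x in lebesgue_on \<Omega>. g x = h x"
proof -
  have \<Omega>m: "\<Omega> \<in> sets lebesgue" using \<Omega> by auto
  have li: "locally_integrable \<Omega> g" "locally_integrable \<Omega> h"
    using g h by (auto simp: has_weak_gradient_def)
  have "AE x in lebesgue_on \<Omega>. g x \<bullet> b - h x \<bullet> b = 0" if b: "b \<in> Basis" for b
  proof (rule fundamental_lemma_of_variations[OF \<Omega>])
    show "locally_integrable \<Omega> (\<lambda>x. g x \<bullet> b - h x \<bullet> b)"
      by (intro locally_integrable_diff locally_integrable_inner li)
    fix \<phi> assume \<phi>: "\<phi> \<in> test_functions \<Omega>"
    have "(LINT x|lebesgue_on \<Omega>. (g x \<bullet> b - h x \<bullet> b) * \<phi> x) =
        (LINT x|lebesgue_on \<Omega>. (g x \<bullet> b) * \<phi> x) - (LINT x|lebesgue_on \<Omega>. (h x \<bullet> b) * \<phi> x)"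
      using locally_integrable_test_function[OF locally_integrable_inner[OF li(1)] \<phi> \<Omega>m]
        locally_integrable_test_function[OF locally_integrable_inner[OF li(2)] \<phi> \<Omega>m]
      by (simp add: left_diff_distrib)
    also have "\<dots> = 0"
    proof -
      have "(LINT x|lebesgue_on \<Omega>. u x * frechet_derivative \<phi> (at x) b) = - (LINT x|lebesgue_on \<Omega>. (g x \<bullet> b) * \<phi> x)"
        "(LINT x|lebesgue_on \<Omega>. u x * frechet_derivative \<phi> (at x) b) = - (LINT x|lebesgue_on \<Omega>. (h x \<bullet> b) * \<phi> x)"
        using g h \<phi> b by (simp_all add: has_weak_gradient_def)
      then show ?thesis by linarith
    qed
    finally show "(LINT x|lebesgue_on \<Omega>. (g x \<bullet> b - h x \<bullet> b) * \<phi> x) = 0" .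
  qed
  then have "AE x in lebesgue_on \<Omega>. \<forall>b\<in>Basis. g x \<bullet> b - h x \<bullet> b = 0"
    by (intro AE_finite_allI) auto
  then show ?thesis by eventually_elim (simp add: euclidean_eq_iff[where 'a = 'a])
qed

text \<open>The derivative is a pointwise limit of continuous difference quotients.\<close>

lemma directional_derivative_measurable:
  fixes F :: "'a::euclidean_space \<Rightarrow> real"
  assumes F: "continuous_on UNIV F" and D: "\<And>x. ((\<lambda>t. F (x + t *\<^sub>R v)) has_real_derivative D x) (at 0)"
  shows "D \<in> borel_measurable borel"
proof (rule borel_measurable_LIMSEQ_real)
  fix x
  have "((\<lambda>h. (F (x + (0 + h) *\<^sub>R v) - F (x + 0 *\<^sub>R v)) / h) \<longlongrightarrow> D x) (at 0)"
    using D by (simp add: DERIV_def)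
  moreover have "filterlim (\<lambda>i. inverse (real (Suc i))) (at 0) sequentially"
    using LIMSEQ_inverse_real_of_nat by (auto simp: filterlim_at)
  ultimately show "(\<lambda>i. (F (x + (0 + inverse (real (Suc i))) *\<^sub>R v) - F (x + 0 *\<^sub>R v)) / inverse (real (Suc i))) \<longlonglongrightarrow> D x"
    by (rule filterlim_compose)
next
  fix i
  have "continuous_on UNIV (\<lambda>x. F (x + (0 + inverse (real (Suc i))) *\<^sub>R v))"
    by (rule continuous_on_compose2[OF F]) (auto intro!: continuous_intros)
  then have "continuous_on UNIV (\<lambda>x. (F (x + (0 + inverse (real (Suc i))) *\<^sub>R v) - F (x + 0 *\<^sub>R v)) / inverse (real (Suc i)))"
    using F by (auto intro!: continuous_intros)
  then show "(\<lambda>x. (F (x + (0 + inverse (real (Suc i))) *\<^sub>R v) - F (x + 0 *\<^sub>R v)) / inverse (real (Suc i))) \<in> borel_measurable borel"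
    by (rule borel_measurable_continuous_onI)
qed

text \<open>Translation invariance makes the integral of every difference quotient zero, and
  dominated convergence passes this to the derivative. Applied to a product, it is integration by
  parts.\<close>

lemma integral_directional_derivative_zero:
  fixes F :: "'a::euclidean_space \<Rightarrow> real"
  assumes F: "continuous_on UNIV F" and supp: "\<And>x. R < norm x \<Longrightarrow> F x = 0"
    and D: "\<And>x. ((\<lambda>t. F (x + t *\<^sub>R v)) has_real_derivative D x) (at 0)"
    and C: "\<And>x t. \<bar>F (x + t *\<^sub>R v) - F x\<bar> \<le> C * \<bar>t\<bar>"
  shows "(LINT x|lborel. D x) = 0"
proof -
  have Fm: "F \<in> borel_measurable borel" using F by (rule borel_measurable_continuous_onI)
  have Fi: "integrable lborel F" using integrable_lborel_bounded_support[OF F supp] .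
  have tc: "continuous_on UNIV (\<lambda>x. F (x + h *\<^sub>R v))" for h
    by (rule continuous_on_compose2[OF F]) (auto intro!: continuous_intros)
  have ti: "integrable lborel (\<lambda>x. F (x + h *\<^sub>R v))" for h
  proof (rule integrable_lborel_bounded_support[OF tc])
    fix x :: 'a assume "R + norm (h *\<^sub>R v) < norm x"
    then have "R < norm (x + h *\<^sub>R v)" using norm_triangle_ineq4[of "x + h *\<^sub>R v" "h *\<^sub>R v"] by simp
    then show "F (x + h *\<^sub>R v) = 0" by (rule supp)
  qed
  have "((\<lambda>h. LINT x|lborel. (F (x + h *\<^sub>R v) - F x) / h) \<longlongrightarrow> (LINT x|lborel. D x)) (at 0)"
  proof (rule integral_dominated_convergence_at_0[where w = "\<lambda>x. C * indicator (cball 0 (R + norm v)) x"])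
    show "((\<lambda>h. (F (x + h *\<^sub>R v) - F x) / h) \<longlongrightarrow> D x) (at 0)" for x
      using D[of x] by (simp add: DERIV_def)
    show "\<bar>(F (x + h *\<^sub>R v) - F x) / h\<bar> \<le> C * indicator (cball 0 (R + norm v)) x" if "h \<noteq> 0" "\<bar>h\<bar> \<le> 1" for h x
    proof (cases "x \<in> cball 0 (R + norm v)")
      case True
      then show ?thesis using C[of x h] that by (simp add: abs_divide divide_le_eq)
    next
      case False
      then have x: "R + norm v < norm x" by simp
      have "norm (h *\<^sub>R v) \<le> norm v" using that mult_left_le_one_le[of "norm v" "\<bar>h\<bar>"] by simp
      then have "R < norm (x + h *\<^sub>R v)" using x norm_triangle_ineq4[of "x + h *\<^sub>R v" "h *\<^sub>R v"] by simp
      moreover have "R < norm x" using x norm_ge_zero[of v] by linarith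
      ultimately show ?thesis using False supp by simp
    qed
    show "D \<in> borel_measurable lborel" using directional_derivative_measurable[OF F D] by simp
    show "(\<lambda>x. (F (x + h *\<^sub>R v) - F x) / h) \<in> borel_measurable lborel" for h
      using Fm borel_measurable_continuous_onI[OF tc[of h]] by auto
    have "emeasure lborel (cball (0::'a) (R + norm v)) < \<infinity>"
      by (rule emeasure_bounded_finite) simp
    then show "integrable lborel (\<lambda>x. C * indicator (cball (0::'a) (R + norm v)) x)"
      by (intro integrable_mult_right integrable_real_indicator) auto
  qed
  moreover have "(\<lambda>h. LINT x|lborel. (F (x + h *\<^sub>R v) - F x) / h) = (\<lambda>h. 0)"
    using ti Fi lborel_integral_translate[OF Fm] by (simp add: fun_eq_iff)
  ultimately have "((\<lambda>h::real. 0) \<longlongrightarrow> (LINT x|lborel. D x)) (at (0::real))" by simp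
  then show ?thesis by (simp add: tendsto_const_iff)
qed

text \<open>The vector field \<open>G\<close> assembled from the directional derivatives is the weak
  gradient: for a test function \<phi>, the derivative of \<open>W x * \<phi> x\<close> integrates
  to zero. Linearity of \<open>D x\<close> identifies \<open>G x \<bullet> v\<close> with
  \<open>D x v\<close>.\<close>

lemma directionally_smooth_functional_le:
  fixes W :: "'a::euclidean_space \<Rightarrow> real"
  assumes \<Omega>: "open \<Omega>" "bounded \<Omega>" and W: "lipschitz_zero_outside \<Omega> L W"
    and D: "\<And>x v. ((\<lambda>t. W (x + t *\<^sub>R v)) has_real_derivative D x v) (at 0)"
    and lin: "\<And>x. linear (D x)"
  shows "grad_sup_functional \<Omega> W \<le> ereal L"
proof -
  have \<Omega>m: "\<Omega> \<in> sets lebesgue" using \<Omega> by auto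
  note WD = lipschitz_zero_outsideD[OF W]
  have Wm: "W \<in> borel_measurable borel" using WD(4) by (rule borel_measurable_continuous_onI)
  obtain R where R: "\<And>x. x \<in> \<Omega> \<Longrightarrow> norm x \<le> R" using \<Omega>(2) by (auto simp: bounded_iff)
  have "W x = 0" if "R < norm x" for x using that R[of x] WD(3)[of x] by force
  then obtain B where B: "B \<ge> 0" "\<And>x. \<bar>W x\<bar> \<le> B"
    using continuous_bounded_support_imp_bounded[OF WD(4)] by blast
  have Dle: "\<bar>D x v\<bar> \<le> L * norm v" for x v
  proof -
    have "norm (D x v) \<le> L * norm v"
    proof (rule norm_vector_derivative_le[where t = 0 and \<epsilon> = 1])
      show "((\<lambda>t. W (x + t *\<^sub>R v)) has_vector_derivative D x v) (at 0)"
        using D by (simp add: has_real_derivative_iff_has_vector_derivative)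
      show "norm (W (x + s *\<^sub>R v) - W (x + 0 *\<^sub>R v)) \<le> L * norm v * \<bar>s - 0\<bar>" for s
        using WD(2)[of "x + s *\<^sub>R v" x] by (simp add: mult_ac)
    qed simp
    then show ?thesis by simp
  qed
  define G where "G = (\<lambda>x. \<Sum>b\<in>Basis. D x b *\<^sub>R b)"
  have Gb: "G x \<bullet> b = D x b" if "b \<in> Basis" for x b
    using that by (simp add: G_def)
  have GD: "G x \<bullet> v = D x v" for x v
  proof -
    have "G x \<bullet> v = (\<Sum>b\<in>Basis. (v \<bullet> b) * D x b)"
      by (simp add: G_def inner_sum_left mult.commute inner_commute[of v])
    then show ?thesis using linear_basis_sum[OF lin, of x v] by simp
  qed
  \<comment> \<open>The bound on directional derivatives is used in the direction \<open>G x\<close>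
    itself, which gives the Euclidean norm without a dimensional constant.\<close>
  have GL: "norm (G x) \<le> L" for x
  proof (cases "G x = 0")
    case False
    have "norm (G x) * norm (G x) = D x (G x)" using GD[of x "G x"] by (simp add: power2_norm_eq_inner flip: power2_eq_square)
    also have "\<dots> \<le> L * norm (G x)" using Dle[of x "G x"] by simp
    finally show ?thesis using False by simp
  qed (use WD(1) in simp)
  have Dm: "(\<lambda>x. D x b) \<in> borel_measurable borel" for b
    by (rule directional_derivative_measurable[OF WD(4) D])
  have Gm: "G \<in> borel_measurable borel"
    unfolding G_def using Dm by (intro borel_measurable_sum borel_measurable_scaleR) auto
  have wg: "has_weak_gradient \<Omega> W G"
    unfolding has_weak_gradient_def
  proof (intro conjI ballI)
    show "locally_integrable \<Omega> W" using Wm B by (intro locally_integrable_bounded) auto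
    show "locally_integrable \<Omega> G" by (rule locally_integrable_bounded[OF Gm GL])
    fix \<phi> and b :: 'a assume \<phi>: "\<phi> \<in> test_functions \<Omega>" and b: "b \<in> Basis"
    obtain R' where \<phi>R: "smooth_supported R' \<phi>" "\<And>x. x \<notin> \<Omega> \<Longrightarrow> \<phi> x = 0"
      using test_functionsD[OF \<phi>] by blast
    note sc = smooth_continuous[OF \<phi>R(1)] and sd = smooth_derivative_continuous[OF \<phi>R(1)]
    obtain M where M: "M \<ge> 0" "\<And>x. \<bar>\<phi> x\<bar> \<le> M"
      using continuous_bounded_support_imp_bounded[OF sc smooth_supportedD(2)[OF \<phi>R(1)]] by blast
    obtain K where K: "K \<ge> 0" "\<And>x y. \<bar>\<phi> x - \<phi> y\<bar> \<le> K * norm (x - y)"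
      using smooth_lipschitz[OF \<phi>R(1)] by blast
    define \<phi>' where "\<phi>' = (\<lambda>x. frechet_derivative \<phi> (at x) b)"
    have \<phi>'c: "continuous_on UNIV \<phi>'" unfolding \<phi>'_def by (rule sd)
    have \<phi>m: "\<phi> \<in> borel_measurable borel" "\<phi>' \<in> borel_measurable borel"
      using sc \<phi>'c by (auto intro: borel_measurable_continuous_onI)
    have "(LINT x|lborel. D x b * \<phi> x + \<phi>' x * W x) = 0"
    \<comment> \<open>Lipschitz constant of a product: \<open>B\<close> and \<open>M\<close> bound
      the factors, \<open>L\<close> and \<open>K\<close> are their Lipschitz constants.\<close>
    proof (rule integral_directional_derivative_zero[where F = "\<lambda>x. W x * \<phi> x" and R = R' and v = b and C = "B * K + L * M"])
      show "continuous_on UNIV (\<lambda>x. W x * \<phi> x)" using WD(4) sc by (intro continuous_intros)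
      show "W x * \<phi> x = 0" if "R' < norm x" for x using smooth_supportedD(2)[OF \<phi>R(1) that] by simp
      have "((\<lambda>t. \<phi> (x + t *\<^sub>R b)) has_real_derivative \<phi>' x) (at 0)" for x
        unfolding \<phi>'_def by (rule smooth_directional_derivative[OF \<phi>R(1)])
      from DERIV_mult[OF D this] show "((\<lambda>t. W (x + t *\<^sub>R b) * \<phi> (x + t *\<^sub>R b)) has_real_derivative D x b * \<phi> x + \<phi>' x * W x) (at 0)" for x
        by simp
      fix x t
      have b1: "norm b = 1" using b by simp
      have "\<bar>W (x + t *\<^sub>R b) * \<phi> (x + t *\<^sub>R b) - W x * \<phi> x\<bar>
          = \<bar>W (x + t *\<^sub>R b) * (\<phi> (x + t *\<^sub>R b) - \<phi> x) + (W (x + t *\<^sub>R b) - W x) * \<phi> x\<bar>"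
        by (simp add: algebra_simps)
      also have "\<dots> \<le> \<bar>W (x + t *\<^sub>R b)\<bar> * \<bar>\<phi> (x + t *\<^sub>R b) - \<phi> x\<bar> + \<bar>W (x + t *\<^sub>R b) - W x\<bar> * \<bar>\<phi> x\<bar>"
        unfolding abs_mult[symmetric] by (rule abs_triangle_ineq)
      also have "\<dots> \<le> B * (K * \<bar>t\<bar>) + (L * \<bar>t\<bar>) * M"
        using K(2)[of "x + t *\<^sub>R b" x] WD(2)[of "x + t *\<^sub>R b" x] B M WD(1) b1
        by (intro add_mono mult_mono) auto
      finally show "\<bar>W (x + t *\<^sub>R b) * \<phi> (x + t *\<^sub>R b) - W x * \<phi> x\<bar> \<le> (B * K + L * M) * \<bar>t\<bar>"
        by (simp add: algebra_simps)
    qed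
    moreover have "integrable lborel (\<lambda>x. D x b * \<phi> x)"
    proof -
      have "integrable lborel (\<lambda>x. \<phi> x * D x b)"
        using Dle[of _ b] Dm by (intro integrable_mult_bounded[where B = "L * norm b"] integrable_lborel_bounded_support[OF sc smooth_supportedD(2)[OF \<phi>R(1)]]) auto
      then show ?thesis by (simp add: mult.commute)
    qed
    moreover have "integrable lborel (\<lambda>x. \<phi>' x * W x)"
      using smooth_derivative_support[OF \<phi>R(1)] Wm B(2)
      by (intro integrable_mult_bounded[where B = B] integrable_lborel_bounded_support[OF \<phi>'c, of R']) (auto simp: \<phi>'_def)
    ultimately have "(LINT x|lborel. \<phi>' x * W x) = - (LINT x|lborel. D x b * \<phi> x)" by simp
    moreover have "(LINT x|lebesgue_on \<Omega>. W x * \<phi>' x) = (LINT x|lborel. W x * \<phi>' x)"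
      using Wm \<phi>m WD(3) by (intro integral_lebesgue_on_eq_lborel[OF \<Omega>m]) auto
    moreover have "(LINT x|lebesgue_on \<Omega>. D x b * \<phi> x) = (LINT x|lborel. D x b * \<phi> x)"
      using Dm \<phi>m \<phi>R(2) by (intro integral_lebesgue_on_eq_lborel[OF \<Omega>m]) auto
    ultimately show "(LINT x|lebesgue_on \<Omega>. W x * frechet_derivative \<phi> (at x) b) = - (LINT x|lebesgue_on \<Omega>. (G x \<bullet> b) * \<phi> x)"
      by (simp add: Gb[OF b] \<phi>'_def mult.commute)
  qed
  have bdd: "f \<in> Linf \<Omega>" if "f \<in> borel_measurable borel" "\<And>x. norm (f x) \<le> C" for f :: "'a \<Rightarrow> 'b::euclidean_space" and C
  proof -
    have "Linf_norm \<Omega> f \<le> ereal C"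
      unfolding Linf_norm_def using borel_imp_lebesgue_on[OF that(1)] that(2) by (intro esssup_I) auto
    then show ?thesis using borel_imp_lebesgue_on[OF that(1)] by (auto simp: Linf_def)
  qed
  have "W \<in> W1inf0 \<Omega>"
    unfolding W1inf0_def W1inf_def
  proof (intro CollectI conjI bexI exI)
    show "W \<in> Linf \<Omega>" using Wm B by (intro bdd) auto
    show "G \<in> Linf \<Omega>" by (rule bdd[OF Gm GL])
    show "continuous_on (closure \<Omega>) W" using WD(4) continuous_on_subset by blast
    show "\<forall>x\<in>frontier \<Omega>. W x = 0" using WD(3) \<Omega>(1) by (auto simp: frontier_def interior_open)
  qed (use wg in auto)
  moreover have "Linf_norm \<Omega> (weak_gradient \<Omega> W) \<le> ereal L"
    unfolding Linf_norm_def
  proof (rule esssup_I)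
    have g': "has_weak_gradient \<Omega> W (weak_gradient \<Omega> W)"
      using wg by (intro has_weak_gradient_weak_gradient) auto
    then show "(\<lambda>x. ereal (norm (weak_gradient \<Omega> W x))) \<in> borel_measurable (lebesgue_on \<Omega>)"
      by (auto simp: has_weak_gradient_def locally_integrable_def)
    show "AE x in lebesgue_on \<Omega>. ereal (norm (weak_gradient \<Omega> W x)) \<le> ereal L"
      using weak_gradient_unique[OF \<Omega>(1) g' wg] by eventually_elim (simp add: GL)
  qed
  ultimately show ?thesis by (simp add: grad_sup_functional_def)
qed

text \<open>Soft thresholding moves the support into the interior of \<open>\<Omega>\<close> without increasing the
  Lipschitz constant, so that mollification keeps the function zero outside \<open>\<Omega>\<close>.\<close>

lemma lipschitz_approximation:
  fixes v :: "'a::euclidean_space \<Rightarrow> real"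
  assumes \<Omega>: "open \<Omega>" "bounded \<Omega>" and v: "lipschitz_zero_outside \<Omega> L v" and \<delta>: "\<delta> > 0"
  obtains W where "continuous_on UNIV W" "grad_sup_functional \<Omega> W \<le> ereal L" "\<And>x. \<bar>W x - v x\<bar> \<le> 2 * \<delta>"
proof -
  note vD = lipschitz_zero_outsideD[OF v]
  define w where "w = (\<lambda>x. v x - max (- \<delta>) (min \<delta> (v x)))"
  have wc: "continuous_on UNIV w" unfolding w_def using vD(4) by (intro continuous_intros)
  have wL: "\<bar>w x - w y\<bar> \<le> L * norm (x - y)" for x y
    using vD(2)[of x y] \<delta> unfolding w_def by (auto simp: max_def min_def abs_if split: if_splits)
  have wv: "\<bar>w x - v x\<bar> \<le> \<delta>" for x using \<delta> by (auto simp: w_def)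
  have w0: "w x = 0" if "\<bar>v x\<bar> \<le> \<delta>" for x using that by (auto simp: w_def)
  \<comment> \<open>Within this distance of a point outside \<Omega> the function \<open>v\<close>
    stays below \<delta> in modulus, so \<open>w\<close> vanishes there. The summand 1 covers the
    case \<open>L = 0\<close>.\<close>
  define \<epsilon> where "\<epsilon> = \<delta> / (L + 1)"
  have e: "\<epsilon> > 0" "L * \<epsilon> < \<delta>" using \<delta> vD(1) by (auto simp: \<epsilon>_def field_simps)
  obtain \<eta> :: "'a \<Rightarrow> real" where m: "mollifier \<epsilon> \<eta>" using mollifier_exists e by blast
  note sm = mollifierD(9)[OF m]
  define W where "W = convolution w \<eta>"
  obtain R where R: "\<And>x. x \<in> \<Omega> \<Longrightarrow> norm x \<le> R" using \<Omega>(2) by (auto simp: bounded_iff)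
  have wi: "integrable lborel w"
  proof (rule integrable_lborel_bounded_support[OF wc])
    fix x :: 'a assume "R < norm x"
    then have "v x = 0" using R vD(3) by force
    then show "w x = 0" using w0 \<delta> by simp
  qed
  have wm: "w \<in> borel_measurable borel" using wc by (rule borel_measurable_continuous_onI)
  have near: "\<bar>v y - v x\<bar> < \<delta>" if "norm (y - x) < \<epsilon>" for x y
  proof -
    have "\<bar>v y - v x\<bar> \<le> L * norm (y - x)" by (rule vD)
    also have "\<dots> \<le> L * \<epsilon>" using that vD(1) by (intro mult_left_mono) auto
    finally show ?thesis using e by simp
  qed
  have W0: "W x = 0" if "x \<notin> \<Omega>" for x
  proof -
    have "\<bar>convolution w \<eta> x - w x\<bar> \<le> 0"
    proof (rule convolution_close[OF m wc])
      fix y assume "dist y x < \<epsilon>"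
      then have "\<bar>v y - v x\<bar> < \<delta>" using near by (simp add: dist_norm)
      then have "w y = 0" using vD(3)[OF that] by (intro w0) simp
      moreover have "w x = 0" using vD(3)[OF that] \<delta> by (intro w0) simp
      ultimately show "\<bar>w y - w x\<bar> \<le> 0" by simp
    qed
    then show ?thesis using vD(3)[OF that] w0[of x] \<delta> by (simp add: W_def)
  qed
  have WL: "\<bar>W x - W y\<bar> \<le> L * norm (x - y)" for x y
  proof -
    have "continuous_on UNIV (\<lambda>z. w (y - z))"
      by (rule continuous_on_compose2[OF wc]) (auto intro!: continuous_intros)
    then have "\<bar>convolution w \<eta> x - (LINT z|lborel. w (y - z) * \<eta> z)\<bar> \<le> L * norm (x - y)"
      using wL[of "x - z" "y - z" for z] by (intro convolution_diff_le[OF m wc]) auto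
    then show ?thesis unfolding W_def convolution_reflect[OF m wm, of y] .
  qed
  have WW: "lipschitz_zero_outside \<Omega> L W" by (rule lipschitz_zero_outsideI[OF vD(1) WL W0])
  have lin: "linear (\<lambda>v. LINT y|lborel. w y * frechet_derivative \<eta> (at (x - y)) v)" for x
  proof (rule linearI)
    fix a b :: 'a and r :: real
    note l = has_derivative_linear[OF smooth_has_derivative[OF sm]]
    note i = convolution_derivative_integrable[OF wi sm]
    show "(LINT y|lborel. w y * frechet_derivative \<eta> (at (x - y)) (a + b)) =
      (LINT y|lborel. w y * frechet_derivative \<eta> (at (x - y)) a) + (LINT y|lborel. w y * frechet_derivative \<eta> (at (x - y)) b)"
      unfolding linear_add[OF l] distrib_left by (rule Bochner_Integration.integral_add[OF i i])
    show "(LINT y|lborel. w y * frechet_derivative \<eta> (at (x - y)) (r *\<^sub>R a)) =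
      r *\<^sub>R (LINT y|lborel. w y * frechet_derivative \<eta> (at (x - y)) a)"
      unfolding linear_cmul[OF l] by (simp add: mult.left_commute)
  qed
  have "grad_sup_functional \<Omega> W \<le> ereal L"
    unfolding W_def
    by (rule directionally_smooth_functional_le[OF \<Omega> WW[unfolded W_def] convolution_directional_derivative[OF wi sm] lin])
  moreover have "\<bar>W x - v x\<bar> \<le> 2 * \<delta>" for x
  proof -
    have "\<bar>convolution w \<eta> x - w x\<bar> \<le> \<delta>"
    proof (rule convolution_close[OF m wc])
      fix y assume "dist y x < \<epsilon>"
      then have "L * norm (y - x) \<le> L * \<epsilon>" using vD(1) by (intro mult_left_mono) (auto simp: dist_norm)
      then show "\<bar>w y - w x\<bar> \<le> \<delta>" using wL[of y x] e by linarith
    qed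
    then show ?thesis using wv[of x] by (simp add: W_def)
  qed
  ultimately show ?thesis using that[of W] lipschitz_zero_outsideD(4)[OF WW] by blast
qed

section \<open>The flow in the space of square integrable functions\<close>

lemma infdist_Compl_eq_infdist_frontier:
  fixes x :: "'a::euclidean_space"
  assumes "open \<Omega>" "bounded \<Omega>" "x \<in> \<Omega>"
  shows "infdist x (- \<Omega>) = infdist x (frontier \<Omega>)"
proof (rule antisym)
  have f: "frontier \<Omega> \<noteq> {}"
    using assms frontier_eq_empty[of \<Omega>] not_bounded_UNIV by auto
  have sub: "frontier \<Omega> \<subseteq> - \<Omega>" using assms(1) by (auto simp: frontier_def interior_open)
  then show "infdist x (- \<Omega>) \<le> infdist x (frontier \<Omega>)" using f by (rule infdist_mono)
  have "infdist x (frontier \<Omega>) \<le> dist x y" if "y \<in> - \<Omega>" for y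
  proof -
    have "closed_segment x y \<inter> frontier \<Omega> \<noteq> {}"
      using that assms(3) by (intro connected_Int_frontier) auto
    then obtain z where z: "z \<in> closed_segment x y" "z \<in> frontier \<Omega>" by blast
    have "infdist x (frontier \<Omega>) \<le> dist x z" using z(2) by (rule infdist_le)
    also have "\<dots> \<le> dist x y" using z(1) dist_in_closed_segment by (metis dist_commute)
    finally show ?thesis .
  qed
  moreover have "- \<Omega> \<noteq> {}" using f sub by blast
  ultimately show "infdist x (frontier \<Omega>) \<le> infdist x (- \<Omega>)"
    unfolding infdist_notempty[OF \<open>- \<Omega> \<noteq> {}\<close>] by (intro cINF_greatest) auto
qed

locale bounded_domain =
  fixes \<Omega> :: "'a::euclidean_space set"
  assumes \<Omega>: "open \<Omega>" "bounded \<Omega>" "\<Omega> \<noteq> {}"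
begin

lemma sets\<Omega>: "\<Omega> \<in> sets lebesgue" and lmeasurable\<Omega>: "\<Omega> \<in> lmeasurable"
  using \<Omega> by (auto intro: lmeasurable_open)

text \<open>Distance to the complement in place of the frontier: it agrees with the distance to the
  frontier on \<Omega> and in addition vanishes off \<Omega>, so it is itself an admissible
  Lipschitz function with constant 1.\<close>

definition bdist :: "'a \<Rightarrow> real" where "bdist x = infdist x (- \<Omega>)"

lemma Compl_nonempty: "- \<Omega> \<noteq> {}"
proof
  assume "- \<Omega> = {}"
  then have "\<Omega> = UNIV" by auto
  then show False using \<Omega>(2) not_bounded_UNIV by simp
qed

lemma bdist_nonneg: "0 \<le> bdist x" by (simp add: bdist_def infdist_nonneg)

lemma bdist_pos: "x \<in> \<Omega> \<Longrightarrow> 0 < bdist x"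
  using in_closed_iff_infdist_zero[of "- \<Omega>" x] \<Omega> Compl_nonempty bdist_nonneg[of x]
  by (force simp: bdist_def)

abbreviation "lzo \<equiv> lipschitz_zero_outside \<Omega>"

lemma lzo_bdist: "lzo 1 bdist"
proof (rule lipschitz_zero_outsideI)
  show "\<bar>bdist x - bdist y\<bar> \<le> 1 * norm (x - y)" for x y
    using infdist_triangle_abs[of x "- \<Omega>" y] by (simp add: bdist_def dist_norm)
qed (auto simp: bdist_def)

lemma lzo_le_bdist:
  assumes "lzo L v" shows "\<bar>v x\<bar> \<le> L * bdist x"
proof (cases "L = 0")
  case True
  obtain y where "y \<in> - \<Omega>" using Compl_nonempty by auto
  then show ?thesis using lipschitz_zero_outsideD(2)[OF assms, of x y] True by (simp add: lipschitz_zero_outsideD(3)[OF assms])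
next
  case False
  then have L: "L > 0" using lipschitz_zero_outsideD(1)[OF assms] by simp
  have "\<bar>v x\<bar> / L \<le> dist x y" if "y \<in> - \<Omega>" for y
    using lipschitz_zero_outsideD(2)[OF assms, of x y] lipschitz_zero_outsideD(3)[OF assms, of y] that L
    by (simp add: dist_norm field_simps)
  then have "\<bar>v x\<bar> / L \<le> bdist x"
    unfolding bdist_def infdist_notempty[OF Compl_nonempty] using Compl_nonempty by (intro cINF_greatest) auto
  then show ?thesis using L by (simp add: field_simps)
qed

lemma lzo_scale:
  assumes "lzo L v" "0 \<le> c" shows "lzo (c * L) (\<lambda>x. c * v x)"
proof (rule lipschitz_zero_outsideI)
  show "\<bar>c * v x - c * v y\<bar> \<le> c * L * norm (x - y)" for x y
    using mult_left_mono[OF lipschitz_zero_outsideD(2)[OF assms(1), of x y] assms(2)] assms(2)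
    by (simp add: abs_mult mult.assoc flip: right_diff_distrib)
qed (use lipschitz_zero_outsideD[OF assms(1)] assms(2) in auto)

lemma lzo_positive_part:
  assumes "lzo L v" shows "lzo L (\<lambda>x. max (v x) 0)"
proof (rule lipschitz_zero_outsideI)
  show "\<bar>max (v x) 0 - max (v y) 0\<bar> \<le> L * norm (x - y)" for x y
    using lipschitz_zero_outsideD(2)[OF assms, of x y] by (auto simp: max_def)
qed (use lipschitz_zero_outsideD[OF assms] in auto)

lemma continuous_L2:
  assumes "continuous_on UNIV v" "\<And>x. x \<in> \<Omega> \<Longrightarrow> \<bar>v x\<bar> \<le> B"
  shows "v \<in> L2 \<Omega>"
  using assms by (intro L2_bounded[OF _ lmeasurable\<Omega>] borel_imp_lebesgue_on borel_measurable_continuous_onI)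

lemma bdist_bounded: obtains B where "\<And>x. bdist x \<le> B"
proof -
  obtain R where "\<And>x. x \<in> \<Omega> \<Longrightarrow> norm x \<le> R" using \<Omega> by (auto simp: bounded_iff)
  then have "\<And>x. R < norm x \<Longrightarrow> bdist x = 0" using lipschitz_zero_outsideD(3)[OF lzo_bdist] by force
  then show ?thesis
    using continuous_bounded_support_imp_bounded[OF lipschitz_zero_outsideD(4)[OF lzo_bdist]] that
    by (metis abs_le_D1)
qed

lemma lzo_L2: assumes "lzo L v" shows "v \<in> L2 \<Omega>"
proof -
  obtain B where "\<And>x. bdist x \<le> B" using bdist_bounded by blast
  then have "\<bar>v x\<bar> \<le> L * B" for x
    using lzo_le_bdist[OF assms, of x] lipschitz_zero_outsideD(1)[OF assms] by (meson mult_left_mono order_trans)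
  then show ?thesis using lipschitz_zero_outsideD(4)[OF assms] by (intro continuous_L2) auto
qed

abbreviation cls :: "('a \<Rightarrow> real) \<Rightarrow> 'a l2" where "cls \<equiv> l2_class \<Omega>"

lemma inner_cls_mono:
  assumes "u \<in> L2 \<Omega>" "v \<in> L2 \<Omega>" "u' \<in> L2 \<Omega>" "v' \<in> L2 \<Omega>" "AE x in lebesgue_on \<Omega>. u x * v x \<le> u' x * v' x"
  shows "cls u \<bullet> cls v \<le> cls u' \<bullet> cls v'"
  unfolding inner_l2_class[OF sets\<Omega> assms(1,2)] inner_l2_class[OF sets\<Omega> assms(3,4)] L2_inner_def
  using assms by (intro integral_mono_AE L2_integrable_mult)

lemma norm_cls_mono:
  assumes "u \<in> L2 \<Omega>" "v \<in> L2 \<Omega>" "AE x in lebesgue_on \<Omega>. \<bar>u x\<bar> \<le> \<bar>v x\<bar>"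
  shows "norm (cls u) \<le> norm (cls v)"
proof -
  have "AE x in lebesgue_on \<Omega>. u x * u x \<le> v x * v x"
    using assms(3) by eventually_elim (metis abs_le_square_iff power2_eq_square)
  then have "cls u \<bullet> cls u \<le> cls v \<bullet> cls v" using assms by (intro inner_cls_mono)
  then show ?thesis by (simp add: norm_le)
qed

definition lipc :: "real \<Rightarrow> 'a l2 \<Rightarrow> bool" where
  "lipc K h \<longleftrightarrow> (\<exists>v. lzo K v \<and> h = cls v)"

text \<open>The exceptional set is open by continuity, and a null open set is empty.\<close>

lemma continuous_AE_mem_imp_mem:
  fixes f :: "'a \<Rightarrow> real"
  assumes f: "continuous_on \<Omega> f" and "closed C" and AE: "AE x in lebesgue_on \<Omega>. f x \<in> C" and "x \<in> \<Omega>"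
  shows "f x \<in> C"
proof (rule ccontr)
  assume n: "f x \<notin> C"
  define V where "V = \<Omega> \<inter> f -` (- C)"
  have "open V" unfolding V_def using f \<Omega>(1) \<open>closed C\<close> by (intro continuous_open_preimage) auto
  moreover have "V \<noteq> {}" using n assms(4) by (auto simp: V_def)
  moreover have "AE x in lebesgue. x \<in> \<Omega> \<longrightarrow> f x \<in> C"
    using AE sets\<Omega> by (simp add: AE_restrict_space_iff)
  then have "AE x in lebesgue. x \<notin> V" by eventually_elim (auto simp: V_def)
  then have "AE x in lebesgue_on V. False"
    using \<open>open V\<close> by (auto simp: AE_restrict_space_iff)
  ultimately show False using AE_open_imp_ex by blast
qed

definition dnorm :: real where "dnorm = norm (cls bdist)"

lemma dnorm_pos: "0 < dnorm"
proof -
  obtain x where x: "x \<in> \<Omega>" using \<Omega> by auto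
  have "cls bdist \<noteq> 0"
  proof
    assume "cls bdist = 0"
    then have "AE x in lebesgue_on \<Omega>. bdist x \<in> {0}"
      using l2_class_eq_0_iff[OF sets\<Omega> lzo_L2[OF lzo_bdist]] by simp
    moreover have "continuous_on \<Omega> bdist"
      using lipschitz_zero_outsideD(4)[OF lzo_bdist] continuous_on_subset by blast
    ultimately have "bdist x \<in> {0}" using x by (intro continuous_AE_mem_imp_mem) auto
    then show False using bdist_pos[OF x] by simp
  qed
  then show ?thesis by (simp add: dnorm_def)
qed

text \<open>Integrates the pointwise bound of \<open>lzo_le_bdist\<close>. The constant is sharp:
  the class of \<open>bdist\<close> with \<open>K = 1\<close> gives equality.\<close>

lemma lipc_poincare:
  assumes "lipc K h" shows "(1 / dnorm) * norm h \<le> K"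
proof -
  obtain v where v: "lzo K v" "h = cls v" using assms by (auto simp: lipc_def)
  have K: "0 \<le> K" using lipschitz_zero_outsideD(1)[OF v(1)] .
  have "norm h \<le> norm (cls (\<lambda>x. K * bdist x))"
    unfolding v(2)
  proof (rule norm_cls_mono)
    show "AE x in lebesgue_on \<Omega>. \<bar>v x\<bar> \<le> \<bar>K * bdist x\<bar>"
      using lzo_le_bdist[OF v(1)] K bdist_nonneg by (intro AE_I2) simp
  qed (use v lzo_L2 L2_scale[OF lzo_L2[OF lzo_bdist]] in auto)
  also have "\<dots> = K * dnorm"
    using K by (simp add: l2_class_scale[OF sets\<Omega> lzo_L2[OF lzo_bdist]] dnorm_def)
  finally show ?thesis using dnorm_pos by (simp add: field_simps)
qed

text \<open>The functional need not be evaluated at \<open>v\<close>: smooth competitors within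
  \<open>2 * \<delta>\<close> of \<open>v\<close> have functional value at most \<open>K\<close>,
  and as \<Omega> has finite measure the uniform error costs a multiple of \<delta> in the inner
  product.\<close>

lemma subdifferential_inner_le:
  assumes p: "p \<in> L2_subdifferential \<Omega> (grad_sup_functional \<Omega>) u"
    and E: "grad_sup_functional \<Omega> u = ereal L" and v: "lzo K v"
  shows "L + cls p \<bullet> (cls v - cls u) \<le> K"
proof -
  have pu: "p \<in> L2 \<Omega>" "u \<in> L2 \<Omega>"
    and sub: "\<And>v. v \<in> L2 \<Omega> \<Longrightarrow> ereal L + ereal (L2_inner \<Omega> p (\<lambda>x. v x - u x)) \<le> grad_sup_functional \<Omega> v"
    using p E by (auto simp: L2_subdifferential_def)
  have vL: "v \<in> L2 \<Omega>" using v by (rule lzo_L2)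
  have one: "(\<lambda>x. 1) \<in> L2 \<Omega>" by (rule continuous_L2[where B = 1]) auto
  define c where "c = norm (cls p) * (2 * norm (cls (\<lambda>x. 1)))"
  have c: "c \<ge> 0" by (simp add: c_def)
  have "L + cls p \<bullet> (cls v - cls u) \<le> K + c * \<delta>" if \<delta>: "\<delta> > 0" for \<delta>
  proof -
    obtain W where W: "continuous_on UNIV W" "grad_sup_functional \<Omega> W \<le> ereal K" "\<And>x. \<bar>W x - v x\<bar> \<le> 2 * \<delta>"
      using lipschitz_approximation[OF \<Omega>(1,2) v \<delta>] by metis
    have "(\<lambda>x. W x - v x) \<in> L2 \<Omega>"
      using W lipschitz_zero_outsideD(4)[OF v] by (intro continuous_L2 continuous_intros) auto
    then have WL: "W \<in> L2 \<Omega>" using L2_add[OF _ vL] by fastforce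
    have "ereal L + ereal (L2_inner \<Omega> p (\<lambda>x. W x - u x)) \<le> ereal K"
      using sub[OF WL] W(2) by (rule order_trans)
    then have "L + cls p \<bullet> (cls W - cls u) \<le> K"
      using inner_l2_class[OF sets\<Omega> pu(1) L2_diff[OF WL pu(2)]] l2_class_diff[OF sets\<Omega> WL pu(2)] by simp
    moreover have "cls p \<bullet> (cls v - cls W) \<le> c * \<delta>"
    proof -
      have "norm (cls v - cls W) = norm (cls (\<lambda>x. v x - W x))" by (simp add: l2_class_diff[OF sets\<Omega> vL WL])
      also have "\<dots> \<le> norm (cls (\<lambda>x. 2 * \<delta> * 1))"
        using W(3) \<delta> by (intro norm_cls_mono L2_diff vL WL L2_scale one AE_I2) (simp add: abs_minus_commute)
      also have "\<dots> = 2 * \<delta> * norm (cls (\<lambda>x. 1))" using \<delta> by (subst l2_class_scale[OF sets\<Omega> one]) simp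
      finally have "norm (cls p) * norm (cls v - cls W) \<le> norm (cls p) * (2 * \<delta> * norm (cls (\<lambda>x. 1)))"
        by (rule mult_left_mono) simp
      then show ?thesis using norm_cauchy_schwarz[of "cls p" "cls v - cls W"] by (simp add: c_def mult_ac)
    qed
    ultimately show ?thesis by (simp add: inner_diff_right)
  qed
  then have le: "L + cls p \<bullet> (cls v - cls u) \<le> K + c * \<delta>" if "\<delta> > 0" for \<delta> using that by blast
  show ?thesis
  proof (rule field_le_epsilon)
    fix e :: real assume "e > 0"
    then have "e / (c + 1) > 0" using c by simp
    moreover have "c * (e / (c + 1)) \<le> e" using c \<open>e > 0\<close> by (simp add: field_simps)
    ultimately show "L + cls p \<bullet> (cls v - cls u) \<le> K + e" using le[of "e / (c + 1)"] by linarith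
  qed
qed

text \<open>Testing with zero gives \<open>L \<le> cls p \<bullet> cls u\<close>, and testing with
  twice the representative gives the reverse inequality. After this Euler identity the subgradient
  inequality reduces to the support inequality.\<close>

lemma subdifferential_characterization:
  assumes p: "p \<in> L2_subdifferential \<Omega> (grad_sup_functional \<Omega>) u"
  obtains L where "lipc L (cls u)" "cls p \<bullet> cls u = L" "\<And>h K. lipc K h \<Longrightarrow> cls p \<bullet> h \<le> K"
proof -
  obtain L where E: "grad_sup_functional \<Omega> u = ereal L"
    using p by (auto simp: L2_subdifferential_def)
  have u: "u \<in> L2 \<Omega>" using p by (auto simp: L2_subdifferential_def)
  obtain v where v: "lzo L v" "AE x in lebesgue_on \<Omega>. u x = v x"
    using W1inf0_lipschitz_representative[OF \<Omega> E] by blast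
  have uv: "cls u = cls v"
    using l2_class_eq_iff[OF sets\<Omega> u lzo_L2[OF v(1)]] v(2) by simp
  have "lzo 0 (\<lambda>x. 0)" by (rule lipschitz_zero_outsideI) auto
  from subdifferential_inner_le[OF p E this] have 1: "L \<le> cls p \<bullet> cls u"
    by (simp add: l2_class_zero[OF sets\<Omega>])
  have "lzo (2 * L) (\<lambda>x. 2 * v x)" using v(1) by (rule lzo_scale) simp
  from subdifferential_inner_le[OF p E this] have 2: "cls p \<bullet> cls u \<le> L"
    by (simp add: l2_class_scale[OF sets\<Omega> lzo_L2[OF v(1)]] uv inner_diff_right)
  show ?thesis
  proof
    show "lipc L (cls u)" using v(1) uv by (auto simp: lipc_def)
    show eq: "cls p \<bullet> cls u = L" using 1 2 by simp
    fix h K assume "lipc K h"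
    then obtain w where "lzo K w" "h = cls w" by (auto simp: lipc_def)
    then show "cls p \<bullet> h \<le> K" using subdifferential_inner_le[OF p E, of K w] eq by (simp add: inner_diff_right)
  qed
qed

end

section \<open>The gradient flow as a curve of classes\<close>

locale gradient_flow = bounded_domain +
  fixes f :: "'a \<Rightarrow> real" and u :: "real \<Rightarrow> 'a \<Rightarrow> real"
  assumes flow0: "L2_gradient_flow \<Omega> (grad_sup_functional \<Omega>) f u"
begin

lemma u_L2: "0 \<le> t \<Longrightarrow> u t \<in> L2 \<Omega>"
  using flow0 by (auto simp: L2_gradient_flow_def)

definition U :: "real \<Rightarrow> 'a l2" where "U t = cls (u t)"

lemma norm_U_diff:
  "0 \<le> s \<Longrightarrow> 0 \<le> t \<Longrightarrow> norm (U s - U t) = L2_norm \<Omega> (\<lambda>x. u s x - u t x)"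
  unfolding U_def
  by (simp add: l2_class_diff[OF sets\<Omega> u_L2 u_L2, symmetric] norm_l2_class[OF sets\<Omega> L2_diff] u_L2)

lemma U_continuous: "continuous_on {0..} U"
  unfolding continuous_on
proof
  fix t :: real assume t: "t \<in> {0..}"
  have "((\<lambda>s. L2_norm \<Omega> (\<lambda>x. u s x - u t x)) \<longlongrightarrow> 0) (at t within {0..})"
    using flow0 t by (auto simp: L2_gradient_flow_def)
  then have "((\<lambda>s. norm (U s - U t)) \<longlongrightarrow> 0) (at t within {0..})"
    by (rule Lim_transform_within[where d = 1]) (use t norm_U_diff in auto)
  then show "(U \<longlongrightarrow> U t) (at t within {0..})"
    by (simp add: tendsto_norm_zero_iff LIM_zero_iff)
qed

lemma U_absolutely_continuous:
  assumes "0 < a" "a \<le> b"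
  shows "absolutely_continuous_dist a b (\<lambda>r s. norm (U s - U r))"
  unfolding absolutely_continuous_dist_def
proof (intro allI impI)
  fix \<epsilon> :: real assume "\<epsilon> > 0"
  have "L2_absolutely_continuous_on \<Omega> a b u" using flow0 assms by (auto simp: L2_gradient_flow_def)
  then obtain d where d: "d > 0" "\<And>S. finite S \<and> (\<forall>(r, s)\<in>S. a \<le> r \<and> r \<le> s \<and> s \<le> b) \<and>
        disjoint_family_on (\<lambda>(r, s). {r<..<s}) S \<and> (\<Sum>(r, s)\<in>S. s - r) < d \<Longrightarrow>
        (\<Sum>(r, s)\<in>S. L2_norm \<Omega> (\<lambda>x. u s x - u r x)) < \<epsilon>"
    unfolding L2_absolutely_continuous_on_def using \<open>\<epsilon> > 0\<close> by meson
  show "\<exists>\<delta>>0. \<forall>S. finite S \<and> (\<forall>(r, s)\<in>S. a \<le> r \<and> r \<le> s \<and> s \<le> b) \<and>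
        disjoint_family_on (\<lambda>(r, s). {r<..<s}) S \<and> (\<Sum>(r, s)\<in>S. s - r) < \<delta> \<longrightarrow>
        (\<Sum>(r, s)\<in>S. norm (U s - U r)) < \<epsilon>"
  proof (intro exI[of _ d] conjI allI impI d(1))
    fix S assume S: "finite S \<and> (\<forall>(r, s)\<in>S. a \<le> r \<and> r \<le> s \<and> s \<le> b) \<and>
        disjoint_family_on (\<lambda>(r, s). {r<..<s}) S \<and> (\<Sum>(r, s)\<in>S. s - r) < d"
    have "(\<Sum>(r, s)\<in>S. norm (U s - U r)) = (\<Sum>(r, s)\<in>S. L2_norm \<Omega> (\<lambda>x. u s x - u r x))"
      using S assms(1) by (intro sum.cong refl) (force intro!: norm_U_diff)
    then show "(\<Sum>(r, s)\<in>S. norm (U s - U r)) < \<epsilon>" using d(2)[OF S] by simp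
  qed
qed

lemma U_vector_derivative:
  assumes "0 < t" "L2_has_derivative_at \<Omega> u w t"
  shows "(U has_vector_derivative cls w) (at t)"
  unfolding has_vector_derivative_iff_norm
proof -
  have w: "w \<in> L2 \<Omega>" and lim: "((\<lambda>s. L2_norm \<Omega> (\<lambda>x. (u s x - u t x) / (s - t) - w x)) \<longlongrightarrow> 0) (at t)"
    using assms(2) by (auto simp: L2_has_derivative_at_def)
  show "((\<lambda>s. norm ((U s - U t) /\<^sub>R (s - t) - cls w)) \<longlongrightarrow> 0) (at t)"
  \<comment> \<open>The radius \<open>t\<close> keeps \<open>s\<close> nonnegative, where
    \<open>u s\<close> is known to be square integrable.\<close>
  proof (rule Lim_transform_within[OF lim \<open>0 < t\<close>])
    fix s assume "0 < dist s t" "dist s t < t"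
    then have s: "0 \<le> s" by (auto simp: dist_real_def)
    have d: "(\<lambda>x. u s x - u t x) \<in> L2 \<Omega>" using s assms(1) by (intro L2_diff u_L2) auto
    have "cls (\<lambda>x. (u s x - u t x) / (s - t) - w x) = (U s - U t) /\<^sub>R (s - t) - cls w"
      unfolding U_def l2_class_diff[OF sets\<Omega> L2_divide[OF d] w] l2_class_divide[OF sets\<Omega> d]
      using s assms(1) by (simp add: l2_class_diff[OF sets\<Omega> u_L2 u_L2])
    then show "L2_norm \<Omega> (\<lambda>x. (u s x - u t x) / (s - t) - w x) = norm ((U s - U t) /\<^sub>R (s - t) - cls w)"
      using norm_l2_class[OF sets\<Omega> L2_diff[OF L2_divide[OF d] w]] by metis
  qed
qed

sublocale homogeneous_flow U lipc "1 / dnorm"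
proof
  have "AE t in lebesgue. 0 < t \<longrightarrow> (\<exists>w. L2_has_derivative_at \<Omega> u w t \<and>
             (\<lambda>x. - w x) \<in> L2_subdifferential \<Omega> (grad_sup_functional \<Omega>) (u t))"
    using flow0 by (simp add: L2_gradient_flow_def)
  then show "AE t in lebesgue. 0 < t \<longrightarrow> (\<exists>p L. flow_at U lipc t p L)"
  proof eventually_elim
    case (elim t)
    show ?case
    proof
      assume t: "0 < t"
      then obtain w where w: "L2_has_derivative_at \<Omega> u w t" "(\<lambda>x. - w x) \<in> L2_subdifferential \<Omega> (grad_sup_functional \<Omega>) (u t)"
        using elim by blast
      obtain L where L: "lipc L (cls (u t))" "cls (\<lambda>x. - w x) \<bullet> cls (u t) = L" "\<And>h K. lipc K h \<Longrightarrow> cls (\<lambda>x. - w x) \<bullet> h \<le> K"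
        using subdifferential_characterization[OF w(2)] by blast
      have "w \<in> L2 \<Omega>" using w(1) by (simp add: L2_has_derivative_at_def)
      then have "(U has_vector_derivative - cls (\<lambda>x. - w x)) (at t)"
        using U_vector_derivative[OF t w(1)] by (simp add: l2_class_uminus[OF sets\<Omega>])
      then show "\<exists>p L. flow_at U lipc t p L" using L by (auto simp: flow_at_def U_def)
    qed
  qed
qed (use U_continuous U_absolutely_continuous dnorm_pos lipc_poincare in auto)


section \<open>Preservation of nonnegativity\<close>

definition Neg :: "real \<Rightarrow> 'a l2" where "Neg t = cls (\<lambda>x. max (- u t x) 0)"

lemma neg_L2: assumes "0 \<le> t" shows "(\<lambda>x. max (- u t x) 0) \<in> L2 \<Omega>"
proof -
  have u: "u t \<in> L2 \<Omega>" using u_L2[OF assms] .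
  have "integrable (lebesgue_on \<Omega>) (\<lambda>x. (max (- u t x) 0)\<^sup>2)"
  proof (rule Bochner_Integration.integrable_bound[OF L2_D(2)[OF u]])
    show "(\<lambda>x. (max (- u t x) 0)\<^sup>2) \<in> borel_measurable (lebesgue_on \<Omega>)"
      using L2_D(1)[OF u] by auto
    show "AE x in lebesgue_on \<Omega>. norm ((max (- u t x) 0)\<^sup>2) \<le> norm ((u t x)\<^sup>2)"
      by (intro AE_I2) (auto simp: max_def)
  qed
  then show ?thesis using L2_D(1)[OF u] by (auto simp: L2_def)
qed

text \<open>The real function \<open>(max (- r) 0)\<^sup>2\<close> is convex with derivative
  \<open>- 2 * max (- r) 0\<close>, and it exceeds its tangent by at most the square of the
  increment. Integrated over \<Omega>, these two pointwise facts yield differentiability of the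
  squared norm of \<open>Neg\<close>.\<close>

lemma Neg_inner:
  assumes "0 \<le> s" "0 \<le> t"
  shows "Neg t \<bullet> Neg t - 2 * (Neg t \<bullet> (U s - U t)) \<le> Neg s \<bullet> Neg s"
    and "Neg s \<bullet> Neg s \<le> Neg t \<bullet> Neg t - 2 * (Neg t \<bullet> (U s - U t)) + (U s - U t) \<bullet> (U s - U t)"
proof -
  let ?n = "\<lambda>t x. max (- u t x) 0"
  have d: "(\<lambda>x. u s x - u t x) \<in> L2 \<Omega>" using assms by (intro L2_diff u_L2)
  have e: "U s - U t = cls (\<lambda>x. u s x - u t x)"
    unfolding U_def using assms by (simp add: l2_class_diff[OF sets\<Omega> u_L2 u_L2])
  note i1 = L2_integrable_mult[OF neg_L2[OF assms(2)] neg_L2[OF assms(2)]]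
    and i2 = L2_integrable_mult[OF neg_L2[OF assms(2)] d] and i3 = L2_integrable_mult[OF d d]
    and i4 = L2_integrable_mult[OF neg_L2[OF assms(1)] neg_L2[OF assms(1)]]
  have eq: "Neg t \<bullet> Neg t = (LINT x|lebesgue_on \<Omega>. ?n t x * ?n t x)" "Neg s \<bullet> Neg s = (LINT x|lebesgue_on \<Omega>. ?n s x * ?n s x)"
    "Neg t \<bullet> (U s - U t) = (LINT x|lebesgue_on \<Omega>. ?n t x * (u s x - u t x))"
    "(U s - U t) \<bullet> (U s - U t) = (LINT x|lebesgue_on \<Omega>. (u s x - u t x) * (u s x - u t x))"
    unfolding e Neg_def using neg_L2 d assms by (simp_all add: inner_l2_class[OF sets\<Omega>] L2_inner_def)
  have "(LINT x|lebesgue_on \<Omega>. ?n t x * ?n t x - 2 * (?n t x * (u s x - u t x))) \<le> (LINT x|lebesgue_on \<Omega>. ?n s x * ?n s x)"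
  proof (rule integral_mono)
    fix x
    have "(u s x + ?n t x) * (u s x + ?n t x) \<ge> 0" "u s x * ?n t x \<ge> 0 \<or> u s x \<le> 0" by auto
    then show "?n t x * ?n t x - 2 * (?n t x * (u s x - u t x)) \<le> ?n s x * ?n s x"
      by (auto simp: max_def algebra_simps mult_nonneg_nonpos)
  qed (use i1 i2 i4 in auto)
  then show "Neg t \<bullet> Neg t - 2 * (Neg t \<bullet> (U s - U t)) \<le> Neg s \<bullet> Neg s"
    unfolding eq using i1 i2 by simp
  have "(LINT x|lebesgue_on \<Omega>. ?n s x * ?n s x) \<le>
     (LINT x|lebesgue_on \<Omega>. ?n t x * ?n t x - 2 * (?n t x * (u s x - u t x)) + (u s x - u t x) * (u s x - u t x))"
  proof (rule integral_mono)
    fix x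
    have "(u s x - u t x) * (u s x - u t x) \<ge> 0" "u s x * u s x \<ge> 0" by auto
    moreover have "u s x * u s x \<le> (u s x - u t x) * (u s x - u t x)" if "u s x \<le> 0" "0 \<le> u t x"
    proof -
      have "(u s x - u t x) * (u s x - u t x) = u s x * u s x + 2 * (u t x * (- u s x)) + u t x * u t x"
        by (simp add: algebra_simps)
      then show ?thesis
        using that mult_nonneg_nonneg[of "u t x" "- u s x"] zero_le_square[of "u t x"] by linarith
    qed
    ultimately show "?n s x * ?n s x \<le> ?n t x * ?n t x - 2 * (?n t x * (u s x - u t x)) + (u s x - u t x) * (u s x - u t x)"
      by (auto simp: max_def algebra_simps)
  qed (use i1 i2 i3 i4 in auto)
  then show "Neg s \<bullet> Neg s \<le> Neg t \<bullet> Neg t - 2 * (Neg t \<bullet> (U s - U t)) + (U s - U t) \<bullet> (U s - U t)"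
    unfolding eq using i1 i2 i3 by simp
qed

lemma Neg_norm_le: "0 \<le> t \<Longrightarrow> norm (Neg t) \<le> norm (U t)"
  unfolding Neg_def U_def by (intro norm_cls_mono neg_L2 u_L2 AE_I2) auto

text \<open>The error \<open>E\<close> of the linearization lies between 0 and the squared increment
  of \<open>U\<close>, so it has derivative zero at \<open>t\<close>. The remaining derivative is
  \<open>2 * (p \<bullet> Neg t)\<close>.\<close>

lemma Neg_derivative:
  assumes "0 < t" "good t p L"
  shows "\<exists>D\<le>0. ((\<lambda>s. Neg s \<bullet> Neg s) has_real_derivative D) (at t)"
proof -
  have der: "(U has_derivative (\<lambda>h. h *\<^sub>R (- p))) (at t)"
    using assms(2) by (simp add: flow_at_def has_vector_derivative_def)
  define E where "E = (\<lambda>s. Neg s \<bullet> Neg s - (Neg t \<bullet> Neg t - 2 * (Neg t \<bullet> (U s - U t))))"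
  define q where "q = (\<lambda>s. (U s - U t) \<bullet> (U s - U t))"
  have "((\<lambda>s. U s - U t) has_derivative (\<lambda>h. h *\<^sub>R (- p))) (at t)"
    using has_derivative_diff[OF der has_derivative_const[of "U t"]] by simp
  then have "(q has_derivative (\<lambda>h. (U t - U t) \<bullet> (h *\<^sub>R (- p)) + (h *\<^sub>R (- p)) \<bullet> (U t - U t))) (at t)"
    unfolding q_def by (intro has_derivative_inner)
  moreover have "(\<lambda>h. (U t - U t) \<bullet> (h *\<^sub>R (- p)) + (h *\<^sub>R (- p)) \<bullet> (U t - U t)) = (*) 0" by auto
  ultimately have "(q has_real_derivative 0) (at t)" unfolding has_field_derivative_def by metis
  then have "((\<lambda>h. (q (t + h) - q t) / h) \<longlongrightarrow> 0) (at 0)" by (simp add: DERIV_def)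
  then have q0: "((\<lambda>h. \<bar>(q (t + h) - q t) / h\<bar>) \<longlongrightarrow> 0) (at 0)" by (rule tendsto_rabs_zero)
  have "((\<lambda>h. (E (t + h) - E t) / h) \<longlongrightarrow> 0) (at 0)"
  proof (rule Lim_null_comparison[OF _ q0])
    have "norm ((E (t + h) - E t) / h) \<le> \<bar>(q (t + h) - q t) / h\<bar>" if "\<bar>h\<bar> < t" for h
    proof -
      have st: "0 \<le> t + h" "0 \<le> t" using that by auto
      have "0 \<le> E (t + h)" "E (t + h) \<le> q (t + h)" using Neg_inner[OF st] by (simp_all add: E_def q_def)
      moreover have "E t = 0" "q t = 0" by (simp_all add: E_def q_def)
      ultimately show ?thesis by (simp add: abs_divide divide_right_mono)
    qed
    then show "\<forall>\<^sub>F h in at 0. norm ((E (t + h) - E t) / h) \<le> \<bar>(q (t + h) - q t) / h\<bar>"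
      unfolding eventually_at using assms(1) by (intro exI[of _ t]) (auto simp: dist_real_def)
  qed
  then have "(E has_real_derivative 0) (at t)" by (simp add: DERIV_def)
  moreover have "((\<lambda>s. Neg t \<bullet> (U s - U t)) has_real_derivative Neg t \<bullet> (- p)) (at t)"
  proof -
    have "((\<lambda>s. Neg t \<bullet> (U s - U t)) has_derivative (\<lambda>h. Neg t \<bullet> (h *\<^sub>R (- p) - 0))) (at t)"
      by (intro has_derivative_inner_right has_derivative_diff der has_derivative_const)
    moreover have "(\<lambda>h. Neg t \<bullet> (h *\<^sub>R (- p) - 0)) = (*) (Neg t \<bullet> (- p))" by (auto simp: fun_eq_iff)
    ultimately show ?thesis by (simp add: has_field_derivative_def)
  qed
  ultimately have "((\<lambda>s. E s + (Neg t \<bullet> Neg t - 2 * (Neg t \<bullet> (U s - U t)))) has_real_derivative 0 + (0 - 2 * (Neg t \<bullet> (- p)))) (at t)"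
    by (intro DERIV_add DERIV_diff DERIV_const DERIV_cmult)
  \<comment> \<open>\<open>U t + Neg t\<close> is the positive part and has the same Lipschitz
    constant \<open>L\<close>. Hence
    \<open>p \<bullet> (U t + Neg t) \<le> L = p \<bullet> U t\<close>.\<close>
  moreover have "p \<bullet> Neg t \<le> 0"
  proof -
    have g: "lipc L (U t)" "p \<bullet> U t = L" "\<And>h K. lipc K h \<Longrightarrow> p \<bullet> h \<le> K"
      using assms(2) by (auto simp: flow_at_def)
    obtain v where v: "lzo L v" "U t = cls v" using g(1) by (auto simp: lipc_def)
    have ut: "u t \<in> L2 \<Omega>" "v \<in> L2 \<Omega>" using u_L2 assms(1) lzo_L2[OF v(1)] by auto
    have "AE x in lebesgue_on \<Omega>. u t x = v x"
      using v(2) l2_class_eq_iff[OF sets\<Omega> ut] by (simp add: U_def)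
    then have "AE x in lebesgue_on \<Omega>. u t x + max (- u t x) 0 = max (v x) 0"
      by eventually_elim auto
    then have "cls (\<lambda>x. u t x + max (- u t x) 0) = cls (\<lambda>x. max (v x) 0)"
      using l2_class_eq_iff[OF sets\<Omega> L2_add[OF ut(1) neg_L2] lzo_L2[OF lzo_positive_part[OF v(1)]]] assms(1) by simp
    then have "U t + Neg t = cls (\<lambda>x. max (v x) 0)"
      using l2_class_add[OF sets\<Omega> ut(1) neg_L2] assms(1) by (simp add: U_def Neg_def)
    then have "lipc L (U t + Neg t)" using lzo_positive_part[OF v(1)] by (auto simp: lipc_def)
    from g(3)[OF this] show ?thesis using g(2) by (simp add: inner_add_right)
  qed
  ultimately show ?thesis
    by (intro exI[of _ "0 + (0 - 2 * (Neg t \<bullet> (- p)))"]) (simp add: E_def inner_commute)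
qed

lemma nonneg_preserved:
  assumes f: "AE x in lebesgue_on \<Omega>. 0 \<le> f x" and b: "0 \<le> b"
  shows "AE x in lebesgue_on \<Omega>. 0 \<le> u b x"
proof -
  obtain Z where Z: "negligible Z" "\<And>t. 0 < t \<Longrightarrow> t \<notin> Z \<Longrightarrow> \<exists>p L. good t p L"
    using exceptional_set by blast
  have N0: "Neg 0 = 0"
  proof -
    have "AE x in lebesgue_on \<Omega>. u 0 x = f x" using flow0 by (simp add: L2_gradient_flow_def)
    then have "AE x in lebesgue_on \<Omega>. max (- u 0 x) 0 = 0" using f by eventually_elim auto
    then show ?thesis unfolding Neg_def using l2_class_eq_0_iff[OF sets\<Omega> neg_L2] by simp
  qed
  have mono: "Neg b \<bullet> Neg b \<le> Neg a \<bullet> Neg a" if a: "0 < a" "a \<le> b" for a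
  proof -
    have "compact (U ` {a..b})" using U_continuous a by (intro compact_continuous_image) (auto intro: continuous_on_subset)
    then obtain B where B: "B > 0" "\<And>t. t \<in> {a..b} \<Longrightarrow> norm (U t) \<le> B"
      using compact_imp_bounded[of "U ` {a..b}"] unfolding bounded_pos by auto
    show ?thesis
    proof (rule nonincreasing_if_derivative_nonpos_AE[where C = "2 * B" and Z = Z, OF a(2) _ U_absolutely_continuous[OF a]])
      fix r s assume rs: "a \<le> r" "r \<le> s" "s \<le> b"
      have "Neg s \<bullet> Neg s - Neg r \<bullet> Neg r \<le> 2 * (Neg s \<bullet> (U r - U s))"
        using Neg_inner(1)[of r s] rs a by simp
      also have "Neg s \<bullet> (U r - U s) \<le> norm (Neg s) * norm (U r - U s)" by (rule norm_cauchy_schwarz)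
      also have "norm (Neg s) * norm (U r - U s) \<le> B * norm (U r - U s)"
        using Neg_norm_le[of s] B(2)[of s] rs a by (intro mult_right_mono) auto
      finally show "Neg s \<bullet> Neg s - Neg r \<bullet> Neg r \<le> 2 * B * (norm (U s - U r) + (s - r))"
        using rs mult_nonneg_nonneg[of "2 * B" "s - r"] B(1)
        by (simp add: norm_minus_commute distrib_left del: mult_nonneg_nonneg zero_le_mult_iff)
    next
      fix t assume "a < t" "t < b" "t \<notin> Z"
      then show "\<exists>D\<le>0. ((\<lambda>s. Neg s \<bullet> Neg s) has_real_derivative D) (at t)"
        using Z(2)[of t] Neg_derivative[of t] a by auto
    qed (use B Z in auto)
  qed
  have "Neg b \<bullet> Neg b \<le> 0"
  proof (cases "b = 0")
    case False
    \<comment> \<open>Absolute continuity gives monotonicity only from a positive time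
      \<open>a\<close>. Since \<open>Neg 0\<close> vanishes, the squared norm of
      \<open>Neg a\<close> is at most that of \<open>U a - U 0\<close>, which tends to zero with
      \<open>a\<close>.\<close>
    have "(U \<longlongrightarrow> U 0) (at 0 within {0..})" using U_continuous by (simp add: continuous_on)
    then have "(U \<longlongrightarrow> U 0) (at_right 0)" by (rule tendsto_within_subset) auto
    then have "((\<lambda>a. (U a - U 0) \<bullet> (U a - U 0)) \<longlongrightarrow> (U 0 - U 0) \<bullet> (U 0 - U 0)) (at_right 0)"
      by (intro tendsto_inner tendsto_diff tendsto_const)
    moreover have "\<forall>\<^sub>F a in at_right 0. Neg b \<bullet> Neg b \<le> (U a - U 0) \<bullet> (U a - U 0)"
      unfolding eventually_at_right_field
    proof (intro exI[of _ b] conjI allI impI)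
      fix a assume "0 < a" "a < b"
      then have "Neg b \<bullet> Neg b \<le> Neg a \<bullet> Neg a" using mono by simp
      also have "\<dots> \<le> (U a - U 0) \<bullet> (U a - U 0)"
        using Neg_inner(2)[of a 0] \<open>0 < a\<close> N0 by simp
      finally show "Neg b \<bullet> Neg b \<le> (U a - U 0) \<bullet> (U a - U 0)" .
    qed (use False b in auto)
    ultimately have "Neg b \<bullet> Neg b \<le> (U 0 - U 0) \<bullet> (U 0 - U 0)" by (intro tendsto_lowerbound) auto
    then show ?thesis by simp
  qed (simp add: N0)
  then have "Neg b = 0" by (metis antisym inner_eq_zero_iff inner_ge_zero)
  then have "AE x in lebesgue_on \<Omega>. max (- u b x) 0 = 0"
    using l2_class_eq_0_iff[OF sets\<Omega> neg_L2[OF b]] by (simp add: Neg_def)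
  then show ?thesis by eventually_elim (auto simp: max_def split: if_splits)
qed


section \<open>Identification of the asymptotic decay rate\<close>

lemma bdist_L2: "bdist \<in> L2 \<Omega>" by (rule lzo_L2[OF lzo_bdist])

lemma good_representative:
  assumes nn: "AE x in lebesgue_on \<Omega>. 0 \<le> u t x" and t: "0 < t" "U t \<noteq> 0" and g: "good t p L"
  obtains w where "lzo (L / norm (U t)) w" "cls w = U t /\<^sub>R norm (U t)" "\<And>x. x \<in> \<Omega> \<Longrightarrow> 0 \<le> w x"
proof -
  obtain v where v: "lzo L v" "U t = cls v" using g by (auto simp: flow_at_def lipc_def)
  have ut: "u t \<in> L2 \<Omega>" "v \<in> L2 \<Omega>" using u_L2 t lzo_L2[OF v(1)] by auto
  have "AE x in lebesgue_on \<Omega>. u t x = v x"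
    using v(2) l2_class_eq_iff[OF sets\<Omega> ut] by (simp add: U_def)
  with nn have "AE x in lebesgue_on \<Omega>. v x \<in> {0..}" by eventually_elim simp
  moreover have "continuous_on \<Omega> v"
    using lipschitz_zero_outsideD(4)[OF v(1)] continuous_on_subset by blast
  ultimately have v0: "0 \<le> v x" if "x \<in> \<Omega>" for x
    using continuous_AE_mem_imp_mem[of v "{0..}" x] that by auto
  show ?thesis
  proof
    show "lzo (L / norm (U t)) (\<lambda>x. inverse (norm (U t)) * v x)"
      using lzo_scale[OF v(1), of "inverse (norm (U t))"] by (simp add: divide_inverse mult.commute)
    show "cls (\<lambda>x. inverse (norm (U t)) * v x) = U t /\<^sub>R norm (U t)"
      unfolding l2_class_scale[OF sets\<Omega> ut(2)] using v(2) by simp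
    show "0 \<le> inverse (norm (U t)) * v x" if "x \<in> \<Omega>" for x using v0[OF that] by simp
  qed
qed

lemma good_slope_le:
  assumes "U t \<noteq> 0" "good t p L"
  shows "L / norm (U t) \<le> norm p"
  using assms norm_cauchy_schwarz[of p "U t"] by (simp add: flow_at_def field_simps)

text \<open>With \<open>R = L / norm (U t)\<close>, \<open>w = U t / norm (U t)\<close> and \<open>q = p - R w\<close> one has \<open>\<langle>q, w\<rangle> = 0\<close>, and
  \<open>\<langle>p, R d - w\<rangle> \<le> 0\<close> because \<open>d\<close> is 1-Lipschitz.\<close>

lemma defect_le:
  assumes U: "U t \<noteq> 0" and g: "good t p L"
  defines "R \<equiv> L / norm (U t)" and "w \<equiv> U t /\<^sub>R norm (U t)"
  shows "R * (w \<bullet> (R *\<^sub>R cls bdist - w)) \<le> sqrt ((norm p)\<^sup>2 - R\<^sup>2) * norm (R *\<^sub>R cls bdist - w)"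
proof -
  have N: "norm (U t) > 0" using U by simp
  have pU: "p \<bullet> U t = L" "\<And>h K. lipc K h \<Longrightarrow> p \<bullet> h \<le> K"
    using g by (auto simp: flow_at_def)
  have pw: "p \<bullet> w = R" using pU(1) by (simp add: w_def R_def divide_inverse)
  have ww: "w \<bullet> w = 1" using N by (simp add: w_def power2_norm_eq_inner[symmetric] power2_eq_square)
  have R0: "0 \<le> R" using good_nonneg[OF g] by (simp add: R_def)
  define q where "q = p - R *\<^sub>R w"
  have "q \<bullet> q = (norm p)\<^sup>2 - R\<^sup>2"
    using pw ww by (simp add: q_def dot_square_norm[of p] inner_diff_left inner_diff_right inner_commute[of w p] power2_eq_square)
  then have nq: "norm q = sqrt ((norm p)\<^sup>2 - R\<^sup>2)" by (simp add: norm_eq_sqrt_inner)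
  have "lipc 1 (cls bdist)" using lzo_bdist by (auto simp: lipc_def)
  then have "p \<bullet> cls bdist \<le> 1" by (rule pU(2))
  then have "p \<bullet> (R *\<^sub>R cls bdist - w) \<le> 0"
    using pw R0 mult_left_mono[of "p \<bullet> cls bdist" 1 R] by (simp add: inner_diff_right)
  then have "R * (w \<bullet> (R *\<^sub>R cls bdist - w)) \<le> - (q \<bullet> (R *\<^sub>R cls bdist - w))"
    by (simp add: q_def inner_diff_left)
  also have "\<dots> \<le> norm q * norm (R *\<^sub>R cls bdist - w)"
    using norm_cauchy_schwarz[of "- q" "R *\<^sub>R cls bdist - w"] by simp
  finally show ?thesis using nq by simp
qed

text \<open>The slopes \<open>R k\<close> and the bounds on \<open>norm (p k)\<close> have the same
  limit \<open>P\<close>, so the square root in \<open>defect_le\<close> tends to zero. In the limit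
  the integral of \<open>g x * (P * bdist x - g x)\<close> is nonpositive while its integrand is
  nonnegative.\<close>

lemma slope_eq:
  assumes conn: "connected \<Omega>" and nn: "\<And>t. 0 \<le> t \<Longrightarrow> AE x in lebesgue_on \<Omega>. 0 \<le> u t x"
    and T: "0 < T" "\<And>t. 0 \<le> t \<Longrightarrow> t < T \<Longrightarrow> U t \<noteq> 0"
    and P0: "0 \<le> P"
    and P1: "\<And>\<epsilon>. \<epsilon> > 0 \<Longrightarrow> \<exists>t0. 0 < t0 \<and> t0 < T \<and> (\<forall>t p L. t0 < t \<and> t < T \<and> good t p L \<longrightarrow> norm p \<le> P + \<epsilon>)"
    and P2: "\<And>\<epsilon> t0. \<epsilon> > 0 \<Longrightarrow> 0 < t0 \<Longrightarrow> t0 < T \<Longrightarrow> \<exists>t p L. t0 < t \<and> t < T \<and> good t p L \<and> P - \<epsilon> \<le> L / norm (U t)"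
  shows "P = 1 / dnorm"
proof -
  \<comment> \<open>\<open>P1\<close> provides a final interval on which the upper bound holds, and
    \<open>P2\<close> finds a time in it with the lower bound; both use the error
    \<open>1 / Suc k\<close>.\<close>
  have "\<exists>t p L. 0 < t \<and> t < T \<and> good t p L \<and> norm p \<le> P + 1 / real (Suc k) \<and> P - 1 / real (Suc k) \<le> L / norm (U t)" for k
  proof -
    have e: "1 / real (Suc k) > 0" by simp
    obtain t0 where t0: "0 < t0" "t0 < T" "\<And>t p L. t0 < t \<Longrightarrow> t < T \<Longrightarrow> good t p L \<Longrightarrow> norm p \<le> P + 1 / real (Suc k)"
      using P1[OF e] by blast
    obtain t p L where "t0 < t" "t < T" "good t p L" "P - 1 / real (Suc k) \<le> L / norm (U t)"
      using P2[OF e t0(1,2)] by blast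
    then show ?thesis using t0 by (intro exI[of _ t] exI[of _ p] exI[of _ L]) auto
  qed
  then obtain t p L where tp: "\<And>k. 0 < t k" "\<And>k. t k < T" "\<And>k. good (t k) (p k) (L k)"
    "\<And>k. norm (p k) \<le> P + 1 / real (Suc k)" "\<And>k. P - 1 / real (Suc k) \<le> L k / norm (U (t k))"
    by metis
  define R where "R = (\<lambda>k. L k / norm (U (t k)))"
  have Unz: "U (t k) \<noteq> 0" for k using T(2)[of "t k"] tp(1,2)[of k] by simp
  have Rp: "R k \<le> norm (p k)" for k unfolding R_def by (rule good_slope_le[OF Unz tp(3)])
  have inv0: "(\<lambda>k. 1 / real (Suc k)) \<longlonglongrightarrow> 0" using LIMSEQ_inverse_real_of_nat by (simp add: inverse_eq_divide)
  have Rlim: "R \<longlonglongrightarrow> P"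
  proof (rule tendsto_sandwich[where f = "\<lambda>k. P - 1 / real (Suc k)" and h = "\<lambda>k. P + 1 / real (Suc k)"])
    show "(\<lambda>k. P - 1 / real (Suc k)) \<longlonglongrightarrow> P" using tendsto_diff[OF tendsto_const inv0, of P] by simp
    show "(\<lambda>k. P + 1 / real (Suc k)) \<longlonglongrightarrow> P" using tendsto_add[OF tendsto_const inv0, of P] by simp
    show "\<forall>\<^sub>F k in sequentially. P - 1 / real (Suc k) \<le> R k" using tp(5) by (auto simp: R_def)
    show "\<forall>\<^sub>F k in sequentially. R k \<le> P + 1 / real (Suc k)"
      using order_trans[OF Rp tp(4)] by auto
  qed
  have R1: "R k \<le> P + 1" for k
  proof -
    have "1 / real (Suc k) \<le> 1" by simp
    then show ?thesis using order_trans[OF Rp tp(4), of k] by linarith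
  qed
  have lam: "1 / dnorm \<le> R k" for k
  proof -
    have "1 / dnorm * norm (U (t k)) \<le> L k" using tp(3)[of k] by (intro lipc_poincare) (simp add: flow_at_def)
    then show ?thesis using Unz[of k] by (simp add: R_def field_simps)
  qed
  have Ppos: "P \<ge> 1 / dnorm"
    by (rule LIMSEQ_le_const[OF Rlim]) (use lam in auto)
  have "\<exists>w. lzo (R k) w \<and> cls w = U (t k) /\<^sub>R norm (U (t k)) \<and> (\<forall>x\<in>\<Omega>. 0 \<le> w x)" for k
    using good_representative[OF nn tp(1) Unz tp(3), of k] tp(1)[of k] unfolding R_def by (metis less_imp_le)
  then obtain w where w: "\<And>k. lzo (R k) (w k)" "\<And>k. cls (w k) = U (t k) /\<^sub>R norm (U (t k))" "\<And>k x. x \<in> \<Omega> \<Longrightarrow> 0 \<le> w k x"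
    by metis
  have wL2: "w k \<in> L2 \<Omega>" for k using w(1) by (rule lzo_L2)
  obtain B where B: "\<And>x. bdist x \<le> B" using bdist_bounded by blast
  have B0: "0 \<le> B" using B[of undefined] bdist_nonneg[of undefined] by linarith
  have R0: "0 \<le> R k" for k using lam[of k] dnorm_pos by (meson divide_nonneg_pos less_imp_le order_trans zero_le_one)
  have wR: "\<bar>w k x\<bar> \<le> R k * bdist x" for k x by (rule lzo_le_bdist[OF w(1)])
  have wB: "\<bar>w k x\<bar> \<le> (P + 1) * B" for k x
  proof -
    have "R k * bdist x \<le> (P + 1) * B" using R1[of k] B[of x] R0[of k] bdist_nonneg[of x] P0 by (intro mult_mono) auto
    then show ?thesis using wR[of k x] by linarith
  qed
  \<comment> \<open>The normalized representatives share the Lipschitz constant \<open>P + 1\<close>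
    and the bound \<open>(P + 1) * B\<close>.\<close>
  obtain g r where g: "continuous_on (closure \<Omega>) g" "strict_mono (r :: nat \<Rightarrow> nat)"
    "\<And>e. 0 < e \<Longrightarrow> \<exists>N. \<forall>n x. n \<ge> N \<and> x \<in> closure \<Omega> \<longrightarrow> norm (w (r n) x - g x) < e"
  proof (rule Arzela_Ascoli[of "closure \<Omega>" w "(P + 1) * B"])
    show "compact (closure \<Omega>)" using \<Omega>(2) by (simp add: compact_closure)
    show "norm (w n x) \<le> (P + 1) * B" for n x using wB by simp
    fix x and e :: real assume "0 < e"
    show "\<exists>d>0. \<forall>n y. y \<in> closure \<Omega> \<and> norm (x - y) < d \<longrightarrow> norm (w n x - w n y) < e"
    proof (intro exI[of _ "e / (P + 1)"] conjI allI impI)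
      fix n y assume y: "y \<in> closure \<Omega> \<and> norm (x - y) < e / (P + 1)"
      have "norm (w n x - w n y) \<le> R n * norm (x - y)" using lipschitz_zero_outsideD(2)[OF w(1)] by simp
      also have "\<dots> \<le> (P + 1) * norm (x - y)" using R1 by (intro mult_right_mono) auto
      also have "\<dots> < e" using y P0 by (simp add: field_simps)
      finally show "norm (w n x - w n y) < e" .
    qed (use P0 \<open>0 < e\<close> in simp)
  qed blast
  have lim: "(\<lambda>n. w (r n) x) \<longlonglongrightarrow> g x" if "x \<in> \<Omega>" for x
    unfolding LIMSEQ_iff
  proof (intro allI impI)
    fix e :: real assume "0 < e"
    then obtain N where "\<forall>n x. n \<ge> N \<and> x \<in> closure \<Omega> \<longrightarrow> norm (w (r n) x - g x) < e"
      using g(3) by metis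
    moreover have "x \<in> closure \<Omega>" using that closure_subset by (rule subsetD[rotated])
    ultimately show "\<exists>N. \<forall>n\<ge>N. norm (w (r n) x - g x) < e" by auto
  qed
  have Rr: "(\<lambda>n. R (r n)) \<longlonglongrightarrow> P" using LIMSEQ_subseq_LIMSEQ[OF Rlim g(2)] by (simp add: o_def)
  have g0: "0 \<le> g x" if "x \<in> \<Omega>" for x
    by (rule LIMSEQ_le_const[OF lim[OF that]]) (use w(3)[OF that] in auto)
  have gP: "g x \<le> P * bdist x" if "x \<in> \<Omega>" for x
  proof (rule LIMSEQ_le[OF lim[OF that] tendsto_mult_right[OF Rr]])
    show "\<exists>N. \<forall>n\<ge>N. w (r n) x \<le> R (r n) * bdist x"
      using wR[of _ x] abs_ge_self order_trans by blast
  qed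
  have gc: "continuous_on \<Omega> g" using g(1) closure_subset continuous_on_subset by blast
  interpret finite_measure "lebesgue_on \<Omega>" using lmeasurable\<Omega> by (intro finite_measure_lebesgue_on)
  have gm: "g \<in> borel_measurable (lebesgue_on \<Omega>)"
    using gc sets\<Omega> by (intro continuous_imp_measurable_on_sets_lebesgue) auto
  have gL2: "g \<in> L2 \<Omega>"
  proof (rule L2_bounded[OF gm lmeasurable\<Omega>])
    fix x assume x: "x \<in> \<Omega>"
    show "\<bar>g x\<bar> \<le> P * B" using g0[OF x] gP[OF x] mult_left_mono[OF B P0, of x] by simp
  qed
  have wm: "w k \<in> borel_measurable (lebesgue_on \<Omega>)" for k using L2_D(1)[OF wL2] .
  have bm: "bdist \<in> borel_measurable (lebesgue_on \<Omega>)" using L2_D(1)[OF bdist_L2] .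
  have i1: "(\<lambda>n. LINT x|lebesgue_on \<Omega>. w (r n) x * w (r n) x) \<longlonglongrightarrow> (LINT x|lebesgue_on \<Omega>. g x * g x)"
  proof (rule integral_dominated_convergence[where w = "\<lambda>x. ((P + 1) * B) * ((P + 1) * B)"])
    show "AE x in lebesgue_on \<Omega>. (\<lambda>n. w (r n) x * w (r n) x) \<longlonglongrightarrow> g x * g x"
      by (intro AE_I2 tendsto_mult lim) auto
    show "AE x in lebesgue_on \<Omega>. norm (w (r n) x * w (r n) x) \<le> ((P + 1) * B) * ((P + 1) * B)" for n
      unfolding norm_mult using wB P0 B0 by (intro AE_I2 mult_mono) auto
  qed (use gm wm in auto)
  have i2: "(\<lambda>n. LINT x|lebesgue_on \<Omega>. w (r n) x * (R (r n) * bdist x - w (r n) x)) \<longlonglongrightarrow> (LINT x|lebesgue_on \<Omega>. g x * (P * bdist x - g x))"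
  proof (rule integral_dominated_convergence[where w = "\<lambda>x. ((P + 1) * B) * (2 * ((P + 1) * B))"])
    show "AE x in lebesgue_on \<Omega>. (\<lambda>n. w (r n) x * (R (r n) * bdist x - w (r n) x)) \<longlonglongrightarrow> g x * (P * bdist x - g x)"
      by (intro AE_I2 tendsto_mult tendsto_diff lim Rr tendsto_const) auto
    have "\<bar>R (r n) * bdist x - w (r n) x\<bar> \<le> 2 * ((P + 1) * B)" for n x
    proof -
      have "R (r n) * bdist x \<le> (P + 1) * B" "0 \<le> R (r n) * bdist x"
        using R1 B R0 bdist_nonneg P0 by (auto intro!: mult_mono)
      then show ?thesis using wB[of "r n" x] by (auto simp: abs_le_iff)
    qed
    then show "AE x in lebesgue_on \<Omega>. norm (w (r n) x * (R (r n) * bdist x - w (r n) x)) \<le> ((P + 1) * B) * (2 * ((P + 1) * B))" for n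
      unfolding norm_mult using wB P0 B0 by (intro AE_I2 mult_mono) auto
  qed (use gm wm bm in auto)
  have ww: "(LINT x|lebesgue_on \<Omega>. w k x * w k x) = 1" for k
  proof -
    have "(LINT x|lebesgue_on \<Omega>. w k x * w k x) = cls (w k) \<bullet> cls (w k)"
      by (simp add: inner_l2_class[OF sets\<Omega> wL2 wL2] L2_inner_def)
    also have "\<dots> = (norm (cls (w k)))\<^sup>2" by (simp add: power2_norm_eq_inner)
    also have "\<dots> = 1" using Unz[of k] by (simp add: w(2))
    finally show ?thesis .
  qed
  have gg: "(LINT x|lebesgue_on \<Omega>. g x * g x) = 1"
    using i1 unfolding ww by (simp add: LIMSEQ_const_iff)
  have RL2: "(\<lambda>x. c * bdist x) \<in> L2 \<Omega>" for c by (rule L2_scale[OF bdist_L2])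
  have clsR: "cls (\<lambda>x. c * bdist x) = c *\<^sub>R cls bdist" for c by (rule l2_class_scale[OF sets\<Omega> bdist_L2])
  \<comment> \<open>The integral is nonnegative, so the varying factor \<open>R k\<close> in
    \<open>defect_le\<close> may be lowered to the fixed positive number
    \<open>1 / dnorm\<close>.\<close>
  have defect: "(1 / dnorm) * (LINT x|lebesgue_on \<Omega>. w k x * (R k * bdist x - w k x))
      \<le> sqrt ((P + 1 / real (Suc k))\<^sup>2 - (R k)\<^sup>2) * ((P + 1) * dnorm)" for k
  proof -
    have eq: "(LINT x|lebesgue_on \<Omega>. w k x * (R k * bdist x - w k x)) = cls (w k) \<bullet> (R k *\<^sub>R cls bdist - cls (w k))"
      using inner_l2_class[OF sets\<Omega> wL2[of k] L2_diff[OF RL2[of "R k"] wL2[of k]]]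
        l2_class_diff[OF sets\<Omega> RL2[of "R k"] wL2[of k]] by (simp add: L2_inner_def clsR)
    have d0: "0 \<le> w k x * (R k * bdist x - w k x)" if "x \<in> \<Omega>" for x
      using w(3)[OF that, of k] wR[of k x] by (intro mult_nonneg_nonneg) auto
    have "0 \<le> (LINT x|lebesgue_on \<Omega>. w k x * (R k * bdist x - w k x))"
      using d0 by (intro integral_nonneg_AE AE_I2) auto
    then have "(1 / dnorm) * (LINT x|lebesgue_on \<Omega>. w k x * (R k * bdist x - w k x))
        \<le> R k * (cls (w k) \<bullet> (R k *\<^sub>R cls bdist - cls (w k)))"
      unfolding eq using lam by (intro mult_right_mono)
    also have "\<dots> \<le> sqrt ((norm (p k))\<^sup>2 - (R k)\<^sup>2) * norm (R k *\<^sub>R cls bdist - cls (w k))"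
      using defect_le[OF Unz tp(3), of k] unfolding w(2) R_def .
    also have "\<dots> \<le> sqrt ((P + 1 / real (Suc k))\<^sup>2 - (R k)\<^sup>2) * ((P + 1) * dnorm)"
    proof (rule mult_mono)
      have "(norm (p k))\<^sup>2 \<le> (P + 1 / real (Suc k))\<^sup>2" using tp(4) by (intro power_mono) auto
      then show "sqrt ((norm (p k))\<^sup>2 - (R k)\<^sup>2) \<le> sqrt ((P + 1 / real (Suc k))\<^sup>2 - (R k)\<^sup>2)" by simp
      have "norm (R k *\<^sub>R cls bdist - cls (w k)) = norm (cls (\<lambda>x. R k * bdist x - w k x))"
        using l2_class_diff[OF sets\<Omega> RL2[of "R k"] wL2[of k]] by (simp add: clsR)
      also have "\<dots> \<le> norm (cls (\<lambda>x. R k * bdist x))"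
      proof (rule norm_cls_mono[OF L2_diff[OF RL2 wL2] RL2], rule AE_I2)
        fix x assume "x \<in> space (lebesgue_on \<Omega>)"
        then have "x \<in> \<Omega>" by simp
        then show "\<bar>R k * bdist x - w k x\<bar> \<le> \<bar>R k * bdist x\<bar>" using w(3)[of x k] wR[of k x] by auto
      qed
      also have "\<dots> = R k * dnorm" using R0 by (simp add: clsR dnorm_def)
      also have "\<dots> \<le> (P + 1) * dnorm" using R1 dnorm_pos by (intro mult_right_mono) auto
      finally show "norm (R k *\<^sub>R cls bdist - cls (w k)) \<le> (P + 1) * dnorm" .
      have "(R k)\<^sup>2 \<le> (P + 1 / real (Suc k))\<^sup>2"
        using order_trans[OF Rp tp(4), of k] R0 by (intro power_mono)
      then show "0 \<le> sqrt ((P + 1 / real (Suc k))\<^sup>2 - (R k)\<^sup>2)" by simp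
    qed simp
    finally show ?thesis .
  qed
  have "(\<lambda>n. (1 / dnorm) * (LINT x|lebesgue_on \<Omega>. w (r n) x * (R (r n) * bdist x - w (r n) x))) \<longlonglongrightarrow>
      (1 / dnorm) * (LINT x|lebesgue_on \<Omega>. g x * (P * bdist x - g x))"
    by (intro tendsto_mult tendsto_const i2)
  moreover have "(\<lambda>n. sqrt ((P + 1 / real (Suc (r n)))\<^sup>2 - (R (r n))\<^sup>2) * ((P + 1) * dnorm)) \<longlonglongrightarrow> sqrt ((P + 0)\<^sup>2 - P\<^sup>2) * ((P + 1) * dnorm)"
    using LIMSEQ_subseq_LIMSEQ[OF inv0 g(2)] by (intro tendsto_intros Rr) (simp add: o_def)
  ultimately have "(1 / dnorm) * (LINT x|lebesgue_on \<Omega>. g x * (P * bdist x - g x)) \<le> sqrt ((P + 0)\<^sup>2 - P\<^sup>2) * ((P + 1) * dnorm)"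
    by (rule LIMSEQ_le) (use defect in auto)
  then have le0: "(LINT x|lebesgue_on \<Omega>. g x * (P * bdist x - g x)) \<le> 0"
    using dnorm_pos by (simp add: field_simps)
  have nn0: "0 \<le> g x * (P * bdist x - g x)" if "x \<in> \<Omega>" for x using g0[OF that] gP[OF that] by simp
  have gi: "integrable (lebesgue_on \<Omega>) (\<lambda>x. g x * (P * bdist x - g x))"
    by (intro L2_integrable_mult gL2 L2_diff RL2)
  have nnA: "AE x in lebesgue_on \<Omega>. 0 \<le> g x * (P * bdist x - g x)" using nn0 by (intro AE_I2) simp
  have "(LINT x|lebesgue_on \<Omega>. g x * (P * bdist x - g x)) = 0"
    using le0 integral_nonneg_AE[OF nnA] by (rule antisym)
  then have "AE x in lebesgue_on \<Omega>. g x * (P * bdist x - g x) = 0"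
    unfolding integral_nonneg_eq_0_iff_AE[OF gi nnA] .
  then have AEz: "AE x in lebesgue_on \<Omega>. g x * (P * bdist x - g x) \<in> {0}" by (simp only: singleton_iff)
  have bc: "continuous_on \<Omega> bdist" using lipschitz_zero_outsideD(4)[OF lzo_bdist] continuous_on_subset by blast
  have dich: "g x = 0 \<or> g x = P * bdist x" if "x \<in> \<Omega>" for x
  proof -
    have "g x * (P * bdist x - g x) \<in> {0}"
      by (rule continuous_AE_mem_imp_mem[OF _ _ AEz that]) (use gc bc in \<open>auto intro!: continuous_intros\<close>)
    then show ?thesis by auto
  qed
  have Pp: "P > 0" using Ppos dnorm_pos by (meson divide_pos_pos less_le_trans zero_less_one)
  \<comment> \<open>A continuous function with values in \<open>{0, 1}\<close> on a connected set is
    constant. The value 0 would make \<open>g\<close> vanish, against its unit norm.\<close>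
  define h where "h = (\<lambda>x. g x / (P * bdist x))"
  have h01: "h x = 0 \<or> h x = 1" if "x \<in> \<Omega>" for x
    using dich[OF that] bdist_pos[OF that] Pp by (auto simp: h_def)
  have "continuous_on \<Omega> h"
    unfolding h_def
  proof (intro continuous_intros gc bc ballI)
    fix x assume "x \<in> \<Omega>"
    then show "P * bdist x \<noteq> 0" using bdist_pos[of x] Pp by simp
  qed
  moreover have "finite (h ` \<Omega>)" by (rule finite_subset[of _ "{0, 1}"]) (use h01 in auto)
  ultimately have "h constant_on \<Omega>" using conn by (intro continuous_finite_range_constant)
  then obtain c where c: "\<And>x. x \<in> \<Omega> \<Longrightarrow> h x = c" by (auto simp: constant_on_def)
  have "c = 0 \<or> c = 1" using \<Omega>(3) c h01 by auto
  moreover have "g x = c * (P * bdist x)" if "x \<in> \<Omega>" for x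
    using c[OF that] bdist_pos[OF that] Pp by (simp add: h_def field_simps)
  then have "(LINT x|lebesgue_on \<Omega>. g x * g x) = (LINT x|lebesgue_on \<Omega>. (c * P)\<^sup>2 * (bdist x * bdist x))"
    by (intro Bochner_Integration.integral_cong) (auto simp: power2_eq_square)
  then have "1 = (c * P)\<^sup>2 * (cls bdist \<bullet> cls bdist)"
    using gg by (simp add: inner_l2_class[OF sets\<Omega> bdist_L2 bdist_L2] L2_inner_def)
  then have "(c * P * dnorm)\<^sup>2 = 1" by (simp add: dnorm_def power_mult_distrib power2_norm_eq_inner)
  ultimately have "(P * dnorm)\<^sup>2 = 1" by auto
  then have "P * dnorm = 1" using mult_nonneg_nonneg[OF P0 less_imp_le[OF dnorm_pos]] by (auto simp: power2_eq_1_iff)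
  then show ?thesis using dnorm_pos by (simp add: field_simps)
qed


section \<open>Convergence of the normalized flow\<close>

lemma extinction_time_eq:
  assumes T: "0 < T" "U T = 0" "\<And>t. 0 \<le> t \<Longrightarrow> t < T \<Longrightarrow> U t \<noteq> 0"
  shows "extinction_time \<Omega> u = ereal T"
proof -
  have eq: "{t. 0 < t \<and> (AE x in lebesgue_on \<Omega>. u t x = 0)} = {t. 0 < t \<and> U t = 0}"
    using l2_class_eq_0_iff[OF sets\<Omega> u_L2] by (auto simp: U_def)
  show ?thesis
    unfolding extinction_time_def eq
  proof (rule antisym)
    show "Inf (ereal ` {t. 0 < t \<and> U t = 0}) \<le> ereal T" using T by (intro Inf_lower) auto
    show "ereal T \<le> Inf (ereal ` {t. 0 < t \<and> U t = 0})"
      using T(3) by (intro Inf_greatest) (force simp: not_less[symmetric])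
  qed
qed

text \<open>Since \<open>0 \<le> U t \<le> L d\<close>, the inequality \<open>\<langle>R d, w\<rangle> \<ge> \<langle>w, w\<rangle> = 1\<close> holds for
  \<open>R = L / norm (U t)\<close> and \<open>w = U t / norm (U t)\<close>.\<close>

lemma profile_distance_le:
  assumes nn: "AE x in lebesgue_on \<Omega>. 0 \<le> u t x" and t: "0 < t" "U t \<noteq> 0" and g: "good t p L"
    and p: "norm p \<le> 1 / dnorm + \<epsilon>"
  shows "norm (U t /\<^sub>R norm (U t) - (1 / dnorm) *\<^sub>R cls bdist) \<le> sqrt ((1 + \<epsilon> * dnorm)\<^sup>2 - 1) + \<epsilon> * dnorm"
proof -
  define R where "R = L / norm (U t)"
  obtain w where w: "lzo R w" "cls w = U t /\<^sub>R norm (U t)" "\<And>x. x \<in> \<Omega> \<Longrightarrow> 0 \<le> w x"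
    using good_representative[OF nn t g] unfolding R_def by blast
  have wL2: "w \<in> L2 \<Omega>" using w(1) by (rule lzo_L2)
  have RL2: "(\<lambda>x. R * bdist x) \<in> L2 \<Omega>" by (rule L2_scale[OF bdist_L2])
  have lam: "1 / dnorm \<le> R"
  proof -
    have "1 / dnorm * norm (U t) \<le> L" using g by (intro lipc_poincare) (simp add: flow_at_def)
    then show ?thesis using t by (simp add: R_def field_simps)
  qed
  have Rle: "R \<le> 1 / dnorm + \<epsilon>" using good_slope_le[OF t(2) g] p by (simp add: R_def)
  have R0: "0 \<le> R" using lipschitz_zero_outsideD(1)[OF w(1)] .
  have nw: "cls w \<bullet> cls w = 1" using t by (simp add: w(2) dot_square_norm)
  have Rd: "cls (\<lambda>x. R * bdist x) = R *\<^sub>R cls bdist" by (rule l2_class_scale[OF sets\<Omega> bdist_L2])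
  have "cls w \<bullet> cls w \<le> cls (\<lambda>x. R * bdist x) \<bullet> cls w"
  proof (rule inner_cls_mono[OF wL2 wL2 RL2 wL2], rule AE_I2)
    fix x assume "x \<in> space (lebesgue_on \<Omega>)"
    then show "w x * w x \<le> R * bdist x * w x"
      using w(3)[of x] lzo_le_bdist[OF w(1), of x] by (intro mult_right_mono) auto
  qed
  then have ge: "1 \<le> R * (cls bdist \<bullet> cls w)" using nw by (simp add: Rd)
  have "(norm (R *\<^sub>R cls bdist - cls w))\<^sup>2 = (R * dnorm)\<^sup>2 - 2 * (R * (cls bdist \<bullet> cls w)) + 1"
    unfolding power2_norm_eq_inner dnorm_def power_mult_distrib
    using nw by (simp add: inner_diff_left inner_diff_right inner_commute[of "cls w" "cls bdist"] power2_eq_square algebra_simps)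
  also have "\<dots> \<le> (R * dnorm)\<^sup>2 - 1" using ge by simp
  also have "\<dots> \<le> (1 + \<epsilon> * dnorm)\<^sup>2 - 1"
  proof -
    have "R * dnorm \<le> (1 / dnorm + \<epsilon>) * dnorm" using Rle dnorm_pos by (intro mult_right_mono) auto
    also have "\<dots> = 1 + \<epsilon> * dnorm" using dnorm_pos by (simp add: field_simps)
    finally show ?thesis using R0 dnorm_pos by (simp add: power_mono)
  qed
  finally have 1: "norm (R *\<^sub>R cls bdist - cls w) \<le> sqrt ((1 + \<epsilon> * dnorm)\<^sup>2 - 1)"
    by (rule real_le_rsqrt)
  have "norm (R *\<^sub>R cls bdist - (1 / dnorm) *\<^sub>R cls bdist) = (R - 1 / dnorm) * dnorm"
    using lam by (simp add: dnorm_def flip: scaleR_left_diff_distrib)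
  also have "\<dots> \<le> \<epsilon> * dnorm" using Rle dnorm_pos by (intro mult_right_mono) auto
  finally have 2: "norm (R *\<^sub>R cls bdist - (1 / dnorm) *\<^sub>R cls bdist) \<le> \<epsilon> * dnorm" .
  have "cls w - (1 / dnorm) *\<^sub>R cls bdist = - (R *\<^sub>R cls bdist - cls w) + (R *\<^sub>R cls bdist - (1 / dnorm) *\<^sub>R cls bdist)"
    by simp
  then have "norm (cls w - (1 / dnorm) *\<^sub>R cls bdist) \<le> norm (R *\<^sub>R cls bdist - cls w) + norm (R *\<^sub>R cls bdist - (1 / dnorm) *\<^sub>R cls bdist)"
    using norm_triangle_ineq[of "- (R *\<^sub>R cls bdist - cls w)"] by (metis norm_minus_cancel)
  then show ?thesis using 1 2 w(2) by simp
qed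

lemma good_times_dense:
  assumes "0 \<le> a" "a < b" obtains t p L where "a < t" "t < b" "good t p L"
proof -
  obtain Z where Z: "negligible Z" "\<And>t. 0 < t \<Longrightarrow> t \<notin> Z \<Longrightarrow> \<exists>p L. good t p L"
    using exceptional_set by blast
  have "\<not> negligible {a<..<b}" using assms by (intro open_not_negligible) auto
  then obtain t where "t \<in> {a<..<b}" "t \<notin> Z" using Z(1) negligible_subset by blast
  then show ?thesis using Z(2)[of t] that assms by auto
qed

lemma profile_convergence:
  assumes conn: "connected \<Omega>" and f: "AE x in lebesgue_on \<Omega>. 0 \<le> f x"
    and T: "0 < T" "U T = 0" "\<And>t. 0 \<le> t \<Longrightarrow> t < T \<Longrightarrow> U t \<noteq> 0"
  shows "((\<lambda>t. norm (U t /\<^sub>R norm (U t) - (1 / dnorm) *\<^sub>R cls bdist)) \<longlongrightarrow> 0) (at_left T)"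
proof -
  note nn = nonneg_preserved[OF f]
  obtain P where P: "0 \<le> P"
    "\<And>\<epsilon>. \<epsilon> > 0 \<Longrightarrow> \<exists>t0. 0 < t0 \<and> t0 < T \<and> (\<forall>t p L. t0 < t \<and> t < T \<and> good t p L \<longrightarrow> norm p \<le> P + \<epsilon>)"
    "\<And>\<epsilon> t0. \<epsilon> > 0 \<Longrightarrow> 0 < t0 \<Longrightarrow> t0 < T \<Longrightarrow> \<exists>t p L. t0 < t \<and> t < T \<and> good t p L \<and> P - \<epsilon> \<le> L / norm (U t)"
    using asymptotic_slope[OF T] by metis
  have Peq: "P = 1 / dnorm" by (rule slope_eq[OF conn nn T(1,3) P])
  define e where "e = (\<lambda>t. norm (U t /\<^sub>R norm (U t) - (1 / dnorm) *\<^sub>R cls bdist))"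
  have ec: "continuous_on {0<..<T} e"
  proof -
    have "continuous_on {0<..<T} U" using U_continuous by (rule continuous_on_subset) auto
    then show ?thesis unfolding e_def using T(3) by (intro continuous_intros) auto
  qed
  have ev: "\<exists>t0. 0 < t0 \<and> t0 < T \<and> (\<forall>t. t0 < t \<and> t < T \<longrightarrow> e t \<le> sqrt ((1 + \<epsilon> * dnorm)\<^sup>2 - 1) + \<epsilon> * dnorm)" if eps: "\<epsilon> > 0" for \<epsilon>
  proof -
    let ?\<beta> = "sqrt ((1 + \<epsilon> * dnorm)\<^sup>2 - 1) + \<epsilon> * dnorm"
    obtain t0 where t0: "0 < t0" "t0 < T" "\<And>t p L. t0 < t \<Longrightarrow> t < T \<Longrightarrow> good t p L \<Longrightarrow> norm p \<le> 1 / dnorm + \<epsilon>"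
      using P(2)[OF eps] Peq by blast
    \<comment> \<open>\<open>profile_distance_le\<close> speaks of good times only. A violation at
      \<open>t\<close> would persist on a neighbourhood by continuity of \<open>e\<close>, and that
      neighbourhood contains a good time.\<close>
    have "e t \<le> ?\<beta>" if t: "t0 < t" "t < T" for t
    proof (rule ccontr)
      assume n: "\<not> e t \<le> ?\<beta>"
      have "open ({t0<..<T} \<inter> e -` {?\<beta><..})"
        by (intro continuous_open_preimage continuous_on_subset[OF ec]) (use t0 in auto)
      moreover have "t \<in> {t0<..<T} \<inter> e -` {?\<beta><..}" using t n by auto
      ultimately obtain d where d: "d > 0" "ball t d \<subseteq> {t0<..<T} \<inter> e -` {?\<beta><..}"
        unfolding open_contains_ball by blast
      have sub: "s \<in> {t0<..<T} \<inter> e -` {?\<beta><..}" if "t < s" "s < t + d" for s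
        using d(2) that by (auto simp: dist_real_def subset_iff)
      obtain s p L where s: "t < s" "s < t + d" "good s p L"
        using good_times_dense[of t "t + d"] t t0 d(1) by auto
      have s': "t0 < s" "s < T" "e s > ?\<beta>" using sub[OF s(1,2)] by auto
      then have "e s \<le> ?\<beta>"
        unfolding e_def using t0 s(3) T(3)[of s] by (intro profile_distance_le[OF nn]) auto
      then show False using s' by simp
    qed
    then show ?thesis using t0 by blast
  qed
  have "((\<lambda>\<epsilon>. sqrt ((1 + \<epsilon> * dnorm)\<^sup>2 - 1) + \<epsilon> * dnorm) \<longlongrightarrow> sqrt ((1 + 0 * dnorm)\<^sup>2 - 1) + 0 * dnorm) (at_right 0)"
    by (intro tendsto_intros)
  then have lim: "((\<lambda>\<epsilon>. sqrt ((1 + \<epsilon> * dnorm)\<^sup>2 - 1) + \<epsilon> * dnorm) \<longlongrightarrow> 0) (at_right 0)" by simp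
  have "(e \<longlongrightarrow> 0) (at_left T)"
  proof (rule tendstoI)
    fix \<eta> :: real assume "\<eta> > 0"
    have "\<forall>\<^sub>F \<epsilon> in at_right 0. sqrt ((1 + \<epsilon> * dnorm)\<^sup>2 - 1) + \<epsilon> * dnorm < \<eta>"
      using order_tendstoD(2)[OF lim \<open>\<eta> > 0\<close>] .
    then obtain b where b: "b > 0" "\<And>\<epsilon>. 0 < \<epsilon> \<Longrightarrow> \<epsilon> < b \<Longrightarrow> sqrt ((1 + \<epsilon> * dnorm)\<^sup>2 - 1) + \<epsilon> * dnorm < \<eta>"
      unfolding eventually_at_right_field by auto
    obtain t0 where t0: "0 < t0" "t0 < T" "\<And>t. t0 < t \<Longrightarrow> t < T \<Longrightarrow> e t \<le> sqrt ((1 + b/2 * dnorm)\<^sup>2 - 1) + b/2 * dnorm"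
      using ev[of "b/2"] b(1) by auto
    have "dist (e t) 0 < \<eta>" if "t0 < t" "t < T" for t
      using t0(3)[OF that] b(2)[of "b/2"] b(1) by (simp add: e_def dist_real_def)
    then show "\<forall>\<^sub>F t in at_left T. dist (e t) 0 < \<eta>"
      unfolding eventually_at_left_field using t0 by blast
  qed
  then show ?thesis by (simp add: e_def)
qed

lemma L2_norm_profile:
  assumes "0 \<le> t"
  shows "L2_norm \<Omega> (\<lambda>x. u t x / L2_norm \<Omega> (u t) - c * infdist x (frontier \<Omega>)) = norm (U t /\<^sub>R norm (U t) - c *\<^sub>R cls bdist)"
proof -
  have ut: "u t \<in> L2 \<Omega>" using u_L2[OF assms] .
  have d: "(\<lambda>x. c * bdist x) \<in> L2 \<Omega>" by (rule L2_scale[OF bdist_L2])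
  have n: "L2_norm \<Omega> (u t) = norm (U t)" by (simp add: U_def norm_l2_class[OF sets\<Omega> ut])
  have "L2_norm \<Omega> (\<lambda>x. u t x / L2_norm \<Omega> (u t) - c * infdist x (frontier \<Omega>)) = L2_norm \<Omega> (\<lambda>x. u t x / norm (U t) - c * bdist x)"
    unfolding n unfolding L2_norm_def L2_inner_def
  proof (intro arg_cong[where f = sqrt] Bochner_Integration.integral_cong refl)
    fix x assume "x \<in> space (lebesgue_on \<Omega>)"
    then have "infdist x (frontier \<Omega>) = bdist x"
      using infdist_Compl_eq_infdist_frontier[OF \<Omega>(1,2)] by (simp add: bdist_def)
    then show "(u t x / norm (U t) - c * infdist x (frontier \<Omega>)) * (u t x / norm (U t) - c * infdist x (frontier \<Omega>)) =
       (u t x / norm (U t) - c * bdist x) * (u t x / norm (U t) - c * bdist x)" by simp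
  qed
  also have "\<dots> = norm (cls (\<lambda>x. u t x / norm (U t) - c * bdist x))"
    by (simp add: norm_l2_class[OF sets\<Omega> L2_diff[OF L2_divide[OF ut] d]])
  also have "cls (\<lambda>x. u t x / norm (U t) - c * bdist x) = U t /\<^sub>R norm (U t) - c *\<^sub>R cls bdist"
    unfolding l2_class_diff[OF sets\<Omega> L2_divide[OF ut] d] l2_class_divide[OF sets\<Omega> ut] l2_class_scale[OF sets\<Omega> bdist_L2]
    by (simp add: U_def)
  finally show ?thesis .
qed

end

theorem theorem2p15:
  fixes \<Omega> :: "(real ^ 'n) set"
    and f :: "real ^ 'n \<Rightarrow> real"
    and u :: "real \<Rightarrow> real ^ 'n \<Rightarrow> real"
  assumes "open \<Omega>" and "connected \<Omega>" and "\<Omega> \<noteq> {}" and "bounded \<Omega>"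
    and "f \<in> L2 \<Omega>"
    and "AE x in lebesgue_on \<Omega>. 0 \<le> f x"
    and "\<not> (AE x in lebesgue_on \<Omega>. f x = 0)"
    and "L2_gradient_flow \<Omega> (grad_sup_functional \<Omega>) f u"
  shows "\<exists>T::real. extinction_time \<Omega> u = ereal T \<and>
    (\<exists>c::real. ((\<lambda>t. L2_norm \<Omega> (\<lambda>x. u t x / L2_norm \<Omega> (u t) - c * infdist x (frontier \<Omega>)))
       \<longlongrightarrow> 0) (at_left T))"
proof -
  interpret gradient_flow \<Omega> f u
    using assms by unfold_locales
  have u0: "AE x in lebesgue_on \<Omega>. u 0 x = f x" using assms(8) by (simp add: L2_gradient_flow_def)
  have "\<not> (AE x in lebesgue_on \<Omega>. u 0 x = 0)"
  proof
    assume "AE x in lebesgue_on \<Omega>. u 0 x = 0"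
    with u0 have "AE x in lebesgue_on \<Omega>. f x = 0" by eventually_elim simp
    then show False using assms(7) by simp
  qed
  then have "U 0 \<noteq> 0" unfolding U_def using l2_class_eq_0_iff[OF sets\<Omega> u_L2] by simp
  then obtain T where T: "0 < T" "U T = 0" "\<And>t. 0 \<le> t \<Longrightarrow> t < T \<Longrightarrow> U t \<noteq> 0"
    using extinction by metis
  \<comment> \<open>The multiple is \<open>1 / dnorm\<close>, which gives the limit unit norm. The
    identity is claimed for times in \<open>(0, T)\<close>, where \<open>u t\<close> is square
    integrable.\<close>
  have "\<forall>\<^sub>F t in at_left T. norm (U t /\<^sub>R norm (U t) - (1 / dnorm) *\<^sub>R cls bdist) =
      L2_norm \<Omega> (\<lambda>x. u t x / L2_norm \<Omega> (u t) - 1 / dnorm * infdist x (frontier \<Omega>))"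
    unfolding eventually_at_left_field using T(1) L2_norm_profile[where c = "1 / dnorm"] by (intro exI[of _ 0]) (simp del: times_divide_eq_left)
  moreover have "((\<lambda>t. norm (U t /\<^sub>R norm (U t) - (1 / dnorm) *\<^sub>R cls bdist)) \<longlongrightarrow> 0) (at_left T)"
    by (rule profile_convergence[OF assms(2,6) T])
  ultimately have "((\<lambda>t. L2_norm \<Omega> (\<lambda>x. u t x / L2_norm \<Omega> (u t) - 1 / dnorm * infdist x (frontier \<Omega>))) \<longlongrightarrow> 0) (at_left T)"
    by (rule Lim_transform_eventually[rotated])
  moreover have "extinction_time \<Omega> u = ereal T" by (rule extinction_time_eq[OF T])
  ultimately show ?thesis by blast
qed

end
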